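(* Let $m$ be even, let $p,q>0$ be constants, and let $\mathcal{F}_\pm$ denote one of the two Clifford-Fourier transforms $\mathcal{F}_+$, $\mathcal{F}_-$ on $\mathbb{R}^m$. Let $f:\mathbb{R}^m\to Cl_{0,m}$ be a measurable function such that, for some positive constant $C$, $$\|f(x)\|_c\leq C e^{-p\|x\|_c^2}\quad (x\in\mathbb{R}^m)\qquad\text{and}\qquad \|\mathcal{F}_\pm(f)(\lambda)\|_c\leq C e^{-q\|\lambda\|_c^2}\quad(\lambda\in\mathbb{R}^m).$$ Then: (i) If $pq>\frac14$, then $f=0$. (ii) If $pq=\frac14$, then $f(x)=A e^{-p\|x\|_c^2}$, where $A$ is a constant. (iii) If $pq<\frac14$, then there are infinitely many functions $f$ satisfying the two displayed assumptions.
   Context: $Cl_{0,m}$ is the real Clifford algebra generated by $e_1,\dots,e_m$ with $e_ie_j=-e_je_i$ for $i\ne j$ and $e_i^2=-1$. Every element is $x=\sum_A x_A e_A$, where $e_A$ runs over the basis $\{1,e_i,e_ie_j\ (i<j),\dots,e_1\cdots e_m\}$, with norm $\|x\|_c=(\sum_A |x_A|^2)^{1/2}$ (the same formula is used for complex coefficients). A vector $x=(x_1,\dots,x_m)\in\mathbb{R}^m$ is identified with $\sum_i x_ie_i$, so $\|x\|_c$ is its Euclidean norm. Constants multiplying Clifford-valued functions are constants in the algebra. Equality of measurable functions is understood almost everywhere. Put $\langle x,y\rangle=\sum_j x_jy_j$ and $\Gamma_y=-\sum_{j<k}e_je_k(y_j\partial_{y_k}-y_k\partial_{y_j})$. The kernels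 are $K_\pm(x,y)=e^{\mp i\frac{\pi}{2}\Gamma_y}e^{-i\langle x,y\rangle}$, where $e^{\mp i\frac{\pi}{2}\Gamma_y}$ acts on each homogeneous term in $y$ of the power series of $e^{-i\langle x,y\rangle}$ ($\Gamma_y$ preserves the finite-dimensional space of homogeneous Clifford-valued polynomials of each degree in $y$). The Clifford-Fourier transform is $$\mathcal{F}_\pm(f)(y)=(2\pi)^{-m/2}\int_{\mathbb{R}^m}K_\pm(x,y)f(x)\,dx,$$ defined for measurable $f$ with $\int_{\mathbb{R}^m}(1+\|y\|_c)^{\frac{m-2}{2}}\|f(y)\|_c\,dy<\infty$. *)

theory Defs
  imports "HOL-Probability.Probability"
begin

text \<open>
  The dimension \<open>m\<close> is \<open>CARD('n)\<close> for a linearly ordered finite index type \<open>'n\<close>. An element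
  \<open>\<Sum>\<^sub>A x\<^sub>A e\<^sub>A\<close> of the Clifford algebra over the coefficient ring \<open>'k\<close> is the vector of its
  coefficients, indexed by the subsets \<open>A\<close> of the index type: \<open>real ^ 'n set\<close> is \<open>Cl\<^bsub>0,m\<^esub>\<close>
  and \<open>complex ^ 'n set\<close> is its complexification. Then \<open>norm\<close> is \<open>(\<Sum>\<^sub>A \<bar>x\<^sub>A\<bar>\<^sup>2)\<^bsup>1/2\<^esup>\<close>. The instance
  \<open>(*)\<close> on vectors is the componentwise product, not the Clifford product.
\<close>

type_synonym 'n point = "(real, 'n) vec"
type_synonym 'n clifford = "(real, 'n set) vec"
type_synonym 'n cclifford = "(complex, 'n set) vec"

definition blade :: "'n::{finite,linorder} set \<Rightarrow> 'k::comm_ring_1 ^ 'n set"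
  where "blade A = axis A 1"

abbreviation gen :: "'n::{finite,linorder} \<Rightarrow> 'k::comm_ring_1 ^ 'n set"
  where "gen i \<equiv> blade {i}"

text \<open>
  Sorting the word \<open>e\<^sub>A e\<^sub>B\<close> costs one sign for each pair \<open>i \<in> A\<close>, \<open>j \<in> B\<close> with \<open>j < i\<close>, and one
  further sign for each square \<open>e\<^sub>i e\<^sub>i = -1\<close>, \<open>i \<in> A \<inter> B\<close>, so that
  \<open>e\<^sub>A e\<^sub>B = blade_sign A B e\<^sub>C\<close>, where \<open>C\<close> is the symmetric difference of \<open>A\<close> and \<open>B\<close>.
\<close>

definition blade_sign :: "'n::{finite,linorder} set \<Rightarrow> 'n set \<Rightarrow> 'k::comm_ring_1"
  where "blade_sign A B = (-1) ^ card {(i, j). i \<in> A \<and> j \<in> B \<and> j \<le> i}"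

definition cl_mult :: "'k::comm_ring_1 ^ 'n::{finite,linorder} set \<Rightarrow> 'k ^ 'n set \<Rightarrow> 'k ^ 'n set"
    (infixl "\<odot>" 70)
  where "a \<odot> b = (\<Sum>A\<in>UNIV. \<Sum>B\<in>UNIV. (a $ A * b $ B * blade_sign A B) *s blade (sym_diff A B))"

definition cl_complexify :: "'n::{finite,linorder} clifford \<Rightarrow> 'n cclifford"
  where "cl_complexify a = (\<chi> A. complex_of_real (a $ A))"

subsection \<open>The defining relations of the Clifford algebra\<close>

lemma blade_sign_eq_prod:
  "blade_sign A B = (\<Prod>i\<in>A. \<Prod>j\<in>B. if j \<le> i then - 1 else (1::'k::comm_ring_1))"
proof -
  have "(\<Prod>i\<in>A. \<Prod>j\<in>B. if j \<le> i then - 1 else (1::'k)) =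
        (\<Prod>p\<in>A \<times> B. if snd p \<le> fst p then - 1 else 1)"
    by (simp add: prod.cartesian_product case_prod_beta)
  also have "\<dots> = (\<Prod>p\<in>{p \<in> A \<times> B. snd p \<le> fst p}. - 1)"
    by (rule prod.inter_filter [symmetric]) simp
  also have "{p \<in> A \<times> B. snd p \<le> fst p} = {(i, j). i \<in> A \<and> j \<in> B \<and> j \<le> i}"
    by auto
  finally show ?thesis
    by (simp add: blade_sign_def)
qed

lemma prod_sym_diff:
  fixes g :: "'n::finite \<Rightarrow> 'k::comm_ring_1"
  assumes "\<And>i. g i * g i = 1"
  shows "prod g (sym_diff A B) = prod g A * prod g B"
proof -
  have 1: "prod g (A \<inter> B) * prod g (A \<inter> B) = 1"
    by (simp add: prod.distrib [symmetric] assms)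
  have "prod g A = prod g (A - B) * prod g (A \<inter> B)"
    by (subst prod.union_disjoint [symmetric]) (auto intro: arg_cong)
  moreover have "prod g B = prod g (B - A) * prod g (A \<inter> B)"
    by (subst prod.union_disjoint [symmetric]) (auto intro: arg_cong)
  moreover have "prod g (sym_diff A B) = prod g (A - B) * prod g (B - A)"
    by (rule prod.union_disjoint) auto
  ultimately have "prod g A * prod g B =
      prod g (sym_diff A B) * (prod g (A \<inter> B) * prod g (A \<inter> B))"
    by (simp add: mult_ac)
  with 1 show ?thesis by simp
qed

lemma blade_sign_sym_diff_left:
  "blade_sign (sym_diff A B) C = blade_sign A C * (blade_sign B C :: 'k::comm_ring_1)"
  unfolding blade_sign_eq_prod
  by (rule prod_sym_diff) (auto simp: prod.distrib [symmetric] intro!: prod.neutral)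

lemma blade_sign_sym_diff_right:
  "blade_sign A (sym_diff B C) = blade_sign A B * (blade_sign A C :: 'k::comm_ring_1)"
  unfolding blade_sign_eq_prod prod.distrib [symmetric]
  by (intro prod.cong refl prod_sym_diff) auto

lemma cl_mult_add_left: "(a + b) \<odot> c = a \<odot> c + b \<odot> c"
  by (simp add: cl_mult_def distrib_right vector_sadd_rdistrib sum.distrib)

lemma cl_mult_add_right: "a \<odot> (b + c) = a \<odot> b + a \<odot> c"
  by (simp add: cl_mult_def distrib_left distrib_right vector_sadd_rdistrib sum.distrib)

lemma smult_sum: "c *s (\<Sum>i\<in>I. v i) = (\<Sum>i\<in>I. c *s (v i :: 'k::comm_ring_1 ^ 'b))"
  by (simp add: vec_eq_iff sum_distrib_left)

lemma cl_mult_smult_left: "(s *s a) \<odot> b = s *s (a \<odot> b)"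
  by (simp add: cl_mult_def smult_sum vector_smult_assoc mult.assoc)

lemma cl_mult_smult_right: "a \<odot> (s *s b) = s *s (a \<odot> b)"
  by (simp add: cl_mult_def smult_sum vector_smult_assoc mult_ac)

lemma cl_mult_zero_left [simp]: "0 \<odot> b = 0"
  by (simp add: cl_mult_def)

lemma cl_mult_zero_right [simp]: "a \<odot> 0 = 0"
  by (simp add: cl_mult_def)

lemma cl_mult_sum_left: "(\<Sum>i\<in>I. v i) \<odot> b = (\<Sum>i\<in>I. v i \<odot> b)"
  by (induction I rule: infinite_finite_induct) (simp_all add: cl_mult_add_left)

lemma cl_mult_sum_right: "a \<odot> (\<Sum>i\<in>I. v i) = (\<Sum>i\<in>I. a \<odot> v i)"
  by (induction I rule: infinite_finite_induct) (simp_all add: cl_mult_add_right)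

lemma cl_expansion: "(\<Sum>A\<in>UNIV. (a $ A) *s blade A) = a"
  by (simp add: blade_def basis_expansion)

lemma blade_mult: "blade A \<odot> blade B = blade_sign A B *s blade (sym_diff A B)"
proof -
  have "((blade A $ C * blade B $ D * blade_sign C D) *s blade (sym_diff C D) :: 'a ^ 'b set) =
        (if D = B then if C = A then blade_sign A B *s blade (sym_diff A B) else 0 else 0)"
    for C D :: "'b set"
    by (simp add: blade_def axis_def)
  then show ?thesis
    by (simp add: cl_mult_def)
qed

lemma cl_mult_assoc: "(a \<odot> b) \<odot> c = a \<odot> (b \<odot> c)"
proof -
  have *: "(blade A \<odot> blade B) \<odot> blade C = blade A \<odot> (blade B \<odot> blade C)"
    for A B C :: "'b set"
  proof -
    have "sym_diff (sym_diff A B) C = sym_diff A (sym_diff B C)" by auto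
    then show ?thesis
      by (simp only: blade_mult cl_mult_smult_left cl_mult_smult_right vector_smult_assoc
            blade_sign_sym_diff_left blade_sign_sym_diff_right mult_ac)
  qed
  have "((\<Sum>A\<in>UNIV. (a $ A) *s blade A) \<odot> (\<Sum>B\<in>UNIV. (b $ B) *s blade B)) \<odot>
          (\<Sum>C\<in>UNIV. (c $ C) *s blade C) =
        (\<Sum>A\<in>UNIV. (a $ A) *s blade A) \<odot>
          ((\<Sum>B\<in>UNIV. (b $ B) *s blade B) \<odot> (\<Sum>C\<in>UNIV. (c $ C) *s blade C))"
    by (simp only: cl_mult_sum_left cl_mult_sum_right cl_mult_smult_left cl_mult_smult_right *
          smult_sum)
  then show ?thesis by (simp only: cl_expansion)
qed

lemma cl_mult_one_left: "blade {} \<odot> a = a"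
proof -
  have "blade {} \<odot> (\<Sum>A\<in>UNIV. (a $ A) *s blade A) = (\<Sum>A\<in>UNIV. (a $ A) *s blade A)"
    by (simp add: cl_mult_sum_right cl_mult_smult_right blade_mult blade_sign_def)
  then show ?thesis by (simp only: cl_expansion)
qed

lemma cl_mult_one_right: "a \<odot> blade {} = a"
proof -
  have "(\<Sum>A\<in>UNIV. (a $ A) *s blade A) \<odot> blade {} = (\<Sum>A\<in>UNIV. (a $ A) *s blade A)"
    by (simp add: cl_mult_sum_left cl_mult_smult_left blade_mult blade_sign_def)
  then show ?thesis by (simp only: cl_expansion)
qed

lemma gen_square: "gen i \<odot> gen i = - blade {}"
  by (simp add: blade_mult blade_sign_eq_prod vec_eq_iff)

lemma gen_anticommute: "i \<noteq> j \<Longrightarrow> gen i \<odot> gen j = - (gen j \<odot> gen i)"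
  by (cases i j rule: linorder_cases)
     (auto simp: blade_mult blade_sign_eq_prod vec_eq_iff insert_Diff_if insert_commute)

lemma blade_insert_less:
  assumes "\<And>j. j \<in> A \<Longrightarrow> i < j"
  shows "blade (insert i A) = gen i \<odot> blade A"
proof -
  have "sym_diff {i} A = insert i A" using assms by fastforce
  moreover have "{(k, j). k \<in> {i} \<and> j \<in> A \<and> j \<le> k} = {}" using assms by fastforce
  ultimately show ?thesis
    by (simp only: blade_mult blade_sign_def card.empty power_0 vector_smult_lid)
qed

subsection \<open>The Clifford-Fourier transforms\<close>

definition gamma_op ::
    "('n::{finite,linorder} point \<Rightarrow> 'n cclifford) \<Rightarrow> 'n point \<Rightarrow> 'n cclifford"
  where "gamma_op g y =
    - (\<Sum>(j, k)\<in>{(j, k). j < k}. gen j \<odot> gen k \<odot>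
         (y $ j *\<^sub>R frechet_derivative g (at y) (axis k 1)
        - y $ k *\<^sub>R frechet_derivative g (at y) (axis j 1)))"

text \<open>
  The exponential series of \<open>c \<Gamma>\<close>, to be applied to homogeneous polynomials \<open>g\<close>. The iterates
  \<open>\<Gamma>\<^sup>n g\<close> then stay in a finite-dimensional space of polynomials, in which pointwise
  convergence is convergence of the coefficients.
\<close>

definition exp_gamma ::
    "complex \<Rightarrow> ('n::{finite,linorder} point \<Rightarrow> 'n cclifford) \<Rightarrow> 'n point \<Rightarrow> 'n cclifford"
  where "exp_gamma c g y = (\<Sum>n. (c ^ n / fact n) *s (gamma_op ^^ n) g y)"

text \<open>
  The degree \<open>k\<close> term in \<open>y\<close> of the power series of \<open>exp (-i \<langle>x, y\<rangle>)\<close>.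
\<close>

definition plane_wave_term ::
    "nat \<Rightarrow> 'n::{finite,linorder} point \<Rightarrow> 'n point \<Rightarrow> 'n cclifford"
  where "plane_wave_term k x y = ((- \<i> * complex_of_real (x \<bullet> y)) ^ k / fact k) *s blade {}"

definition cft_kernel ::
    "complex \<Rightarrow> 'n::{finite,linorder} point \<Rightarrow> 'n point \<Rightarrow> 'n cclifford"
  where "cft_kernel c x y = (\<Sum>k. exp_gamma c (plane_wave_term k x) y)"

definition cft_kernel_plus :: "'n::{finite,linorder} point \<Rightarrow> 'n point \<Rightarrow> 'n cclifford"
  where "cft_kernel_plus = cft_kernel (- \<i> * complex_of_real (pi / 2))"

definition cft_kernel_minus :: "'n::{finite,linorder} point \<Rightarrow> 'n point \<Rightarrow> 'n cclifford"
  where "cft_kernel_minus = cft_kernel (\<i> * complex_of_real (pi / 2))"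

definition kernel_transform ::
    "('n::{finite,linorder} point \<Rightarrow> 'n point \<Rightarrow> 'n cclifford) \<Rightarrow> ('n point \<Rightarrow> 'n clifford) \<Rightarrow>
      'n point \<Rightarrow> 'n cclifford"
  where "kernel_transform K f y =
    (2 * pi) powr (- real CARD('n) / 2) *\<^sub>R (LINT x|lebesgue. K x y \<odot> cl_complexify (f x))"

text \<open>
  The class of functions on which the transforms are mathematically defined. The functions
  \<open>cft_plus\<close> and \<open>cft_minus\<close> are total, but \<open>hardy_bounds\<close> with \<open>p > 0\<close> implies \<open>cft_domain\<close>;
  see \<open>hardy_bounds_imp_cft_domain\<close>.
\<close>

definition cft_domain :: "('n::{finite,linorder} point \<Rightarrow> 'n clifford) \<Rightarrow> bool"
  where "cft_domain f \<longleftrightarrow> f \<in> borel_measurable lebesgue \<and>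
    integrable lebesgue (\<lambda>y. (1 + norm y) powr ((real CARD('n) - 2) / 2) * norm (f y))"

definition cft_plus ::
    "('n::{finite,linorder} point \<Rightarrow> 'n clifford) \<Rightarrow> 'n point \<Rightarrow> 'n cclifford"
  where "cft_plus = kernel_transform cft_kernel_plus"

definition cft_minus ::
    "('n::{finite,linorder} point \<Rightarrow> 'n clifford) \<Rightarrow> 'n point \<Rightarrow> 'n cclifford"
  where "cft_minus = kernel_transform cft_kernel_minus"

definition hardy_bounds ::
    "(('n::{finite,linorder} point \<Rightarrow> 'n clifford) \<Rightarrow> 'n point \<Rightarrow> 'n cclifford) \<Rightarrow> real \<Rightarrow> real \<Rightarrow>
      ('n point \<Rightarrow> 'n clifford) \<Rightarrow> bool"
  where "hardy_bounds F p q f \<longleftrightarrow>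
    f \<in> borel_measurable lebesgue \<and>
    (\<exists>C>0. (\<forall>x. norm (f x) \<le> C * exp (- p * (norm x)\<^sup>2)) \<and>
           (\<forall>l. norm (F f l) \<le> C * exp (- q * (norm l)\<^sup>2)))"

text \<open>
  Equality almost everywhere, used to count functions: a single function could otherwise be
  changed on null sets to give infinitely many.
\<close>

definition ae_equal :: "(('n::finite point \<Rightarrow> 'b) \<times> ('n point \<Rightarrow> 'b)) set"
  where "ae_equal = {(f, g). AE x in lebesgue. f x = g x}"

lemma integrable_gaussian:
  fixes a :: real
  assumes "a > 0"
  shows "integrable lborel (\<lambda>x::'a::euclidean_space. exp (- a * (norm x)\<^sup>2))"
proof -
  define \<sigma> where "\<sigma> = sqrt (1 / (2 * a))"
  have "\<sigma> > 0" using assms by (simp add: \<sigma>_def)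
  have \<sigma>: "\<sigma>\<^sup>2 = 1 / (2 * a)" using assms by (simp add: \<sigma>_def)
  have "integrable lborel (\<lambda>t. sqrt (2 * pi * \<sigma>\<^sup>2) * normal_density 0 \<sigma> t)"
    by (intro integrable_mult_right integrable_normal_density \<open>\<sigma> > 0\<close>)
  also have "(\<lambda>t. sqrt (2 * pi * \<sigma>\<^sup>2) * normal_density 0 \<sigma> t) = (\<lambda>t. exp (- a * t\<^sup>2))"
    using assms \<open>\<sigma> > 0\<close> by (auto simp: normal_density_def \<sigma>)
  finally have 1: "(\<integral>\<^sup>+t. ennreal (exp (- a * t\<^sup>2)) \<partial>lborel) < \<infinity>"
    by (simp add: integrable_iff_bounded)
  have "ennreal (exp (- a * (norm x)\<^sup>2)) = (\<Prod>b\<in>Basis. ennreal (exp (- a * (x \<bullet> b)\<^sup>2)))" for x :: 'a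
  proof -
    have "(norm x)\<^sup>2 = (\<Sum>b\<in>Basis. (x \<bullet> b)\<^sup>2)"
      unfolding power2_norm_eq_inner by (subst euclidean_inner) (simp add: power2_eq_square)
    then show ?thesis
      by (simp add: prod_ennreal exp_sum [symmetric] sum_distrib_left)
  qed
  then have "(\<integral>\<^sup>+x. ennreal (exp (- a * (norm x)\<^sup>2)) \<partial>(lborel :: 'a measure)) =
      (\<Prod>b\<in>(Basis :: 'a set). \<integral>\<^sup>+t. ennreal (exp (- a * t\<^sup>2)) \<partial>lborel)"
    by (simp only:) (rule nn_integral_lborel_prod; simp)
  also have "\<dots> < \<infinity>"
    using 1 by (simp add: less_top [symmetric] ennreal_prod_eq_top power_eq_top_ennreal)
  finally show ?thesis
    by (simp add: integrable_iff_bounded)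
qed

lemma hardy_bounds_imp_cft_domain:
  assumes f: "hardy_bounds F p q (f :: 'n::{finite,linorder} point \<Rightarrow> 'n clifford)" and "p > 0"
  shows "cft_domain f"
proof -
  define s where "s = (real CARD('n) - 2) / 2"
  obtain C where C: "C > 0" "\<And>x. norm (f x) \<le> C * exp (- p * (norm x)\<^sup>2)"
    and [measurable]: "f \<in> borel_measurable lebesgue"
    using f by (auto simp: hardy_bounds_def)
  define b where "b = \<bar>s\<bar>"
  define M where "M = exp (b\<^sup>2 / (2 * p))"
  have weight: "(1 + r) powr s * exp (- p * r\<^sup>2) \<le> M * exp (- (p / 2) * r\<^sup>2)" if "r \<ge> 0" for r :: real
  proof -
    have "(1 + r) powr s = exp (s * ln (1 + r))"
      using that by (simp add: powr_def)
    also have "\<dots> \<le> exp (b * r)"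
    proof -
      have "s * ln (1 + r) \<le> b * ln (1 + r)"
        using that by (intro mult_right_mono) (auto simp: b_def)
      also have "\<dots> \<le> b * r"
        using that ln_add_one_self_le_self [of r] by (intro mult_left_mono) (auto simp: b_def)
      finally show ?thesis by simp
    qed
    finally have "(1 + r) powr s * exp (- p * r\<^sup>2) \<le> exp (b * r) * exp (- p * r\<^sup>2)"
      by (intro mult_right_mono) auto
    also have "\<dots> = exp (b * r - p * r\<^sup>2)"
      by (simp add: exp_add [symmetric])
    also have "\<dots> \<le> exp (b\<^sup>2 / (2 * p) + - (p / 2) * r\<^sup>2)"
    proof -
      have "0 \<le> (p * r - b)\<^sup>2 / (2 * p)" using \<open>p > 0\<close> by simp
      also have "\<dots> = b\<^sup>2 / (2 * p) + (p / 2) * r\<^sup>2 - b * r"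
        using \<open>p > 0\<close> by (simp add: field_simps power2_eq_square)
      finally show ?thesis by (simp add: field_simps)
    qed
    finally show ?thesis by (simp only: exp_add M_def)
  qed
  have "integrable lborel (\<lambda>x::'n point. C * M * exp (- (p / 2) * (norm x)\<^sup>2))"
    using \<open>p > 0\<close> by (intro integrable_mult_right integrable_gaussian) simp
  then have "integrable lebesgue (\<lambda>x::'n point. C * M * exp (- (p / 2) * (norm x)\<^sup>2))"
    by (subst integrable_completion) auto
  moreover have "(\<lambda>y. (1 + norm y) powr s * norm (f y)) \<in> borel_measurable lebesgue"
  proof -
    have "(\<lambda>y::'n point. (1 + norm y) powr s) \<in> borel_measurable lebesgue"
      by (rule measurable_completion) measurable
    then show ?thesis by measurable
  qed
  moreover have "norm ((1 + norm y) powr s * norm (f y)) \<le> norm (C * M * exp (- (p / 2) * (norm y)\<^sup>2))"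
    for y
  proof -
    have "(1 + norm y) powr s * norm (f y) \<le> C * ((1 + norm y) powr s * exp (- p * (norm y)\<^sup>2))"
      using mult_left_mono [OF C(2) [of y], of "(1 + norm y) powr s"] by (simp add: mult_ac)
    also have "\<dots> \<le> C * (M * exp (- (p / 2) * (norm y)\<^sup>2))"
      using C(1) by (intro mult_left_mono weight) auto
    finally show ?thesis using C(1) by (simp add: M_def abs_mult mult_ac)
  qed
  ultimately have "integrable lebesgue (\<lambda>y. (1 + norm y) powr s * norm (f y))"
    by (rule Bochner_Integration.integrable_bound [OF _ _ AE_I2])
  then show ?thesis by (simp add: cft_domain_def s_def)
qed

end

theory Submission
  imports Defs "HOL-Complex_Analysis.Complex_Analysis"
begin

text \<open>
  The transform is \<open>exp (c \<Gamma>)\<close>, with \<open>c\<close> imaginary, applied to the homogeneous terms of the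
  classical Fourier integral. A homogeneous polynomial of degree \<open>k\<close> is the evaluation of a tensor
  of order \<open>k\<close>. On tensors \<open>\<Gamma>\<close> is self-adjoint, so \<open>exp (c \<Gamma>)\<close> is an isometry, which gives the sharp
  bound \<open>(\<bar>x\<bar> \<bar>y\<bar>)\<^sup>k / k!\<close> for the terms of the kernel. Hence for a unit vector \<open>e\<close> the transform
  extends in \<open>t e\<close> to an entire function of \<open>t\<close> that is at most a polynomial times
  \<open>exp (\<bar>t\<bar>\<^sup>2 / 4p)\<close>, and Hardy's theorem in one variable (by Phragmen and Lindelof) makes it
  a multiple of \<open>exp (- t\<^sup>2 / 4p)\<close>. The factor is \<open>\<integral> f\<close>, independently of \<open>e\<close>. If \<open>\<integral> f\<close> is zero, then all
  moments of \<open>f\<close> are zero and so is \<open>f\<close>. This is the case if \<open>pq > 1/4\<close>, and for \<open>pq = 1/4\<close> after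
  subtracting a multiple of the Gaussian, which \<open>\<Gamma>\<close> leaves alone because its moments are radial.
\<close>

subsection \<open>Tensors and homogeneous polynomials\<close>

text \<open>The estimate of the kernel terms must not contain a factor K^k: it would enlarge the
  growth exponent 1/(4p) of the entire extension and lose the case pq = 1/4. Summing norms in the
  series of exp (c \<open>\<Gamma>\<close>) does produce such a factor, because the norm of
  \<open>\<Gamma>\<close> on degree k grows with k. The l^2 norm of tensors avoids it: evaluation at
  y is an inner product with the k-th tensor power of y, whose norm is exactly |y|^k, so an isometry
  of tensors costs nothing. The price is that tensors are not unique, since only their symmetric
  part is seen by evaluation; the inverse of exp (c \<open>\<Gamma>\<close>) is therefore taken on
  evaluations. The extension to complex t is controlled by the sum of the norms of the terms, which
  depends on |t| only. Integrating exp (r |x| - p |x|^2) over the space costs a power of r beyond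
  exp (r^2 / 4p). Hardy's theorem tolerates this power off the real line, because the decay on the
  real line carries none.\<close>

definition words :: "nat \<Rightarrow> 'n::finite list set"
  where "words k = {w. length w = k}"

lemma finite_words [simp]: "finite (words k)"
  using finite_lists_length_eq [of "UNIV :: 'a set" k] by (simp add: words_def)

lemma words_0 [simp]: "words 0 = {[]}"
  by (auto simp: words_def)

lemma sum_words_Suc: "(\<Sum>w\<in>words (Suc k). f w) = (\<Sum>i\<in>UNIV. \<Sum>w\<in>words k. f (i # w))"
proof -
  have "bij_betw (\<lambda>(i, w). i # w) (UNIV \<times> words k) (words (Suc k))"
    by (auto simp: bij_betw_def inj_on_def words_def length_Suc_conv image_iff)
  from sum.reindex_bij_betw [OF this, of f, symmetric]
  have "(\<Sum>w\<in>words (Suc k). f w) = (\<Sum>(i, w)\<in>UNIV \<times> words k. f (i # w))"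
    by (simp add: case_prod_beta)
  then show ?thesis by (simp add: sum.cartesian_product)
qed

definition tens :: "'n::finite point \<Rightarrow> 'n list \<Rightarrow> real"
  where "tens x w = prod_list (map (($) x) w)"

lemma tens_Nil [simp]: "tens x [] = 1"
  and tens_Cons [simp]: "tens x (i # w) = x $ i * tens x w"
  by (simp_all add: tens_def)

text \<open>Expanding the product of k copies of the inner product gives one summand for each word.
  So \<open>tens x\<close> is the k-th tensor power of x, of l^2 norm |x|^k, and each power of an
  inner product is an evaluation.\<close>

lemma sum_tens_mult: "(\<Sum>w\<in>words k. tens x w * tens y w) = (x \<bullet> y) ^ k"
proof (induction k)
  case (Suc k)
  have "(\<Sum>w\<in>words (Suc k). tens x w * tens y w) =
      (\<Sum>i\<in>UNIV. x $ i * y $ i * (\<Sum>w\<in>words k. tens x w * tens y w))"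
    by (simp add: sum_words_Suc sum_distrib_left mult_ac)
  then show ?case
    by (simp add: Suc inner_vec_def sum_distrib_right)
qed simp

lemma tens_scaleR: "w \<in> words k \<Longrightarrow> tens (t *\<^sub>R x) w = t ^ k * tens x w"
  by (induction w arbitrary: k) (auto simp: words_def)

lemma abs_tens_le: "w \<in> words k \<Longrightarrow> \<bar>tens x w\<bar> \<le> norm x ^ k"
proof (induction w arbitrary: k)
  case (Cons i w)
  then have "\<bar>tens x w\<bar> \<le> norm x ^ length w" by (simp add: words_def)
  with Cons.prems component_le_norm_cart [of x i] show ?case
    by (auto simp: words_def abs_mult intro!: mult_mono)
qed (simp add: words_def)

text \<open>Tensors are functions on all lists, of which only the entries at words of length k
  count. Symmetry is not imposed, so different tensors may give the same polynomial.\<close>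

definition tens_eval :: "nat \<Rightarrow> ('n::finite list \<Rightarrow> 'v::real_vector) \<Rightarrow> 'n point \<Rightarrow> 'v"
  where "tens_eval k a y = (\<Sum>w\<in>words k. tens y w *\<^sub>R a w)"

lemma tens_eval_0 [simp]: "tens_eval 0 a y = a []"
  by (simp add: tens_eval_def)

lemma tens_eval_Suc: "tens_eval (Suc k) a y = (\<Sum>i\<in>UNIV. y $ i *\<^sub>R tens_eval k (\<lambda>w. a (i # w)) y)"
  by (simp add: tens_eval_def sum_words_Suc scaleR_sum_right)

lemma tens_eval_scaleR: "tens_eval k a (t *\<^sub>R y) = t ^ k *\<^sub>R tens_eval k a y"
  by (simp add: tens_eval_def tens_scaleR scaleR_sum_right)

lemma tens_eval_add: "tens_eval k (\<lambda>w. a w + b w) y = tens_eval k a y + tens_eval k b y"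
  by (simp add: tens_eval_def scaleR_add_right sum.distrib)

lemma tens_eval_diff: "tens_eval k (\<lambda>w. a w - b w) y = tens_eval k a y - tens_eval k b y"
  by (simp add: tens_eval_def scaleR_diff_right sum_subtractf)

lemma tens_eval_linear:
  "linear T \<Longrightarrow> tens_eval k (\<lambda>w. T (a w)) y = T (tens_eval k a y)"
  by (simp add: tens_eval_def linear_sum linear_cmul)

lemma tens_eval_sum: "tens_eval k (\<lambda>w. \<Sum>i\<in>I. a i w) y = (\<Sum>i\<in>I. tens_eval k (a i) y)"
  unfolding tens_eval_def scaleR_sum_right by (rule sum.swap)

text \<open>Cauchy-Schwarz against the tensor power of y. The absence of a constant depending on k
  is what the sharp kernel bound rests on.\<close>

lemma norm_tens_eval_le:
  fixes a :: "'n::finite list \<Rightarrow> 'v::real_inner"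
  shows "norm (tens_eval k a y) \<le> norm y ^ k * sqrt (\<Sum>w\<in>words k. a w \<bullet> a w)"
proof -
  have "norm (tens_eval k a y) \<le> (\<Sum>w\<in>words k. \<bar>tens y w\<bar> * \<bar>norm (a w)\<bar>)"
    unfolding tens_eval_def by (rule order.trans [OF norm_sum]) simp
  also have "\<dots> \<le> L2_set (tens y) (words k) * L2_set (\<lambda>w. norm (a w)) (words k)"
    by (rule L2_set_mult_ineq)
  also have "L2_set (tens y) (words k) = norm y ^ k"
    using sum_tens_mult [of y y k]
    by (simp add: L2_set_def power2_eq_square real_sqrt_power norm_eq_sqrt_inner)
  also have "L2_set (\<lambda>w. norm (a w)) (words k) = sqrt (\<Sum>w\<in>words k. a w \<bullet> a w)"
    by (simp add: L2_set_def power2_norm_eq_inner)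
  finally show ?thesis .
qed

lemma sum_if_const: "(\<Sum>w\<in>A. if P then f w else 0) = (if P then sum f A else 0)"
  by simp

text \<open>
  The derivation of the tensor algebra that corresponds to \<open>y\<^sub>j \<partial>\<^sub>l - y\<^sub>l \<partial>\<^sub>j\<close>; see \<open>tens_eval_rot\<close>.
\<close>

primrec rot :: "'n \<Rightarrow> 'n \<Rightarrow> 'n list \<Rightarrow> ('n list \<Rightarrow> 'v::real_vector) \<Rightarrow> 'v"
  where
    "rot j l [] a = 0"
  | "rot j l (i # w) a =
       (if i = j then a (l # w) else 0) - (if i = l then a (j # w) else 0) + rot j l w (\<lambda>v. a (i # v))"

lemma rot_linear:
  assumes T: "linear T"
  shows "rot j l w (\<lambda>v. T (a v)) = T (rot j l w a)"
proof (induction w arbitrary: a)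
  case (Cons i w)
  then show ?case
    by (simp add: linear_add [OF T] linear_diff [OF T] linear_0 [OF T] linear_neg [OF T])
qed (simp add: linear_0 [OF T])

lemma rot_sum: "rot j l w (\<lambda>v. \<Sum>i\<in>I. a i v) = (\<Sum>i\<in>I. rot j l w (a i))"
proof (induction w arbitrary: a)
  case (Cons i w)
  then show ?case by (simp add: sum.distrib sum_subtractf sum_negf)
qed simp

text \<open>Each of the k positions contributes at most two terms, and at a fixed position the
  exchange of one letter for the other never uses an entry of \<open>a\<close> twice.\<close>

lemma sum_norm_rot_le:
  fixes a :: "'n::finite list \<Rightarrow> 'v::real_normed_vector"
  shows "(\<Sum>w\<in>words k. norm (rot j l w a)) \<le> 2 * real k * (\<Sum>w\<in>words k. norm (a w))"
proof (induction k arbitrary: a)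
  case (Suc k)
  define S where "S = (\<Sum>w\<in>words (Suc k). norm (a w))"
  have part: "(\<Sum>w\<in>words k. norm (a (i # w))) \<le> S" for i
    unfolding S_def sum_words_Suc by (rule member_le_sum) (auto intro: sum_nonneg)
  have "(\<Sum>w\<in>words (Suc k). norm (rot j l w a)) \<le>
     (\<Sum>i\<in>UNIV. \<Sum>w\<in>words k. (if i = j then norm (a (l # w)) else 0) +
        (if i = l then norm (a (j # w)) else 0) + norm (rot j l w (\<lambda>v. a (i # v))))"
    unfolding sum_words_Suc rot.simps
    by (intro sum_mono order.trans [OF norm_triangle_ineq] add_right_mono order.trans [OF norm_triangle_ineq4])
       auto
  also have "\<dots> = (\<Sum>w\<in>words k. norm (a (l # w))) + (\<Sum>w\<in>words k. norm (a (j # w))) +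
      (\<Sum>i\<in>UNIV. \<Sum>w\<in>words k. norm (rot j l w (\<lambda>v. a (i # v))))"
    by (simp only: sum.distrib sum_if_const sum.delta finite_UNIV finite_class.finite_UNIV if_True UNIV_I)
  also have "\<dots> \<le> S + S + (\<Sum>i\<in>UNIV. 2 * real k * (\<Sum>w\<in>words k. norm (a (i # w))))"
    by (intro add_mono part sum_mono Suc)
  also have "\<dots> = 2 * real (Suc k) * S"
    by (simp add: S_def sum_words_Suc sum_distrib_left [symmetric] algebra_simps)
  finally show ?case by (simp add: S_def)
qed simp

text \<open>In each slot \<open>rot j l\<close> acts by the skew matrix that sends the two
  coordinate directions j and l to each other with opposite signs.\<close>

lemma rot_inner_skew:
  fixes a b :: "'n::finite list \<Rightarrow> 'v::real_inner"
  shows "(\<Sum>w\<in>words k. rot j l w a \<bullet> b w) = - (\<Sum>w\<in>words k. a w \<bullet> rot j l w b)"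
proof (induction k arbitrary: a b)
  case (Suc k)
  have inner_if: "(if P then x else 0) \<bullet> y = (if P then x \<bullet> y else 0)"
    "y \<bullet> (if P then x else 0) = (if P then y \<bullet> x else 0)" for P and x y :: 'v by simp_all
  show ?case
    by (simp only: sum_words_Suc rot.simps inner_add_left inner_add_right inner_diff_left
        inner_diff_right inner_if sum.distrib sum_subtractf sum_if_const sum.delta finite_UNIV
        finite_class.finite_UNIV UNIV_I if_True Suc sum_negf)
qed simp

text \<open>Induction on the order by the product rule, applied to the splitting of a word into
  first letter and tail. Differentiability and the formula are proved together, because the formula
  for order k + 1 needs the derivatives of all tails.\<close>

lemma tens_eval_rot:
  fixes a :: "'n::finite list \<Rightarrow> 'v::real_normed_vector"
  shows "\<exists>D. (tens_eval k a has_derivative D) (at y) \<and>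
    (\<forall>j l. y $ j *\<^sub>R D (axis l 1) - y $ l *\<^sub>R D (axis j 1) = tens_eval k (\<lambda>w. rot j l w a) y)"
proof (induction k arbitrary: a)
  case 0
  have "tens_eval 0 a = (\<lambda>y. a [])" by auto
  then show ?case by (intro exI [of _ "\<lambda>_. 0"]) simp
next
  case (Suc k)
  define D where "D i = (SOME D. (tens_eval k (\<lambda>w. a (i # w)) has_derivative D) (at y) \<and>
    (\<forall>j l. y $ j *\<^sub>R D (axis l 1) - y $ l *\<^sub>R D (axis j 1) =
      tens_eval k (\<lambda>w. rot j l w (\<lambda>w. a (i # w))) y))" for i
  have D: "\<And>i. (tens_eval k (\<lambda>w. a (i # w)) has_derivative D i) (at y)"
    and L: "\<And>i j l. y $ j *\<^sub>R D i (axis l 1) - y $ l *\<^sub>R D i (axis j 1) = tens_eval k (\<lambda>w. rot j l w (\<lambda>w. a (i # w))) y"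
    unfolding D_def using someI_ex [OF Suc] by blast+
  define e where "e i = tens_eval k (\<lambda>w. a (i # w)) y" for i
  define D' where "D' h = (\<Sum>i\<in>UNIV. y $ i *\<^sub>R D i h + h $ i *\<^sub>R e i)" for h
  have nth: "((\<lambda>y. y $ i) has_derivative (\<lambda>h. h $ i)) (at y)" for i
    by (rule bounded_linear_imp_has_derivative [OF bounded_linear_vec_nth])
  have der: "(tens_eval (Suc k) a has_derivative D') (at y)"
    unfolding tens_eval_Suc [abs_def] D'_def e_def
    by (intro has_derivative_sum has_derivative_scaleR nth D)
  have "y $ j *\<^sub>R D' (axis l 1) - y $ l *\<^sub>R D' (axis j 1) = tens_eval (Suc k) (\<lambda>w. rot j l w a) y" for j l
  proof -
    \<comment> \<open>The derivative of the leading factor contributes \<open>e l\<close> and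
      \<open>e j\<close>: these are the terms in which \<open>rot\<close> changes the first letter.
      The derivatives of the tails supply the recursive part of \<open>rot\<close>.\<close>
    have pick: "(\<Sum>i\<in>UNIV. axis l (1::real) $ i *\<^sub>R e i) = e l" for l
      by (simp add: axis_def if_distrib [of "\<lambda>c. c *\<^sub>R _"] cong: if_cong)
    have "y $ j *\<^sub>R D' (axis l 1) - y $ l *\<^sub>R D' (axis j 1) =
      y $ j *\<^sub>R e l - y $ l *\<^sub>R e j +
      (\<Sum>i\<in>UNIV. y $ i *\<^sub>R (y $ j *\<^sub>R D i (axis l 1) - y $ l *\<^sub>R D i (axis j 1)))"
      by (simp add: D'_def sum.distrib pick scaleR_add_right scaleR_sum_right scaleR_diff_right
          sum_subtractf mult.commute)
    also have "\<dots> = y $ j *\<^sub>R e l - y $ l *\<^sub>R e j +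
      (\<Sum>i\<in>UNIV. y $ i *\<^sub>R tens_eval k (\<lambda>w. rot j l w (\<lambda>w. a (i # w))) y)"
      by (simp only: L)
    also have "\<dots> = tens_eval (Suc k) (\<lambda>w. rot j l w a) y"
    proof -
      have if_eval: "tens_eval k (\<lambda>w. if P then f w else 0) y = (if P then tens_eval k f y else 0)"
        for P and f :: "'n list \<Rightarrow> 'v" by (simp add: tens_eval_def)
      have scaleR_if: "c *\<^sub>R (if P then x else 0) = (if P then c *\<^sub>R x else 0)" for P c and x :: 'v
        by simp
      show ?thesis
        by (simp only: tens_eval_Suc rot.simps tens_eval_add tens_eval_diff if_eval scaleR_add_right
            scaleR_diff_right scaleR_if sum.distrib sum_subtractf sum.delta finite_UNIV
            finite_class.finite_UNIV UNIV_I if_True e_def)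
    qed
    finally show ?thesis .
  qed
  with der show ?case by blast
qed

subsection \<open>The angular Dirac operator on tensors\<close>

lemma tens_eval_minus: "tens_eval k (\<lambda>w. - a w) y = - tens_eval k a y"
  by (simp add: tens_eval_def sum_negf)

lemma bounded_bilinear_cl_mult:
  "bounded_bilinear ((\<odot>) :: 'n::{finite,linorder} cclifford \<Rightarrow> 'n cclifford \<Rightarrow> 'n cclifford)"
proof -
  have scaleR: "r *\<^sub>R a = complex_of_real r *s a" for r and a :: "'n cclifford"
    by (simp add: vec_eq_iff complex_eq_iff)
  have "bilinear ((\<odot>) :: 'n cclifford \<Rightarrow> 'n cclifford \<Rightarrow> 'n cclifford)"
    by (auto simp: bilinear_def scaleR cl_mult_add_left cl_mult_add_right cl_mult_smult_left
        cl_mult_smult_right intro!: linearI)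
  then show ?thesis by (simp add: bilinear_conv_bounded_bilinear)
qed

interpretation cl_mult: bounded_bilinear
  "(\<odot>) :: 'n::{finite,linorder} cclifford \<Rightarrow> 'n cclifford \<Rightarrow> 'n cclifford"
  by (rule bounded_bilinear_cl_mult)

lemma linear_smult: "linear (\<lambda>a. c *s (a :: complex ^ 'b))"
  by (rule linearI) (simp_all add: vec_eq_iff algebra_simps)

lemma bounded_linear_smult: "bounded_linear (\<lambda>a. c *s (a :: complex ^ 'b::finite))"
  using linear_smult by (simp add: linear_conv_bounded_linear)

text \<open>The inner product on complex vectors is the real one, the real part of the Hermitian
  product, for which multiplication by \<open>\<i>\<close> is a quarter turn.\<close>

lemma inner_smult_imaginary:
  fixes u v :: "complex ^ 'b::finite"
  assumes "Re c = 0"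
  shows "(c *s u) \<bullet> v = - (u \<bullet> (c *s v))"
  using assms by (simp add: inner_vec_def inner_complex_def sum_negf [symmetric] algebra_simps)

lemma norm_smult: "norm (c *s (a :: complex ^ 'b::finite)) = norm c * norm a"
proof -
  have "norm (c *s a) = L2_set (\<lambda>i. norm c * norm (a $ i)) UNIV"
    by (simp add: norm_vec_def norm_mult)
  then show ?thesis by (simp add: norm_vec_def L2_set_right_distrib [symmetric])
qed

lemma gen_mult_expand:
  "gen j \<odot> a = (\<Sum>B\<in>UNIV. (a $ B * blade_sign {j} B) *s blade (sym_diff {j} B))"
proof -
  have "gen j \<odot> a = gen j \<odot> (\<Sum>B\<in>UNIV. (a $ B) *s blade B)" by (simp only: cl_expansion)
  then show ?thesis
    by (simp only: cl_mult_sum_right cl_mult_smult_right blade_mult vector_smult_assoc)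
qed

lemma gen_mult_nth:
  "(gen j \<odot> a) $ C = - (a $ sym_diff {j} C) * blade_sign {j} C" for a :: "'n::{finite,linorder} cclifford"
proof -
  have "(gen j \<odot> a) $ C = (\<Sum>B\<in>UNIV. if B = sym_diff {j} C then a $ B * blade_sign {j} B else 0)"
    unfolding gen_mult_expand sum_component
    by (intro sum.cong refl) (auto simp: blade_def axis_def)
  also have "\<dots> = a $ sym_diff {j} C * blade_sign {j} (sym_diff {j} C)" by simp
  also have "\<dots> = - (a $ sym_diff {j} C) * blade_sign {j} C"
    unfolding blade_sign_sym_diff_right by (simp add: blade_sign_eq_prod)
  finally show ?thesis .
qed

text \<open>Left multiplication by a generator permutes the blades up to sign, so it is orthogonal;
  its square is -1, so it is skew.\<close>

lemma inner_gen_mult: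
  fixes u v :: "'n::{finite,linorder} cclifford"
  shows "(gen j \<odot> u) \<bullet> v = - (u \<bullet> (gen j \<odot> v))"
proof -
  have sgn: "(- z * blade_sign {j} C) \<bullet> w = - (z \<bullet> (w * blade_sign {j} C))" for C :: "'n set" and z w :: complex
    unfolding blade_sign_def
    by (cases "even (card {(i, k). i \<in> {j} \<and> k \<in> C \<and> k \<le> i})") simp_all
  have inv: "sym_diff {j} (sym_diff {j} B) = B" for B :: "'n set" by auto
  have bij: "bij_betw (sym_diff {j}) UNIV UNIV" for j :: 'n
    by (rule bij_betw_byWitness [of _ "sym_diff {j}"]) auto
  have "(gen j \<odot> u) \<bullet> v = (\<Sum>C\<in>UNIV. - (u $ sym_diff {j} C \<bullet> (v $ C * blade_sign {j} C)))"
    unfolding inner_vec_def gen_mult_nth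
    by (intro sum.cong refl) (simp only: sgn)
  also have "\<dots> = (\<Sum>C\<in>UNIV. - (u $ C \<bullet> (v $ sym_diff {j} C * blade_sign {j} (sym_diff {j} C))))"
    using sum.reindex_bij_betw [OF bij [of j],
      of "\<lambda>C. - (u $ C \<bullet> (v $ sym_diff {j} C * blade_sign {j} (sym_diff {j} C)))"]
    by (simp only: inv)
  also have "\<dots> = - (u \<bullet> (gen j \<odot> v))"
    unfolding blade_sign_sym_diff_right
    by (simp add: inner_vec_def gen_mult_nth sum_negf blade_sign_eq_prod)
  finally show ?thesis .
qed

text \<open>\<open>gamma_op\<close> transported to coefficients: the rotation field becomes
  \<open>rot\<close>, and the bivector multiplies each entry. No derivative is left, so adjoints and
  bounds are statements about finite sums.\<close>

definition gam :: "('n::{finite,linorder} list \<Rightarrow> 'n cclifford) \<Rightarrow> 'n list \<Rightarrow> 'n cclifford"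
  where "gam a w = - (\<Sum>(j, l)\<in>{(j, l). j < l}. gen j \<odot> gen l \<odot> rot j l w a)"

lemma linear_bivector: "linear (\<lambda>u. gen j \<odot> gen l \<odot> (u :: 'n::{finite,linorder} cclifford))"
  using cl_mult.bounded_linear_right bounded_linear.linear by blast

lemma gamma_op_tens_eval: "gamma_op (tens_eval k a) = tens_eval k (gam a)"
proof
  fix y
  obtain D where D: "(tens_eval k a has_derivative D) (at y)"
    and L: "\<And>j l. y $ j *\<^sub>R D (axis l 1) - y $ l *\<^sub>R D (axis j 1) = tens_eval k (\<lambda>w. rot j l w a) y"
    using tens_eval_rot [of k a y] by blast
  have "frechet_derivative (tens_eval k a) (at y) = D"
    using D by (rule frechet_derivative_at [symmetric])
  then have "gamma_op (tens_eval k a) y =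
      - (\<Sum>(j, l)\<in>{(j, l). j < l}. gen j \<odot> gen l \<odot> tens_eval k (\<lambda>w. rot j l w a) y)"
    by (simp only: gamma_op_def L)
  also have "\<dots> = - (\<Sum>(j, l)\<in>{(j, l). j < l}. tens_eval k (\<lambda>w. gen j \<odot> gen l \<odot> rot j l w a) y)"
    by (simp only: tens_eval_linear [OF linear_bivector])
  also have "\<dots> = tens_eval k (gam a) y"
    by (simp add: gam_def [abs_def] tens_eval_sum tens_eval_minus case_prod_beta)
  finally show "gamma_op (tens_eval k a) y = tens_eval k (gam a) y" .
qed

lemma gamma_op_pow_tens_eval: "(gamma_op ^^ n) (tens_eval k a) = tens_eval k ((gam ^^ n) a)"
  by (induction n) (simp_all add: gamma_op_tens_eval)

text \<open>The bivector is a product of two anticommuting skew maps, hence skew. It acts on the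
  values and \<open>rot\<close> on the words, so the two commute, and a product of commuting skew
  maps is self-adjoint.\<close>

lemma gam_inner_self_adjoint:
  "(\<Sum>w\<in>words k. gam a w \<bullet> b w) = (\<Sum>w\<in>words k. a w \<bullet> gam b w)"
proof -
  have "(\<Sum>w\<in>words k. (gen j \<odot> gen l \<odot> rot j l w a) \<bullet> b w) =
      (\<Sum>w\<in>words k. a w \<bullet> (gen j \<odot> gen l \<odot> rot j l w b))" if "j < l" for j l
  proof -
    have *: "(gen j \<odot> gen l \<odot> u) \<bullet> v = - (u \<bullet> (gen j \<odot> gen l \<odot> v))" for u v :: "'a cclifford"
    proof -
      have "(gen j \<odot> gen l \<odot> u) \<bullet> v = u \<bullet> (gen l \<odot> gen j \<odot> v)"
        by (simp add: cl_mult_assoc inner_gen_mult)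
      also have "gen l \<odot> gen j = - (gen j \<odot> gen l)"
        using that by (intro gen_anticommute) auto
      finally show ?thesis by (simp add: cl_mult.minus_left)
    qed
    have "(\<Sum>w\<in>words k. (gen j \<odot> gen l \<odot> rot j l w a) \<bullet> b w) =
        - (\<Sum>w\<in>words k. rot j l w a \<bullet> (gen j \<odot> gen l \<odot> b w))"
      by (simp add: * sum_negf)
    also have "\<dots> = (\<Sum>w\<in>words k. a w \<bullet> (gen j \<odot> gen l \<odot> rot j l w b))"
      by (simp add: rot_inner_skew rot_linear [OF linear_bivector])
    finally show ?thesis .
  qed
  then have "(\<Sum>(j, l)\<in>{(j, l). j < l}. \<Sum>w\<in>words k. (gen j \<odot> gen l \<odot> rot j l w a) \<bullet> b w) =
      (\<Sum>(j, l)\<in>{(j, l). j < l}. \<Sum>w\<in>words k. a w \<bullet> (gen j \<odot> gen l \<odot> rot j l w b))"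
    by (intro sum.cong) auto
  then show ?thesis
    by (simp add: gam_def inner_sum_left inner_sum_right sum_negf case_prod_beta
        sum.swap [of _ _ "words k"])
qed

text \<open>A crude bound, with K depending on k. It serves only for the convergence of exponential
  series at a fixed order; sharp estimates come from \<open>tens_exp_isometry\<close>.\<close>

lemma sum_norm_gam_le:
  "\<exists>K\<ge>0. \<forall>a :: 'n::{finite,linorder} list \<Rightarrow> 'n cclifford.
     (\<Sum>w\<in>words k. norm (gam a w)) \<le> K * (\<Sum>w\<in>words k. norm (a w))"
proof -
  let ?J = "{(j, l :: 'n). j < l}"
  have "\<exists>K\<ge>0. \<forall>u :: 'n cclifford. norm (gen j \<odot> gen l \<odot> u) \<le> norm u * K" for j l :: 'n
    using bounded_linear.nonneg_bounded [OF cl_mult.bounded_linear_right] by blast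
  then obtain M where M: "\<And>j l :: 'n. M j l \<ge> 0"
    "\<And>(j :: 'n) l u :: 'n cclifford. norm (gen j \<odot> gen l \<odot> u) \<le> norm u * M j l" by metis
  define K where "K = (\<Sum>(j, l)\<in>?J. M j l * (2 * real k))"
  have "(\<Sum>w\<in>words k. norm (gam a w)) \<le> K * (\<Sum>w\<in>words k. norm (a w))"
    for a :: "'n list \<Rightarrow> 'n cclifford"
  proof -
    have "(\<Sum>w\<in>words k. norm (gam a w)) \<le> (\<Sum>w\<in>words k. \<Sum>(j, l)\<in>?J. norm (rot j l w a) * M j l)"
      unfolding gam_def norm_minus_cancel
      by (intro sum_mono order.trans [OF norm_sum]) (auto intro: M)
    also have "\<dots> = (\<Sum>(j, l)\<in>?J. M j l * (\<Sum>w\<in>words k. norm (rot j l w a)))"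
      by (subst sum.swap) (simp add: sum_distrib_left case_prod_beta mult.commute)
    also have "\<dots> \<le> (\<Sum>(j, l)\<in>?J. M j l * (2 * real k * (\<Sum>w\<in>words k. norm (a w))))"
      by (intro sum_mono) (auto intro!: mult_left_mono M sum_norm_rot_le)
    also have "\<dots> = K * (\<Sum>w\<in>words k. norm (a w))"
      by (simp add: K_def sum_distrib_right case_prod_beta mult.assoc)
    finally show ?thesis .
  qed
  moreover have "K \<ge> 0" unfolding K_def by (intro sum_nonneg) (auto intro!: mult_nonneg_nonneg M)
  ultimately show ?thesis by blast
qed

text \<open>Formally this is \<open>exp (- T) (exp T) = 1\<close>, with \<open>\<phi> n\<close> in place of \<open>T\<^sup>n\<close>.\<close>

lemma exp_shift_inverse:
  fixes \<phi> :: "nat \<Rightarrow> 'a::banach"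
  assumes bound: "\<And>n. norm (\<phi> n) \<le> M * K ^ n"
  shows "(\<lambda>l. ((- 1) ^ l / fact l) *\<^sub>R (\<Sum>n. (1 / fact n) *\<^sub>R \<phi> (n + l))) sums \<phi> 0"
proof -
  \<comment> \<open>The double series of exp (- T) exp T. Its absolute summability permits summation
    both by rows and along the diagonals n + l = N.\<close>
  define F where "F l n = ((- 1) ^ l / (fact l * fact n)) *\<^sub>R \<phi> (n + l)" for l n :: nat
  have F_le: "norm (F l n) \<le> \<bar>M\<bar> * (\<bar>K\<bar> ^ l / fact l * (\<bar>K\<bar> ^ n / fact n))" for l n
  proof -
    have "M * K ^ (n + l) \<le> \<bar>M\<bar> * \<bar>K\<bar> ^ (n + l)"
      by (metis abs_ge_self abs_mult power_abs)
    with bound [of "n + l"] show ?thesis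
      by (simp add: F_def power_abs divide_right_mono power_add mult_ac)
  qed
  have exp_abs: "((\<lambda>n. \<bar>K\<bar> ^ n / fact n) has_sum exp \<bar>K\<bar>) UNIV"
  proof (rule norm_summable_imp_has_sum)
    have eq: "(\<lambda>n. \<bar>K\<bar> ^ n / fact n) = (\<lambda>n. \<bar>K\<bar> ^ n /\<^sub>R fact n)"
      by (simp add: field_simps)
    show "(\<lambda>n. \<bar>K\<bar> ^ n / fact n) sums exp \<bar>K\<bar>" unfolding eq by (rule exp_converges)
    then show "summable (\<lambda>n. norm (\<bar>K\<bar> ^ n / fact n))" by (simp add: sums_iff)
  qed
  have "(\<lambda>(l, n). \<bar>M\<bar> * (\<bar>K\<bar> ^ l / fact l * (\<bar>K\<bar> ^ n / fact n))) summable_on UNIV \<times> UNIV"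
  proof (rule summable_on_SigmaI)
    fix l
    show "((\<lambda>n. case (l, n) of (l, n) \<Rightarrow> \<bar>M\<bar> * (\<bar>K\<bar> ^ l / fact l * (\<bar>K\<bar> ^ n / fact n)))
        has_sum \<bar>M\<bar> * (\<bar>K\<bar> ^ l / fact l * exp \<bar>K\<bar>)) UNIV"
      unfolding prod.case by (intro has_sum_cmult_right exp_abs)
    show "(\<lambda>l. \<bar>M\<bar> * (\<bar>K\<bar> ^ l / fact l * exp \<bar>K\<bar>)) summable_on UNIV"
      using exp_abs by (intro summable_on_cmult_right summable_on_cmult_left) (auto simp: summable_on_def)
  qed auto
  then have "(\<lambda>z. norm (case z of (l, n) \<Rightarrow> F l n)) summable_on UNIV \<times> UNIV"
    by (rule Infinite_Sum.abs_summable_on_comparison_test') (use F_le in auto)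
  then have sF: "(\<lambda>(l, n). F l n) summable_on UNIV \<times> UNIV" by (rule Infinite_Sum.abs_summable_summable)
  obtain s where s: "((\<lambda>(l, n). F l n) has_sum s) (UNIV \<times> UNIV)"
    using sF by (auto simp: summable_on_def)
  have row: "(F l has_sum ((- 1) ^ l / fact l) *\<^sub>R (\<Sum>n. (1 / fact n) *\<^sub>R \<phi> (n + l))) UNIV" for l
  proof -
    have "(\<lambda>n. F l n) summable_on UNIV"
    proof (rule Infinite_Sum.abs_summable_summable, rule Infinite_Sum.abs_summable_on_comparison_test')
      show "(\<lambda>n. \<bar>M\<bar> * (\<bar>K\<bar> ^ l / fact l * (\<bar>K\<bar> ^ n / fact n))) summable_on UNIV"
        using exp_abs by (intro summable_on_cmult_right) (auto simp: summable_on_def)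
    qed (rule F_le)
    then have "(F l has_sum infsum (F l) UNIV) UNIV" by (rule has_sum_infsum)
    moreover from this have "infsum (F l) UNIV = (\<Sum>n. F l n)"
      by (intro sums_unique has_sum_imp_sums)
    moreover have "(\<Sum>n. F l n) = ((- 1) ^ l / fact l) *\<^sub>R (\<Sum>n. (1 / fact n) *\<^sub>R \<phi> (n + l))"
    proof -
      have "summable (\<lambda>n. fact l *\<^sub>R F l n)"
        using has_sum_imp_sums [OF \<open>(F l has_sum infsum (F l) UNIV) UNIV\<close>]
        by (intro summable_scaleR_right) (simp add: sums_iff)
      then have "summable (\<lambda>n. (- 1) ^ l *\<^sub>R fact l *\<^sub>R F l n)"
        by (rule summable_scaleR_right)
      then have "summable (\<lambda>n. (1 / fact n) *\<^sub>R \<phi> (n + l))"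
        by (simp add: F_def power_add [symmetric])
      from suminf_scaleR_right [OF this, of "(- 1) ^ l / fact l"] show ?thesis
        by (simp add: F_def)
    qed
    ultimately show ?thesis by simp
  qed
  have "((\<lambda>l. ((- 1) ^ l / fact l) *\<^sub>R (\<Sum>n. (1 / fact n) *\<^sub>R \<phi> (n + l))) has_sum s) UNIV"
    by (rule has_sum_SigmaD [OF s]) (use row in auto)
  moreover have "s = \<phi> 0"
  proof -
    \<comment> \<open>On the diagonal n + l = N the terms add up to \<open>\<phi> N\<close> / N!
      times the alternating sum of the binomial coefficients of N, which is zero unless N =
      0.\<close>
    have "((\<lambda>(N, l). F l (N - l)) has_sum s) (SIGMA N:UNIV. {..N})"
      using s by (rule has_sum_reindex_bij_witness
          [where i = "\<lambda>(N, l). (l, N - l)" and j = "\<lambda>(l, n). (n + l, l)", THEN iffD1, rotated -1]) auto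
    then have "((\<lambda>N. \<Sum>l\<le>N. F l (N - l)) has_sum s) UNIV"
      by (rule has_sum_SigmaD) (auto intro: has_sum_finite)
    moreover have "(\<Sum>l\<le>N. F l (N - l)) = (if N = 0 then \<phi> 0 else 0)" for N
    proof -
      have "(\<Sum>l\<le>N. F l (N - l)) = (\<Sum>l\<le>N. ((- 1) ^ l * of_nat (N choose l) / fact N) *\<^sub>R \<phi> N)"
        by (intro sum.cong) (auto simp: F_def binomial_fact field_simps)
      also have "\<dots> = ((\<Sum>l\<le>N. (- 1) ^ l * of_nat (N choose l)) / fact N) *\<^sub>R \<phi> N"
        by (simp add: scaleR_sum_left sum_divide_distrib)
      finally show ?thesis
        using choose_alternating_sum [of N, where ?'a = real] by (cases "N = 0") auto
    qed
    moreover have "((\<lambda>N. if N = 0 then \<phi> 0 else 0) has_sum \<phi> 0) (UNIV :: nat set)"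
      by (rule has_sum_finite_neutralI [of "{0}"]) auto
    ultimately show ?thesis by (simp add: has_sum_unique)
  qed
  ultimately show ?thesis by (simp add: has_sum_imp_sums)
qed

section \<open>Exponentials of multiples of the angular operator on tensors\<close>

definition cgam :: "complex \<Rightarrow> ('n::{finite,linorder} list \<Rightarrow> 'n cclifford) \<Rightarrow> 'n list \<Rightarrow> 'n cclifford"
  where "cgam c a w = c *s gam a w"

definition tens_exp :: "complex \<Rightarrow> ('n::{finite,linorder} list \<Rightarrow> 'n cclifford) \<Rightarrow> 'n list \<Rightarrow> 'n cclifford"
  where "tens_exp c a w = (\<Sum>n. (1 / fact n) *\<^sub>R (cgam c ^^ n) a w)"

lemma scaleR_conv_smult: "r *\<^sub>R a = complex_of_real r *s (a :: complex ^ 'b)"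
  by (simp add: vec_eq_iff complex_eq_iff)

lemma gam_smult: "gam (\<lambda>w. c *s a w) w = c *s gam a w"
  by (simp add: gam_def rot_linear [OF linear_smult] cl_mult_smult_right smult_sum case_prod_beta
      vector_smult_rneg)

text \<open>The bivectors multiply from the left, so right multiplication by a constant commutes
  with everything. This allows the factor f(x), which stands to the right of the kernel, to enter
  the exponential.\<close>

lemma gam_mult_right: "gam (\<lambda>w. a w \<odot> u) w = gam a w \<odot> u"
proof -
  have lin: "linear (\<lambda>a. a \<odot> u)"
    using cl_mult.bounded_linear_left bounded_linear.linear by blast
  show ?thesis
    by (simp add: gam_def rot_linear [OF lin] cl_mult_assoc cl_mult_sum_left case_prod_beta cl_mult.minus_left)
qed

lemma cgam_mult_right: "cgam c (\<lambda>w. a w \<odot> u) = (\<lambda>w. cgam c a w \<odot> u)"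
  by (auto simp: cgam_def [abs_def] gam_mult_right cl_mult_smult_left)

lemma cgam_pow_mult_right: "(cgam c ^^ n) (\<lambda>w. a w \<odot> u) = (\<lambda>w. (cgam c ^^ n) a w \<odot> u)"
  by (induction n) (simp_all add: cgam_mult_right)

lemma cgam_smult: "cgam c (\<lambda>w. d *s a w) = (\<lambda>w. d *s cgam c a w)"
  by (auto simp: cgam_def [abs_def] gam_smult vector_smult_assoc mult.commute)

lemma cgam_scaleR: "cgam c (\<lambda>w. r *\<^sub>R a w) w = r *\<^sub>R cgam c a w"
  by (simp only: scaleR_conv_smult cgam_smult)

lemma cgam_pow: "(cgam c ^^ n) a = (\<lambda>w. c ^ n *s (gam ^^ n) a w)"
proof (induction n)
  case (Suc n)
  then show ?case
    by (simp add: cgam_def [abs_def] gam_smult vector_smult_assoc)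
qed simp

lemma cgam_pow_tens_eval: "tens_eval k ((cgam c ^^ n) a) y = c ^ n *s (gamma_op ^^ n) (tens_eval k a) y"
  unfolding cgam_pow gamma_op_pow_tens_eval by (rule tens_eval_linear [OF linear_smult])

lemma cgam_pow_bound:
  "\<exists>K\<ge>0. \<forall>(a :: 'n::{finite,linorder} list \<Rightarrow> 'n cclifford) n.
     (\<Sum>w\<in>words k. norm ((cgam c ^^ n) a w)) \<le> K ^ n * (\<Sum>w\<in>words k. norm (a w))"
proof -
  obtain K where K: "K \<ge> 0" "\<And>a :: 'n list \<Rightarrow> 'n cclifford.
     (\<Sum>w\<in>words k. norm (gam a w)) \<le> K * (\<Sum>w\<in>words k. norm (a w))"
    using sum_norm_gam_le by blast
  have step: "(\<Sum>w\<in>words k. norm (cgam c a w)) \<le> norm c * K * (\<Sum>w\<in>words k. norm (a w))"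
    for a :: "'n list \<Rightarrow> 'n cclifford"
    using K(2) [of a]
    by (simp add: cgam_def norm_smult sum_distrib_left [symmetric] mult.assoc mult_left_mono)
  have "(\<Sum>w\<in>words k. norm ((cgam c ^^ n) a w)) \<le> (norm c * K) ^ n * (\<Sum>w\<in>words k. norm (a w))"
    for a :: "'n list \<Rightarrow> 'n cclifford" and n
  proof (induction n)
    case (Suc n)
    have "(\<Sum>w\<in>words k. norm ((cgam c ^^ Suc n) a w)) \<le>
        norm c * K * (\<Sum>w\<in>words k. norm ((cgam c ^^ n) a w))"
      using step by simp
    also have "\<dots> \<le> norm c * K * ((norm c * K) ^ n * (\<Sum>w\<in>words k. norm (a w)))"
      using K(1) by (intro mult_left_mono Suc) auto
    finally show ?case by (simp add: mult.assoc)
  qed simp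
  with K(1) show ?thesis by (intro exI [of _ "norm c * K"]) auto
qed

lemma tens_exp_sums: "(\<lambda>n. (1 / fact n) *\<^sub>R (cgam c ^^ n) a w) sums tens_exp c a w"
proof -
  obtain K where K: "K \<ge> 0" "\<And>(a :: 'a list \<Rightarrow> 'a cclifford) n.
     (\<Sum>w\<in>words (length w). norm ((cgam c ^^ n) a w)) \<le> K ^ n * (\<Sum>w\<in>words (length w). norm (a w))"
    using cgam_pow_bound by blast
  define S where "S = (\<Sum>w\<in>words (length w). norm (a w))"
  have "norm ((cgam c ^^ n) a w) \<le> K ^ n * S" for n
  proof -
    have "norm ((cgam c ^^ n) a w) \<le> (\<Sum>w\<in>words (length w). norm ((cgam c ^^ n) a w))"
      by (rule member_le_sum) (auto simp: words_def intro: finite_words [unfolded words_def])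
    with K(2) [of n a] show ?thesis by (simp add: S_def)
  qed
  then have "norm ((1 / fact n) *\<^sub>R (cgam c ^^ n) a w) \<le> S * (K ^ n /\<^sub>R fact n)" for n
    by (simp add: field_simps)
  moreover have "summable (\<lambda>n. S * (K ^ n /\<^sub>R fact n))"
    by (intro summable_mult summable_exp_generic)
  ultimately have "summable (\<lambda>n. (1 / fact n) *\<^sub>R (cgam c ^^ n) a w)"
    by (rule summable_comparison_test' [rotated])
  then show ?thesis unfolding tens_exp_def by (rule summable_sums)
qed

lemma tens_eval_sums:
  fixes s :: "'n::finite list \<Rightarrow> 'v::real_normed_vector"
  assumes "\<And>w. (\<lambda>n. u n w) sums s w"
  shows "(\<lambda>n. tens_eval k (u n) y) sums tens_eval k s y"
  unfolding tens_eval_def by (intro sums_sum sums_scaleR_right assms)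

lemma exp_gamma_tens_eval: "exp_gamma c (tens_eval k a) y = tens_eval k (tens_exp c a) y"
proof -
  have "(\<lambda>n. tens_eval k (\<lambda>w. (1 / fact n) *\<^sub>R (cgam c ^^ n) a w) y) sums tens_eval k (tens_exp c a) y"
    by (intro tens_eval_sums tens_exp_sums)
  also have "(\<lambda>n. tens_eval k (\<lambda>w. (1 / fact n) *\<^sub>R (cgam c ^^ n) a w) y) =
      (\<lambda>n. (c ^ n / fact n) *s (gamma_op ^^ n) (tens_eval k a) y)"
  proof
    fix n
    have "tens_eval k (\<lambda>w. (1 / fact n) *\<^sub>R (cgam c ^^ n) a w) y =
        (1 / fact n) *\<^sub>R (c ^ n *s (gamma_op ^^ n) (tens_eval k a) y)"
      unfolding cgam_pow_tens_eval [symmetric] by (rule tens_eval_linear) (rule linear_scale_self)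
    also have "\<dots> = (c ^ n / fact n) *s (gamma_op ^^ n) (tens_eval k a) y"
      by (simp add: scaleR_conv_smult vector_smult_assoc)
    finally show "tens_eval k (\<lambda>w. (1 / fact n) *\<^sub>R (cgam c ^^ n) a w) y =
        (c ^ n / fact n) *s (gamma_op ^^ n) (tens_eval k a) y" .
  qed
  finally show ?thesis by (simp add: exp_gamma_def sums_iff)
qed

lemma cgam_inner_skew:
  assumes "Re c = 0"
  shows "(\<Sum>w\<in>words k. cgam c a w \<bullet> b w) = - (\<Sum>w\<in>words k. a w \<bullet> cgam c b w)"
proof -
  have "(\<Sum>w\<in>words k. cgam c a w \<bullet> b w) = - (\<Sum>w\<in>words k. gam a w \<bullet> (c *s b w))"
    by (simp add: cgam_def inner_smult_imaginary [OF assms] sum_negf)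
  also have "(\<Sum>w\<in>words k. gam a w \<bullet> (c *s b w)) = (\<Sum>w\<in>words k. a w \<bullet> cgam c b w)"
    by (simp add: gam_inner_self_adjoint gam_smult cgam_def)
  finally show ?thesis .
qed

lemma cgam_pow_inner_skew:
  assumes "Re c = 0"
  shows "(\<Sum>w\<in>words k. (cgam c ^^ l) a w \<bullet> b w) = (- 1) ^ l * (\<Sum>w\<in>words k. a w \<bullet> (cgam c ^^ l) b w)"
proof (induction l arbitrary: b)
  case (Suc l)
  then show ?case
    by (simp add: cgam_inner_skew [OF assms] funpow_swap1 [symmetric])
qed simp

text \<open>With T = c \<open>\<Gamma>\<close> skew and \<open>\<phi> n\<close> the inner product of
  T^n a with a, moving l factors T to the other side gives the sign (-1)^l. The shifted series of
  \<open>exp_shift_inverse\<close> is then the series of the inner product of exp (T) a with itself,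
  expanded in the second argument, and it sums to \<open>\<phi> 0\<close>.\<close>

lemma tens_exp_isometry:
  assumes "Re c = 0"
  shows "(\<Sum>w\<in>words k. tens_exp c a w \<bullet> tens_exp c a w) = (\<Sum>w\<in>words k. a w \<bullet> a w)"
proof -
  obtain K where K: "K \<ge> 0" "\<And>(a :: 'a list \<Rightarrow> 'a cclifford) n.
     (\<Sum>w\<in>words k. norm ((cgam c ^^ n) a w)) \<le> K ^ n * (\<Sum>w\<in>words k. norm (a w))"
    using cgam_pow_bound by blast
  define S where "S = (\<Sum>w\<in>words k. norm (a w))"
  define \<phi> where "\<phi> n = (\<Sum>w\<in>words k. (cgam c ^^ n) a w \<bullet> a w)" for n
  have "norm (\<phi> n) \<le> S * S * K ^ n" for n
  proof -
    have "norm (\<phi> n) \<le> (\<Sum>w\<in>words k. norm ((cgam c ^^ n) a w) * S)"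
      unfolding \<phi>_def S_def
      by (intro order.trans [OF norm_sum] sum_mono order.trans [OF Cauchy_Schwarz_ineq2 [folded real_norm_def]] mult_left_mono member_le_sum) auto
    also have "\<dots> \<le> K ^ n * S * S"
      unfolding sum_distrib_right [symmetric] using K(2) [of n a]
      by (intro mult_right_mono) (auto simp: S_def intro: sum_nonneg)
    finally show ?thesis by (simp add: mult_ac)
  qed
  from exp_shift_inverse [OF this]
  have "(\<lambda>l. ((- 1) ^ l / fact l) *\<^sub>R (\<Sum>n. (1 / fact n) *\<^sub>R \<phi> (n + l))) sums \<phi> 0" .
  moreover have "((- 1) ^ l / fact l) *\<^sub>R (\<Sum>n. (1 / fact n) *\<^sub>R \<phi> (n + l)) =
      (\<Sum>w\<in>words k. tens_exp c a w \<bullet> ((1 / fact l) *\<^sub>R (cgam c ^^ l) a w))" for l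
  proof -
    have eq: "(1 / fact n) *\<^sub>R \<phi> (n + l) =
        (- 1) ^ l * (\<Sum>w\<in>words k. ((1 / fact n) *\<^sub>R (cgam c ^^ n) a w) \<bullet> (cgam c ^^ l) a w)" for n
    proof -
      have "\<phi> (n + l) = (- 1) ^ l * (\<Sum>w\<in>words k. (cgam c ^^ n) a w \<bullet> (cgam c ^^ l) a w)"
        unfolding \<phi>_def add.commute [of n l] funpow_add o_apply by (rule cgam_pow_inner_skew [OF assms])
      then show ?thesis by (simp add: sum_divide_distrib [symmetric])
    qed
    have "(\<lambda>n. (- 1) ^ l * (\<Sum>w\<in>words k. ((1 / fact n) *\<^sub>R (cgam c ^^ n) a w) \<bullet> (cgam c ^^ l) a w)) sums
       ((- 1) ^ l * (\<Sum>w\<in>words k. tens_exp c a w \<bullet> (cgam c ^^ l) a w))"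
      by (intro sums_mult sums_sum bounded_linear.sums [OF bounded_linear_inner_left] tens_exp_sums)
    then have "(\<Sum>n. (1 / fact n) *\<^sub>R \<phi> (n + l)) =
        (- 1) ^ l * (\<Sum>w\<in>words k. tens_exp c a w \<bullet> (cgam c ^^ l) a w)"
      unfolding eq by (simp add: sums_iff)
    then show ?thesis
      by (simp add: sum_divide_distrib power_mult_distrib [symmetric])
  qed
  moreover have "(\<lambda>l. \<Sum>w\<in>words k. tens_exp c a w \<bullet> ((1 / fact l) *\<^sub>R (cgam c ^^ l) a w)) sums
      (\<Sum>w\<in>words k. tens_exp c a w \<bullet> tens_exp c a w)"
    by (intro sums_sum bounded_linear.sums [OF bounded_linear_inner_right] tens_exp_sums)
  ultimately have "\<phi> 0 = (\<Sum>w\<in>words k. tens_exp c a w \<bullet> tens_exp c a w)"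
    by (simp add: sums_unique2)
  then show ?thesis by (simp add: \<phi>_def)
qed

lemma rot_sums:
  fixes s :: "'n list \<Rightarrow> 'v::real_normed_vector"
  assumes "\<And>w. (\<lambda>n. u n w) sums s w"
  shows "(\<lambda>n. rot j l w (u n)) sums rot j l w s"
  using assms
proof (induction w arbitrary: u s)
  case (Cons i w)
  have "(\<lambda>n. if P then u n v else 0) sums (if P then s v else 0)" for P v
    using Cons.prems by simp
  then show ?case
    unfolding rot.simps by (intro sums_add sums_diff Cons)
qed simp

lemma cgam_sums:
  assumes "\<And>w. (\<lambda>n. u n w) sums s w"
  shows "(\<lambda>n. cgam c (u n) w) sums cgam c s w"
proof -
  have "(\<lambda>n. gen j \<odot> gen l \<odot> rot j l w (u n)) sums (gen j \<odot> gen l \<odot> rot j l w s)" for j l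
    by (intro bounded_linear.sums [OF cl_mult.bounded_linear_right] rot_sums assms)
  then show ?thesis
    unfolding cgam_def gam_def
    by (intro bounded_linear.sums [OF bounded_linear_smult] sums_minus sums_sum) auto
qed

lemma cgam_pow_tens_exp_sums:
  "(\<lambda>n. (1 / fact n) *\<^sub>R (cgam c ^^ (n + l)) a w) sums (cgam c ^^ l) (tens_exp c a) w"
proof (induction l arbitrary: w)
  case 0
  then show ?case by (simp add: tens_exp_sums)
next
  case (Suc l)
  from cgam_sums [where c = c and w = w and u = "\<lambda>n w. (1 / fact n) *\<^sub>R (cgam c ^^ (n + l)) a w", OF Suc]
  show ?case by (simp add: cgam_scaleR)
qed

section \<open>The angular operator and its exponential on polynomials\<close>

lemma gamma_op_zero: "gamma_op (\<lambda>_. 0) = (\<lambda>_. 0)"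
  by (rule ext) (simp add: gamma_op_def case_prod_beta)

lemma gamma_op_pow_zero: "(gamma_op ^^ n) (\<lambda>_. 0) = (\<lambda>_. 0)"
  by (induction n) (simp_all add: gamma_op_zero)

text \<open>The injectivity of exp (c \<open>\<Gamma>\<close>) on polynomials. The tensor exp (c
  \<open>\<Gamma>\<close>) a need not vanish when its evaluation does, but \<open>gamma_op\<close>
  maps the zero function to itself, so all its images under powers of \<open>cgam\<close> evaluate
  to zero as well. \<open>exp_shift_inverse\<close> recovers the evaluation of \<open>a\<close> from
  these.\<close>

lemma tens_eval_exp_eq_0_imp:
  assumes zero: "\<And>y. tens_eval k (tens_exp c a) y = 0"
  shows "tens_eval k a y = 0"
proof -
  obtain K where K: "K \<ge> 0" "\<And>(a :: 'a list \<Rightarrow> 'a cclifford) n.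
     (\<Sum>w\<in>words k. norm ((cgam c ^^ n) a w)) \<le> K ^ n * (\<Sum>w\<in>words k. norm (a w))"
    using cgam_pow_bound by blast
  define \<phi> where "\<phi> n = tens_eval k ((cgam c ^^ n) a) y" for n
  have "norm (\<phi> n) \<le> (norm y ^ k * (\<Sum>w\<in>words k. norm (a w))) * K ^ n" for n
  proof -
    have "norm (\<phi> n) \<le> (\<Sum>w\<in>words k. norm y ^ k * norm ((cgam c ^^ n) a w))"
      unfolding \<phi>_def tens_eval_def
      by (intro order.trans [OF norm_sum] sum_mono) (simp add: abs_tens_le mult_right_mono)
    also have "\<dots> \<le> norm y ^ k * (K ^ n * (\<Sum>w\<in>words k. norm (a w)))"
      unfolding sum_distrib_left [symmetric] by (intro mult_left_mono K) auto
    finally show ?thesis by (simp add: mult_ac)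
  qed
  from exp_shift_inverse [OF this]
  have "(\<lambda>l. ((- 1) ^ l / fact l) *\<^sub>R (\<Sum>n. (1 / fact n) *\<^sub>R \<phi> (n + l))) sums \<phi> 0" .
  moreover have "(\<Sum>n. (1 / fact n) *\<^sub>R \<phi> (n + l)) = 0" for l
  proof -
    have "(\<lambda>n. tens_eval k (\<lambda>w. (1 / fact n) *\<^sub>R (cgam c ^^ (n + l)) a w) y) sums
        tens_eval k ((cgam c ^^ l) (tens_exp c a)) y"
      by (intro tens_eval_sums cgam_pow_tens_exp_sums)
    moreover have "tens_eval k (tens_exp c a) = (\<lambda>_. 0)"
      using zero by auto
    ultimately have "(\<lambda>n. tens_eval k (\<lambda>w. (1 / fact n) *\<^sub>R (cgam c ^^ (n + l)) a w) y) sums 0"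
      by (simp add: cgam_pow_tens_eval gamma_op_pow_zero)
    moreover have "tens_eval k (\<lambda>w. (1 / fact n) *\<^sub>R (cgam c ^^ (n + l)) a w) y = (1 / fact n) *\<^sub>R \<phi> (n + l)" for n
      unfolding \<phi>_def by (rule tens_eval_linear) (rule linear_scale_self)
    ultimately show ?thesis by (simp add: sums_iff)
  qed
  ultimately show ?thesis by (simp add: \<phi>_def sums_iff)
qed

lemma exp_gamma_of_kernel:
  assumes "gamma_op g = (\<lambda>_. 0)"
  shows "exp_gamma c g = g"
proof
  fix y
  have "(gamma_op ^^ Suc n) g = (\<lambda>_. 0)" for n
    by (induction n) (simp_all add: assms gamma_op_zero)
  then have "(c ^ n / fact n) *s (gamma_op ^^ n) g y = (if n = 0 then g y else 0)" for n
    by (cases n) simp_all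
  then show "exp_gamma c g y = g y"
    using sums_single [of 0 "\<lambda>_. g y"] by (simp add: exp_gamma_def sums_iff)
qed

text \<open>The gradient of a radial function at y is a multiple of y, and the rotation fields are
  tangent to spheres.\<close>

lemma gamma_op_radial: "gamma_op (\<lambda>y. (y \<bullet> y) ^ j *\<^sub>R v) = (\<lambda>_. 0)"
proof
  fix y :: "'a point"
  define D where "D h = (of_nat j * (2 * (y \<bullet> h)) * (y \<bullet> y) ^ (j - 1)) *\<^sub>R v" for h
  have "((\<lambda>y. (y \<bullet> y) ^ j *\<^sub>R v) has_derivative D) (at y)"
    unfolding D_def by (auto intro!: derivative_eq_intros simp: inner_commute)
  then have "frechet_derivative (\<lambda>y. (y \<bullet> y) ^ j *\<^sub>R v) (at y) = D"
    by (rule frechet_derivative_at [symmetric])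
  then show "gamma_op (\<lambda>y. (y \<bullet> y) ^ j *\<^sub>R v) y = 0"
    by (simp add: gamma_op_def D_def inner_axis mult_ac case_prod_beta)
qed

subsection \<open>Hardy's theorem for entire functions\<close>

lemma cosh_ge_exp_abs: "exp \<bar>x\<bar> / 2 \<le> cosh (x::real)"
  by (auto simp: cosh_def abs_if)

lemma Re_cosh: "Re (cosh z) = cosh (Re z) * cos (Im z)" for z :: complex
  by (simp add: cosh_def Re_exp field_simps)

text \<open>Under the exponential map this concerns functions of order 2 in a sector of angle
  \<open>\<theta>\<close> below pi / 2. The damping factor exp (- \<open>\<epsilon>\<close> cosh (u
  w)) has modulus at most 1 on the strip and beats the growth at both ends, so the maximum principle
  on a long rectangle applies; at the fixed point w, \<open>\<epsilon>\<close> and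
  \<open>\<eta>\<close> then tend to 0.\<close>

lemma Phragmen_Lindelof_strip:
  fixes \<phi> :: "complex \<Rightarrow> complex"
  assumes \<theta>: "0 < \<theta>" "\<theta> < pi / 2"
    and hol: "\<phi> holomorphic_on {w. 0 \<le> Im w \<and> Im w \<le> \<theta>}"
    and growth: "\<And>w. 0 \<le> Im w \<Longrightarrow> Im w \<le> \<theta> \<Longrightarrow> norm (\<phi> w) \<le> C * exp (K * exp (2 * \<bar>Re w\<bar>))"
    and edge: "\<And>w. Im w = 0 \<or> Im w = \<theta> \<Longrightarrow> norm (\<phi> w) \<le> M"
    and w: "0 \<le> Im w" "Im w \<le> \<theta>"
  shows "norm (\<phi> w) \<le> M"
proof -
  define S where "S = {w. 0 \<le> Im w \<and> Im w \<le> \<theta>}"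
  \<comment> \<open>The midpoint of 2 and pi / \<open>\<theta>\<close>. Above 2, cosh outgrows exp
    (2 |Re w|); below pi / \<open>\<theta>\<close>, its real part stays positive on the
    strip.\<close>
  define \<rho> where "\<rho> = (2 + pi / \<theta>) / 2"
  have \<rho>: "2 < \<rho>" "\<rho> * \<theta> < pi"
    using \<theta> by (auto simp: \<rho>_def field_simps)
  define \<delta> where "\<delta> = cos (\<rho> * \<theta> / 2)"
  have "\<delta> > 0" unfolding \<delta>_def
    using \<rho> \<theta> by (intro cos_gt_zero_pi) (auto intro: order.strict_trans1 [of _ 0])
  have M: "M \<ge> 0" using edge [of 0] norm_ge_zero [of "\<phi> 0"] by (simp del: norm_ge_zero)
  have C: "C \<ge> 0"
    using growth [of 0] \<theta> norm_ge_zero [of "\<phi> 0"]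
    by (smt (verit) exp_gt_zero mult_neg_pos zero_complex.simps)
  \<comment> \<open>The shift centres the strip on the real axis, so that |Im (u z)| is at most
    \<open>\<rho> * \<theta> / 2\<close>, which is below pi / 2.\<close>
  define u where "u z = of_real \<rho> * (z - \<i> * of_real (\<theta> / 2))" for z
  have Re_cosh_u: "\<delta> * (exp (\<rho> * \<bar>Re z\<bar>) / 2) \<le> Re (cosh (u z))" if "z \<in> S" for z
  proof -
    have "\<bar>Im (u z)\<bar> \<le> \<rho> * \<theta> / 2"
    proof -
      have "\<bar>Im z - \<theta> / 2\<bar> \<le> \<theta> / 2" using that by (auto simp: S_def abs_if)
      then have "\<rho> * \<bar>Im z - \<theta> / 2\<bar> \<le> \<rho> * (\<theta> / 2)" using \<rho> by (intro mult_left_mono) auto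
      then show ?thesis using \<rho> by (simp add: u_def abs_mult)
    qed
    moreover have "cos (Im (u z)) = cos \<bar>Im (u z)\<bar>" by (simp add: abs_if)
    moreover have "\<rho> * \<theta> / 2 \<le> pi" using \<rho> pi_gt_zero by linarith
    ultimately have "\<delta> \<le> cos (Im (u z))" unfolding \<delta>_def
      by (simp only:) (intro cos_monotone_0_pi_le; simp)
    moreover have "exp (\<rho> * \<bar>Re z\<bar>) / 2 \<le> cosh (Re (u z))"
      using cosh_ge_exp_abs [of "Re (u z)"] \<rho> by (simp add: u_def abs_mult)
    ultimately show ?thesis unfolding Re_cosh
      using \<open>\<delta> > 0\<close> by (subst mult.commute) (intro mult_mono; simp)
  qed
  have eps: "norm (\<phi> w * exp (- of_real \<epsilon> * cosh (u w))) \<le> M + \<eta>" if "\<epsilon> > 0" "\<eta> > 0" for \<epsilon> \<eta>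
  proof -
    define \<psi> where "\<psi> z = \<phi> z * exp (- of_real \<epsilon> * cosh (u z))" for z
    have norm_\<psi>: "norm (\<psi> z) = norm (\<phi> z) * exp (- \<epsilon> * Re (cosh (u z)))" for z
      by (simp add: \<psi>_def norm_mult)
    have "\<forall>\<^sub>F x in at_top. C * exp (K * exp (2 * x)) * exp (- \<epsilon> * (\<delta> * (exp (\<rho> * x) / 2))) \<le> \<eta>"
    proof -
      have "((\<lambda>x. C * exp (K * exp (2 * x) - \<epsilon> * (\<delta> * (exp (\<rho> * x) / 2)))) \<longlongrightarrow> C * 0) at_top"
      proof (intro tendsto_mult tendsto_const filterlim_compose [OF exp_at_bot])
        have lim: "filterlim (\<lambda>x::real. exp (c * x)) at_top at_top" if "c > 0" for c :: real
          using that by (intro filterlim_compose [OF exp_at_top] filterlim_tendsto_pos_mult_at_top [OF tendsto_const] filterlim_ident)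
        have "filterlim (\<lambda>x. exp (2 * x) * (- K + \<epsilon> * \<delta> / 2 * exp ((\<rho> - 2) * x))) at_top at_top"
          using \<rho> \<open>\<delta> > 0\<close> that
          by (intro filterlim_at_top_mult_at_top filterlim_tendsto_add_at_top [OF tendsto_const]
              filterlim_tendsto_pos_mult_at_top [OF tendsto_const] lim) auto
        then have "filterlim (\<lambda>x. - (exp (2 * x) * (- K + \<epsilon> * \<delta> / 2 * exp ((\<rho> - 2) * x)))) at_bot at_top"
          by (simp add: filterlim_uminus_at_top)
        moreover have "(\<lambda>x. - (exp (2 * x) * (- K + \<epsilon> * \<delta> / 2 * exp ((\<rho> - 2) * x)))) =
            (\<lambda>x. K * exp (2 * x) - \<epsilon> * (\<delta> * (exp (\<rho> * x) / 2)))"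
          by (auto simp: algebra_simps exp_add [symmetric])
        ultimately show "filterlim (\<lambda>x. K * exp (2 * x) - \<epsilon> * (\<delta> * (exp (\<rho> * x) / 2))) at_bot at_top"
          by simp
      qed
      then have "\<forall>\<^sub>F x in at_top. C * exp (K * exp (2 * x) - \<epsilon> * (\<delta> * (exp (\<rho> * x) / 2))) < \<eta>"
        using that by (intro order_tendstoD) auto
      then show ?thesis
        by eventually_elim (simp add: mult.assoc exp_add [symmetric])
    qed
    then obtain X where X: "\<And>x. x \<ge> X \<Longrightarrow> C * exp (K * exp (2 * x)) * exp (- \<epsilon> * (\<delta> * (exp (\<rho> * x) / 2))) \<le> \<eta>"
      by (auto simp: eventually_at_top_linorder)
    define R where "R = max X (\<bar>Re w\<bar> + 1)"
    define T where "T = cbox (Complex (- R) 0) (Complex R \<theta>)"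
    have T: "z \<in> T \<longleftrightarrow> \<bar>Re z\<bar> \<le> R \<and> 0 \<le> Im z \<and> Im z \<le> \<theta>" for z
      by (auto simp: T_def in_cbox_complex_iff)
    have "T \<subseteq> S" by (auto simp: T S_def)
    have hol_\<psi>: "\<psi> holomorphic_on T"
      unfolding \<psi>_def u_def cosh_def
      by (intro holomorphic_intros holomorphic_on_subset [OF hol]) (use \<open>T \<subseteq> S\<close> S_def in auto)
    have "norm (\<psi> w) \<le> M + \<eta>"
    proof (rule maximum_modulus_frontier [where S = T and f = \<psi> and \<xi> = w])
      show "\<psi> holomorphic_on interior T"
        by (rule holomorphic_on_subset [OF hol_\<psi> interior_subset])
      show "continuous_on (closure T) \<psi>"
        using hol_\<psi> by (simp add: T_def holomorphic_on_imp_continuous_on)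
      show "bounded T" by (simp add: T_def)
      show "w \<in> T" using w by (auto simp: T R_def)
      fix z assume "z \<in> frontier T"
      then have "z \<in> T - box (Complex (- R) 0) (Complex R \<theta>)"
        by (simp add: T_def frontier_def)
      then have "z \<in> T" and "\<bar>Re z\<bar> = R \<or> Im z = 0 \<or> Im z = \<theta>"
        by (auto simp: T in_box_complex_iff abs_if split: if_splits)
      then consider "\<bar>Re z\<bar> = R" | "Im z = 0 \<or> Im z = \<theta>" by auto
      then show "norm (\<psi> z) \<le> M + \<eta>"
      proof cases
        case 1
        have "z \<in> S" using \<open>z \<in> T\<close> \<open>T \<subseteq> S\<close> by blast
        have "norm (\<psi> z) \<le> C * exp (K * exp (2 * \<bar>Re z\<bar>)) * exp (- \<epsilon> * (\<delta> * (exp (\<rho> * \<bar>Re z\<bar>) / 2)))"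
          unfolding norm_\<psi> using \<open>z \<in> S\<close> C that Re_cosh_u [OF \<open>z \<in> S\<close>]
          by (intro mult_mono growth) (auto simp: S_def)
        also have "\<dots> \<le> \<eta>" using 1 by (intro X) (simp add: R_def)
        finally show ?thesis using M by simp
      next
        case 2
        have "Re (cosh (u z)) \<ge> 0"
          using Re_cosh_u [of z] \<open>z \<in> T\<close> \<open>T \<subseteq> S\<close> \<open>\<delta> > 0\<close>
          by (smt (verit) divide_pos_pos exp_gt_zero mult_pos_pos subsetD)
        then have "norm (\<psi> z) \<le> M * 1"
          unfolding norm_\<psi> using edge [OF 2] M that by (intro mult_mono) auto
        then show ?thesis using that by simp
      qed
    qed
    then show ?thesis by (simp add: \<psi>_def)
  qed
  have "norm (\<phi> w) \<le> M + \<eta>" if "\<eta> > 0" for \<eta>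
  proof (rule tendsto_upperbound)
    have "((\<lambda>\<epsilon>. norm (\<phi> w * exp (- of_real \<epsilon> * cosh (u w)))) \<longlongrightarrow> norm (\<phi> w * exp (- of_real 0 * cosh (u w)))) (at_right 0)"
      by (intro tendsto_intros)
    then show "((\<lambda>\<epsilon>. norm (\<phi> w * exp (- of_real \<epsilon> * cosh (u w)))) \<longlongrightarrow> norm (\<phi> w)) (at_right 0)"
      by simp
    show "\<forall>\<^sub>F \<epsilon> in at_right 0. norm (\<phi> w * exp (- of_real \<epsilon> * cosh (u w))) \<le> M + \<eta>"
      using eventually_at_right_less [of 0] by eventually_elim (rule eps [OF _ that])
  qed simp
  then show ?thesis by (rule field_le_epsilon)
qed

section \<open>From strips to quadrants and to the whole plane\<close>

lemma norm_one_plus_ge: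
  assumes "Re z \<ge> 0"
  shows "(1 + norm z) / 2 \<le> norm (1 + z)"
proof -
  have "norm z \<le> norm (1 + z)"
    using assms by (auto simp: cmod_def power2_eq_square algebra_simps)
  moreover have "1 \<le> norm (1 + z)"
    using assms complex_Re_le_cmod [of "1 + z"] by simp
  ultimately show ?thesis by simp
qed

text \<open>A quadrant is the critical angle for order 2, where Phragmen-Lindelof just fails. Hence
  smaller sectors of opening \<open>\<theta>0\<close> are used, with a multiplier adapted to the
  upper ray, and \<open>\<theta>0\<close> tends to pi / 2 for fixed z.\<close>

lemma quadrant_bound:
  fixes g :: "complex \<Rightarrow> complex"
  assumes "\<alpha> > 0" and hol: "g holomorphic_on UNIV"
    and growth: "\<And>z. norm (g z) \<le> C * (1 + norm z) ^ N * exp (\<alpha> * (norm z)\<^sup>2)"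
    and decay: "\<And>t. norm (g (of_real t)) \<le> C * exp (- \<alpha> * t\<^sup>2)"
    and z: "Re z \<ge> 0" "Im z \<ge> 0"
  shows "norm (g z * exp (of_real \<alpha> * z\<^sup>2)) \<le> C * 2 ^ N * (1 + norm z) ^ N"
proof -
  have C: "C \<ge> 0" using order.trans [OF norm_ge_zero decay [of 0]] by simp
  show ?thesis
  \<comment> \<open>On the two boundary rays the bound is immediate: the decay cancels the factor on
    the real axis, and on the imaginary axis the factor itself decays and cancels the
    growth.\<close>
  proof (cases "Im z = 0 \<or> Re z = 0")
    case True
    have "norm (g z * exp (of_real \<alpha> * z\<^sup>2)) \<le> C * (1 + norm z) ^ N"
    proof (cases "Im z = 0")
      case True
      then have zr: "z = of_real (Re z)" by (simp add: complex_eq_iff)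
      have "norm (g z * exp (of_real \<alpha> * z\<^sup>2)) = norm (g (of_real (Re z))) * exp (\<alpha> * (Re z)\<^sup>2)"
        by (subst (1 2) zr) (simp add: norm_mult)
      also have "\<dots> \<le> C * exp (- \<alpha> * (Re z)\<^sup>2) * exp (\<alpha> * (Re z)\<^sup>2)"
        by (intro mult_right_mono decay) auto
      also have "\<dots> = C" by (simp add: mult.assoc exp_add [symmetric])
      also have "\<dots> \<le> C * (1 + norm z) ^ N" using C by (simp add: mult_le_cancel_left1 one_le_power)
      finally show ?thesis .
    next
      case False
      with True have zi: "z = \<i> * of_real (Im z)" by (simp add: complex_eq_iff)
      have nz: "norm z = \<bar>Im z\<bar>" by (subst zi) (simp add: norm_mult)
      have "Re (of_real \<alpha> * z\<^sup>2) = - \<alpha> * (Im z)\<^sup>2"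
        by (subst zi) (simp add: power_mult_distrib)
      then have "norm (g z * exp (of_real \<alpha> * z\<^sup>2)) = norm (g z) * exp (- \<alpha> * (Im z)\<^sup>2)"
        by (simp add: norm_mult)
      also have "\<dots> \<le> C * (1 + norm z) ^ N * exp (\<alpha> * (norm z)\<^sup>2) * exp (- \<alpha> * (Im z)\<^sup>2)"
        by (intro mult_right_mono growth) auto
      also have "\<dots> = C * (1 + norm z) ^ N" by (simp add: nz mult.assoc exp_add [symmetric])
      finally show ?thesis .
    qed
    also have "\<dots> \<le> C * 2 ^ N * (1 + norm z) ^ N"
      using C mult_right_mono [of 1 "2 ^ N" "C * (1 + norm z) ^ N"] by (simp add: mult_ac)
    finally show ?thesis .
  next
    case False
    with z have z0: "z \<noteq> 0" and re: "Re z > 0" and im: "Im z > 0" by auto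
    define \<theta> where "\<theta> = Im (Ln z)"
    have \<theta>: "0 < \<theta>" "\<theta> < pi / 2"
      using Re_Ln_pos_lt_imp [OF re] Im_Ln_pos_lt_imp [OF im] by (auto simp: \<theta>_def)
    have bound: "norm (g z * exp (of_real \<alpha> * Complex 1 (cot \<theta>0) * z\<^sup>2)) \<le> C * 2 ^ N * norm (1 + z) ^ N"
      if \<theta>0: "\<theta> < \<theta>0" "\<theta>0 < pi / 2" for \<theta>0
    proof -
      \<comment> \<open>With this b the real part of (1 + i b) z^2 is |z|^2 on the positive real
        axis and - |z|^2 on the ray of argument \<open>\<theta>0\<close>. The multiplier thus
        cancels exactly the decay on the one ray and the growth on the other.\<close>
      define b where "b = cot \<theta>0"
      have "cos \<theta>0 > 0" "sin \<theta>0 > 0" using \<theta> \<theta>0 by (auto intro: cos_gt_zero sin_gt_zero)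
      then have "b > 0" by (simp add: b_def cot_def)
      \<comment> \<open>The exponential map turns the sector into a strip of width
        \<open>\<theta>0\<close>. The denominator removes the polynomial factor; as |1 + z| is at
        least (1 + |z|) / 2 in the right half-plane, this costs 2^N.\<close>
      define \<phi> where "\<phi> w = g (exp w) * exp (of_real \<alpha> * Complex 1 b * (exp w)\<^sup>2) / (1 + exp w) ^ N" for w
      have Re_exp_ge: "Re (exp w) \<ge> 0" if "0 \<le> Im w" "Im w \<le> \<theta>0" for w
        using that \<theta>0 by (auto simp: Re_exp intro!: mult_nonneg_nonneg cos_ge_zero)
      have nz: "1 + exp w \<noteq> 0" if "0 \<le> Im w" "Im w \<le> \<theta>0" for w
      proof
        assume "1 + exp w = 0"
        then have "Re (1 + exp w) = 0" by (simp only: zero_complex.simps)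
        with Re_exp_ge [OF that] show False by simp
      qed
      have Re_exponent: "Re (of_real \<alpha> * Complex 1 b * (exp w)\<^sup>2) =
          \<alpha> * exp (2 * Re w) * (cos (2 * Im w) - b * sin (2 * Im w))" for w
        by (simp add: exp_double [symmetric] Re_exp Im_exp algebra_simps)
      have denom: "((1 + exp (Re w)) / 2) ^ N \<le> norm (1 + exp w) ^ N" if "0 \<le> Im w" "Im w \<le> \<theta>0" for w
        using norm_one_plus_ge [OF Re_exp_ge [OF that]] by (intro power_mono) auto
      have norm_\<phi>: "norm (\<phi> w) \<le> norm (g (exp w)) * exp (\<alpha> * exp (2 * Re w) * (cos (2 * Im w) - b * sin (2 * Im w)))
          / ((1 + exp (Re w)) / 2) ^ N" if "0 \<le> Im w" "Im w \<le> \<theta>0" for w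
        unfolding \<phi>_def norm_mult norm_divide norm_power norm_exp_eq_Re Re_exponent
        by (intro divide_left_mono denom that mult_pos_pos zero_less_power)
           (use nz [OF that] in \<open>auto intro: add_pos_pos\<close>)
      have growth': "norm (g (exp w)) \<le> C * (1 + exp (Re w)) ^ N * exp (\<alpha> * exp (2 * Re w))" for w
        using growth [of "exp w"] by (simp add: norm_exp_eq_Re exp_double [symmetric])
      have "norm (\<phi> (Ln z)) \<le> C * 2 ^ N"
      proof (rule Phragmen_Lindelof_strip [where \<phi> = \<phi> and w = "Ln z"])
        show "0 < \<theta>0" "\<theta>0 < pi / 2" using \<theta> \<theta>0 by auto
        show "0 \<le> Im (Ln z)" "Im (Ln z) \<le> \<theta>0" using \<theta> \<theta>0 by (auto simp: \<theta>_def)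
        show "\<phi> holomorphic_on {w. 0 \<le> Im w \<and> Im w \<le> \<theta>0}"
          unfolding \<phi>_def
          by (intro holomorphic_intros holomorphic_on_compose [OF _ holomorphic_on_subset [OF hol], unfolded o_def])
             (use nz in auto)
      next
        fix w assume w: "0 \<le> Im w" "Im w \<le> \<theta>0"
        define E where "E = \<alpha> * exp (2 * Re w)"
        have "E \<ge> 0" using \<open>\<alpha> > 0\<close> by (simp add: E_def)
        have "norm (\<phi> w) \<le> C * (1 + exp (Re w)) ^ N * exp E *
           exp (E * (cos (2 * Im w) - b * sin (2 * Im w))) / ((1 + exp (Re w)) / 2) ^ N"
          unfolding E_def
          by (intro order.trans [OF norm_\<phi> [OF w]] divide_right_mono mult_right_mono growth') (auto intro: add_nonneg_nonneg)
        also have "\<dots> = C * 2 ^ N * exp (E + E * (cos (2 * Im w) - b * sin (2 * Im w)))"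
          by (simp only: exp_add) (simp add: power_divide add_pos_pos [THEN less_imp_neq, symmetric])
        also have "\<dots> \<le> C * 2 ^ N * exp (\<alpha> * (2 + b) * exp (2 * \<bar>Re w\<bar>))"
        proof -
          have "cos (2 * Im w) - b * sin (2 * Im w) \<le> 1 + b * 1"
          proof -
            have "- b * sin (2 * Im w) \<le> b * 1" using \<open>b > 0\<close> sin_ge_minus_one [of "2 * Im w"]
              by (metis (no_types, opaque_lifting) minus_mult_commute mult_left_mono less_imp_le minus_le_iff)
            with cos_le_one [of "2 * Im w"] show ?thesis by linarith
          qed
          then have "E + E * (cos (2 * Im w) - b * sin (2 * Im w)) \<le> E + E * (1 + b * 1)"
            using \<open>E \<ge> 0\<close> by (intro add_left_mono mult_left_mono)
          also have "\<dots> = \<alpha> * (2 + b) * exp (2 * Re w)" by (simp add: E_def algebra_simps)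
          also have "\<dots> \<le> \<alpha> * (2 + b) * exp (2 * \<bar>Re w\<bar>)"
            using \<open>\<alpha> > 0\<close> \<open>b > 0\<close> by (intro mult_left_mono) auto
          finally show ?thesis using C by (intro mult_left_mono) auto
        qed
        finally show "norm (\<phi> w) \<le> C * 2 ^ N * exp (\<alpha> * (2 + b) * exp (2 * \<bar>Re w\<bar>))" .
      next
        fix w assume "Im w = 0 \<or> Im w = \<theta>0"
        then show "norm (\<phi> w) \<le> C * 2 ^ N"
        proof
          assume w: "Im w = 0"
          have "exp w = of_real (exp (Re w))" using w by (simp add: exp_eq_polar)
          then have "norm (g (exp w)) \<le> C * exp (- \<alpha> * exp (2 * Re w))"
            using decay [of "exp (Re w)"] by (simp add: exp_double [symmetric])
          then have "norm (\<phi> w) \<le> C * exp (- \<alpha> * exp (2 * Re w)) * exp (\<alpha> * exp (2 * Re w)) / ((1 + exp (Re w)) / 2) ^ N"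
            using w \<theta> \<theta>0 C
            by (intro order.trans [OF norm_\<phi>] divide_right_mono mult_mono) (auto intro!: zero_le_power divide_nonneg_pos add_nonneg_nonneg)
          also have "\<dots> = C / ((1 + exp (Re w)) / 2) ^ N"
            by (simp add: mult.assoc exp_add [symmetric])
          also have "\<dots> \<le> C / (1 / 2) ^ N"
            using C by (intro divide_left_mono power_mono) (auto intro!: zero_less_power divide_pos_pos add_pos_pos mult_pos_pos)
          finally show ?thesis by (simp add: power_one_over)
        next
          assume w: "Im w = \<theta>0"
          have "cos (2 * \<theta>0) - b * sin (2 * \<theta>0) = - 1"
          proof -
            have "b * sin (2 * \<theta>0) = 2 * (cos \<theta>0)\<^sup>2"
              using \<open>sin \<theta>0 > 0\<close> by (simp add: b_def cot_def sin_double power2_eq_square)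
            then show ?thesis by (simp add: cos_double_cos)
          qed
          then have "norm (\<phi> w) \<le> norm (g (exp w)) * exp (- (\<alpha> * exp (2 * Re w))) / ((1 + exp (Re w)) / 2) ^ N"
            using norm_\<phi> [of w] w \<theta> \<theta>0 by simp
          also have "\<dots> \<le> C * (1 + exp (Re w)) ^ N * exp (\<alpha> * exp (2 * Re w)) * exp (- (\<alpha> * exp (2 * Re w))) / ((1 + exp (Re w)) / 2) ^ N"
            by (intro divide_right_mono mult_right_mono growth') (auto intro: add_nonneg_nonneg)
          also have "\<dots> = C * 2 ^ N"
            by (simp add: mult.assoc exp_add [symmetric] power_divide add_pos_pos [THEN less_imp_neq, symmetric])
          finally show ?thesis .
        qed
      qed
      moreover have "0 < norm (1 + z) ^ N"
      proof (intro zero_less_power less_le_trans [OF _ norm_one_plus_ge [OF less_imp_le [OF re]]])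
        show "0 < (1 + norm z) / 2" by (intro divide_pos_pos add_pos_nonneg) simp_all
      qed
      ultimately show ?thesis
        using z0 by (simp add: \<phi>_def b_def norm_divide norm_power pos_divide_le_eq del: zero_less_norm_iff)
    qed
    \<comment> \<open>The bounds do not depend on \<open>\<theta>0\<close>, and cot
      \<open>\<theta>0\<close> tends to 0 as \<open>\<theta>0\<close> tends to pi / 2 from below, so
      the multiplier becomes exp (\<open>\<alpha>\<close> z^2).\<close>
    have "norm (g z * exp (of_real \<alpha> * Complex 1 0 * z\<^sup>2)) \<le> C * 2 ^ N * norm (1 + z) ^ N"
    proof (rule tendsto_upperbound)
      have "((\<lambda>\<theta>0. cot \<theta>0) \<longlongrightarrow> cot (pi / 2)) (at_left (pi / 2))"
        by (intro tendsto_intros) auto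
      then have cot: "((\<lambda>\<theta>0. cot \<theta>0) \<longlongrightarrow> 0) (at_left (pi / 2))"
        by (simp add: cot_def)
      show "((\<lambda>\<theta>0. norm (g z * exp (of_real \<alpha> * Complex 1 (cot \<theta>0) * z\<^sup>2))) \<longlongrightarrow>
          norm (g z * exp (of_real \<alpha> * Complex 1 0 * z\<^sup>2))) (at_left (pi / 2))"
        by (intro tendsto_intros cot)
      show "\<forall>\<^sub>F \<theta>0 in at_left (pi / 2). norm (g z * exp (of_real \<alpha> * Complex 1 (cot \<theta>0) * z\<^sup>2)) \<le> C * 2 ^ N * norm (1 + z) ^ N"
        using eventually_at_left_real [OF \<theta>(2)] by eventually_elim (auto intro: bound)
    qed simp
    also have "\<dots> \<le> C * 2 ^ N * (1 + norm z) ^ N"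
      using C norm_triangle_ineq [of 1 z] by (intro mult_left_mono power_mono) auto
    finally show ?thesis by (simp add: Complex_eq)
  qed
qed

text \<open>Reflections carry the quadrant bound to the plane, so g z exp (\<open>\<alpha>\<close>
  z^2) is entire of polynomial growth and hence a polynomial. It is bounded on the real line, where
  the decay has no polynomial factor, so it is constant.\<close>

lemma Hardy_entire:
  fixes g :: "complex \<Rightarrow> complex"
  assumes \<alpha>: "\<alpha> > 0" and hol: "g holomorphic_on UNIV"
    and growth: "\<And>z. norm (g z) \<le> C * (1 + norm z) ^ N * exp (\<alpha> * (norm z)\<^sup>2)"
    and decay: "\<And>t. norm (g (of_real t)) \<le> C * exp (- \<alpha> * t\<^sup>2)"
  shows "g z = g 0 * exp (- of_real \<alpha> * z\<^sup>2)"
proof -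
  have all: "norm (g z * exp (of_real \<alpha> * z\<^sup>2)) \<le> C * 2 ^ N * (1 + norm z) ^ N" for z
  proof -
    \<comment> \<open>The reflections z to -z, z to cnj z and their composition map the other
      quadrants to the first. They preserve growth, decay on the real line and the real part of
      z^2.\<close>
    have hol_cnj: "(\<lambda>z. cnj (h (cnj z))) holomorphic_on UNIV" if "h holomorphic_on UNIV" for h
      using holomorphic_on_compose_cnj_cnj [of h UNIV] holomorphic_on_subset [OF that] by (simp add: o_def)
    have hol_minus: "(\<lambda>z. h (- z)) holomorphic_on UNIV" if "h holomorphic_on UNIV" for h
      by (rule holomorphic_on_compose [OF _ holomorphic_on_subset [OF that subset_UNIV], of uminus UNIV, unfolded o_def])
         (intro holomorphic_intros)
    have decay': "norm (g (- of_real t)) \<le> C * exp (- \<alpha> * t\<^sup>2)" for t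
      using decay [of "- t"] by simp
    have growth': "norm (g (- z)) \<le> C * (1 + norm z) ^ N * exp (\<alpha> * (norm z)\<^sup>2)"
      "norm (cnj (g (cnj z))) \<le> C * (1 + norm z) ^ N * exp (\<alpha> * (norm z)\<^sup>2)"
      "norm (cnj (g (- cnj z))) \<le> C * (1 + norm z) ^ N * exp (\<alpha> * (norm z)\<^sup>2)" for z
      using growth [of "- z"] growth [of "cnj z"] growth [of "- cnj z"] by simp_all
    have decay_cnj: "norm (cnj (g (cnj (of_real t)))) \<le> C * exp (- \<alpha> * t\<^sup>2)"
      "norm (cnj (g (- cnj (of_real t)))) \<le> C * exp (- \<alpha> * t\<^sup>2)" for t
      using decay [of t] decay' [of t] by simp_all
    have cnj_eq: "Re ((cnj z)\<^sup>2) = Re (z\<^sup>2)"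
      by (simp add: power2_eq_square)
    consider "Re z \<ge> 0" "Im z \<ge> 0" | "Re z \<le> 0" "Im z \<le> 0" | "Re z \<ge> 0" "Im z \<le> 0" | "Re z \<le> 0" "Im z \<ge> 0"
      by linarith
    then show ?thesis
    proof cases
      case 1
      with quadrant_bound [OF \<alpha> hol growth decay] show ?thesis by blast
    next
      case 2
      then show ?thesis
        using quadrant_bound [OF \<alpha> hol_minus [OF hol] growth'(1) decay', of "- z"] by simp
    next
      case 3
      then show ?thesis
        using quadrant_bound [OF \<alpha> hol_cnj [OF hol] growth'(2) decay_cnj(1), of "cnj z"]
        by (simp add: norm_mult cnj_eq)
    next
      case 4
      then show ?thesis
        using quadrant_bound [OF \<alpha> hol_cnj [OF hol_minus [OF hol]] growth'(3) decay_cnj(2), of "- cnj z"]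
        by (simp add: norm_mult cnj_eq)
    qed
  qed
  define G where "G z = g z * exp (of_real \<alpha> * z\<^sup>2)" for z
  have "G holomorphic_on UNIV"
    unfolding G_def by (intro holomorphic_intros hol)
  have C: "C \<ge> 0" using order.trans [OF norm_ge_zero decay [of 0]] by simp
  have "norm (G z) \<le> C * 4 ^ N * norm z ^ N" if "1 \<le> norm z" for z
  proof -
    have "norm (G z) \<le> C * 2 ^ N * (2 * norm z) ^ N"
      unfolding G_def using that C by (intro order.trans [OF all] mult_left_mono power_mono) auto
    also have "\<dots> = C * 4 ^ N * norm z ^ N"
    proof -
      have "(4::real) ^ N = 2 ^ N * 2 ^ N" by (subst power_mult_distrib [symmetric]) simp
      then show ?thesis by (simp add: power_mult_distrib mult.assoc)
    qed
    finally show ?thesis .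
  qed
  note poly = Liouville_polynomial [OF \<open>G holomorphic_on UNIV\<close> this]
  define c where "c k = (deriv ^^ k) G 0 / fact k" for k
  have G: "G z = (\<Sum>k\<le>N. c k * z ^ k)" for z
    unfolding c_def by (rule poly)
  \<comment> \<open>A polynomial of positive degree tends to infinity in modulus, in particular
    along the positive reals, where G is bounded by C.\<close>
  have "c k = 0" if k: "1 \<le> k" "k \<le> N" for k
  proof (rule ccontr)
    assume "c k \<noteq> 0"
    with k have "\<exists>k. k \<noteq> 0 \<and> k \<le> N \<and> c k \<noteq> 0" by (intro exI [of _ k]) auto
    from polyfun_extremal [OF this, of "C + 1"]
    obtain B where B: "\<And>z. norm z \<ge> B \<Longrightarrow> C + 1 \<le> norm (G z)"
      unfolding eventually_at_infinity G [symmetric] by blast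
    have "C + 1 \<le> norm (G (of_real \<bar>B\<bar>))" by (rule B) simp
    also have "\<dots> = norm (g (of_real \<bar>B\<bar>)) * exp (\<alpha> * \<bar>B\<bar>\<^sup>2)"
      by (simp add: G_def norm_mult power2_eq_square)
    also have "\<dots> \<le> C * exp (- \<alpha> * \<bar>B\<bar>\<^sup>2) * exp (\<alpha> * \<bar>B\<bar>\<^sup>2)"
      by (intro mult_right_mono decay) auto
    also have "\<dots> = C" by (simp add: mult.assoc exp_add [symmetric])
    finally show False by simp
  qed
  then have "G z = (\<Sum>k\<le>N. if k = 0 then c 0 else 0)" for z
    unfolding G by (intro sum.cong refl) auto
  then have "G z = G 0" by (simp only:)
  then have "g z * exp (of_real \<alpha> * z\<^sup>2) = g 0"
    by (simp add: G_def)
  then have "g 0 * exp (- of_real \<alpha> * z\<^sup>2) = g z * (exp (of_real \<alpha> * z\<^sup>2) * exp (- of_real \<alpha> * z\<^sup>2))"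
    by (simp only: mult.assoc [symmetric])
  also have "exp (of_real \<alpha> * z\<^sup>2) * exp (- of_real \<alpha> * z\<^sup>2) = 1"
    by (simp only: exp_add [symmetric]) simp
  finally show ?thesis by simp
qed

subsection \<open>Gaussian integrals\<close>

lemma power_series_zero_coeff:
  fixes a :: "nat \<Rightarrow> 'a::{real_normed_field,banach}"
  assumes sums: "\<And>z. (\<lambda>n. a n * z ^ n) sums 0"
  shows "a n = 0"
proof (rule ccontr)
  assume "a n \<noteq> 0"
  show False
  proof (cases "n = 0")
    case True
    have "(\<lambda>n. a n * 0 ^ n) sums a 0" by simp
    with sums [of 0] have "a 0 = 0" by (rule sums_unique2 [symmetric])
    with \<open>a n \<noteq> 0\<close> True show False by simp
  next
    case False
    show False
    proof (rule powser_0_nonzero [of 1 0 a "\<lambda>_. 0" n])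
      fix s :: real assume "0 < s" "\<And>z. z \<in> cball 0 s - {0::'a} \<Longrightarrow> (0::'a) \<noteq> 0"
      from this(2) [of "of_real s"] this(1) show False by simp
    qed (use sums \<open>a n \<noteq> 0\<close> False in auto)
  qed
qed

definition exp_square_coeff :: "'a::{real_normed_field,banach} \<Rightarrow> nat \<Rightarrow> 'a"
  where "exp_square_coeff b n = (if even n then b ^ (n div 2) / fact (n div 2) else 0)"

lemma exp_square_sums: "(\<lambda>n. exp_square_coeff b n * t ^ n) sums exp (b * t\<^sup>2)"
proof -
  have "(\<lambda>j. (b * t\<^sup>2) ^ j /\<^sub>R fact j) sums exp (b * t\<^sup>2)" by (rule exp_converges)
  also have "(\<lambda>j. (b * t\<^sup>2) ^ j /\<^sub>R fact j) = (\<lambda>j. exp_square_coeff b (2 * j) * t ^ (2 * j))"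
    by (auto simp: exp_square_coeff_def power_mult_distrib power_mult [symmetric] scaleR_conv_of_real field_simps)
  finally have "(\<lambda>j. exp_square_coeff b (2 * j) * t ^ (2 * j)) sums exp (b * t\<^sup>2)" .
  moreover have "strict_mono (\<lambda>j::nat. 2 * j)" by (simp add: strict_mono_def)
  ultimately show ?thesis
    by (subst (asm) sums_mono_reindex) (auto simp: exp_square_coeff_def elim!: evenE)
qed

text \<open>The partial sums of the norms are dominated by the integrable function exp (r) h, the
  sum of the majorants. This is the common form of termwise integration for Gaussian moments, the
  classical Fourier integral and the Clifford kernel. The last conclusion bounds the sum of the
  norms and not just the norm of the sum, which is what complex arguments require.\<close>

lemma
  fixes u :: "nat \<Rightarrow> 'a \<Rightarrow> 'b::{banach, second_countable_topology}"
  assumes meas [measurable]: "\<And>k. u k \<in> borel_measurable M" "r \<in> borel_measurable M" "h \<in> borel_measurable M"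
    and int: "integrable M (\<lambda>x. exp (r x) * h x)"
    and r: "\<And>x. r x \<ge> 0" and h: "\<And>x. h x \<ge> 0"
    and bound: "\<And>k x. norm (u k x) \<le> r x ^ k / fact k * h x"
  shows exp_dominated_integrable_term: "integrable M (u k)"
    and exp_dominated_sums: "(\<lambda>k. integral\<^sup>L M (u k)) sums (\<integral>x. (\<Sum>k. u k x) \<partial>M)"
    and exp_dominated_integrable: "integrable M (\<lambda>x. \<Sum>k. u k x)"
    and exp_dominated_summable: "summable (\<lambda>k. norm (integral\<^sup>L M (u k)))"
    and exp_dominated_suminf_le: "(\<Sum>k. norm (integral\<^sup>L M (u k))) \<le> (\<integral>x. exp (r x) * h x \<partial>M)"
proof -
  have exp_sums: "(\<lambda>k. r x ^ k / fact k * h x) sums (exp (r x) * h x)" for x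
    using sums_mult2 [OF exp_converges [of "r x"], of "h x"] by (simp add: field_simps)
  have sum_le: "(\<Sum>k<n. norm (u k x)) \<le> exp (r x) * h x" for n x
  proof -
    have "(\<Sum>k<n. norm (u k x)) \<le> (\<Sum>k<n. r x ^ k / fact k * h x)"
      by (intro sum_mono bound)
    also have "\<dots> \<le> exp (r x) * h x"
      using exp_sums [of x] r h by (intro sum_le_suminf [of _ "{..<n}", THEN order.trans]) (auto simp: sums_iff)
    finally show ?thesis .
  qed
  have int_u: "integrable M (u k)" for k
  proof (rule Bochner_Integration.integrable_bound [OF int])
    show "AE x in M. norm (u k x) \<le> norm (exp (r x) * h x)"
    proof (rule AE_I2)
      fix x
      have "norm (u k x) \<le> (\<Sum>k<Suc k. norm (u k x))" by (simp add: sum_nonneg)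
      also note sum_le [of x "Suc k"]
      finally show "norm (u k x) \<le> norm (exp (r x) * h x)" using h [of x] by simp
    qed
  qed simp
  then show "integrable M (u k)" .
  have partial: "(\<Sum>k<n. \<integral>x. norm (u k x) \<partial>M) \<le> (\<integral>x. exp (r x) * h x \<partial>M)" for n
  proof -
    have "(\<Sum>k<n. \<integral>x. norm (u k x) \<partial>M) = (\<integral>x. (\<Sum>k<n. norm (u k x)) \<partial>M)"
      using int_u by (subst Bochner_Integration.integral_sum) auto
    also have "\<dots> \<le> (\<integral>x. exp (r x) * h x \<partial>M)"
      using int_u int by (intro integral_mono) (auto simp: sum_le)
    finally show ?thesis .
  qed
  have summ: "summable (\<lambda>k. \<integral>x. norm (u k x) \<partial>M)"
    using partial by (intro summableI_nonneg_bounded) auto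
  have AE: "AE x in M. summable (\<lambda>k. norm (u k x))"
    using sum_le by (intro AE_I2 summableI_nonneg_bounded) auto
  show "(\<lambda>k. integral\<^sup>L M (u k)) sums (\<integral>x. (\<Sum>k. u k x) \<partial>M)"
    by (rule sums_integral [OF int_u AE summ])
  show "integrable M (\<lambda>x. \<Sum>k. u k x)"
    by (rule integrable_suminf [OF int_u AE summ])
  show summ_norm: "summable (\<lambda>k. norm (integral\<^sup>L M (u k)))"
    by (rule summable_comparison_test' [OF summ]) simp
  have "(\<Sum>k. norm (integral\<^sup>L M (u k))) \<le> (\<Sum>k. \<integral>x. norm (u k x) \<partial>M)"
    by (intro suminf_le summ summ_norm) simp
  also have "\<dots> \<le> (\<integral>x. exp (r x) * h x \<partial>M)"
    using partial by (intro suminf_le_const summ)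
  finally show "(\<Sum>k. norm (integral\<^sup>L M (u k))) \<le> (\<integral>x. exp (r x) * h x \<partial>M)" .
qed

text \<open>Completing the square bounds the left side by exp (r^2 / 4p) everywhere. Beyond radius 2
  r / p half of the Gaussian already absorbs exp (r |x|). The ball has volume of order r^m, so
  integration keeps the exponent 1/(4p) up to a power of r.\<close>

lemma exp_norm_gaussian_le:
  fixes x :: "'a::real_normed_vector"
  assumes "p > 0" "r \<ge> 0"
  shows "exp (r * norm x) * exp (- p * (norm x)\<^sup>2) \<le>
    indicator (cball 0 (2 * r / p)) x * exp (r\<^sup>2 / (4 * p)) + exp (- (p / 2) * (norm x)\<^sup>2)"
proof (cases "norm x \<le> 2 * r / p")
  case True
  have "0 \<le> (2 * p * norm x - r)\<^sup>2 / (4 * p)" using assms by simp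
  also have "\<dots> = r\<^sup>2 / (4 * p) - (r * norm x - p * (norm x)\<^sup>2)"
    using assms by (simp add: field_simps power2_eq_square)
  finally have "exp (r * norm x - p * (norm x)\<^sup>2) \<le> exp (r\<^sup>2 / (4 * p))" by simp
  with True show ?thesis
    by (simp add: exp_add [symmetric] add_increasing2)
next
  case False
  then have "r \<le> p / 2 * norm x" using assms by (simp add: field_simps)
  then have "r * norm x \<le> p / 2 * norm x * norm x" by (intro mult_right_mono) auto
  then show ?thesis using False
    by (simp add: exp_add [symmetric] power2_eq_square field_simps)
qed

lemma integrable_exp_norm_gaussian:
  fixes r :: real
  assumes "p > 0"
  shows "integrable lborel (\<lambda>x::'a::euclidean_space. exp (r * norm x) * exp (- p * (norm x)\<^sup>2))"
proof (rule Bochner_Integration.integrable_bound)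
  show "integrable lborel (\<lambda>x::'a. indicator (cball 0 (2 * \<bar>r\<bar> / p)) x * exp (\<bar>r\<bar>\<^sup>2 / (4 * p)) + exp (- (p / 2) * (norm x)\<^sup>2))"
    using assms by (intro Bochner_Integration.integrable_add integrable_mult_left integrable_real_indicator integrable_gaussian)
      (use emeasure_bounded_finite [OF bounded_cball] assms in auto)
  show "AE x in lborel. norm (exp (r * norm x) * exp (- p * (norm (x::'a))\<^sup>2)) \<le>
    norm (indicator (cball 0 (2 * \<bar>r\<bar> / p)) x * exp (\<bar>r\<bar>\<^sup>2 / (4 * p)) + exp (- (p / 2) * (norm x)\<^sup>2))"
  proof (rule AE_I2)
    fix x :: 'a
    have "exp (r * norm x) * exp (- p * (norm x)\<^sup>2) \<le> exp (\<bar>r\<bar> * norm x) * exp (- p * (norm x)\<^sup>2)"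
      by (intro mult_right_mono) (auto intro: mult_right_mono)
    also note exp_norm_gaussian_le [OF assms abs_ge_zero, of r x]
    finally show "norm (exp (r * norm x) * exp (- p * (norm x)\<^sup>2)) \<le>
      norm (indicator (cball 0 (2 * \<bar>r\<bar> / p)) x * exp (\<bar>r\<bar>\<^sup>2 / (4 * p)) + exp (- (p / 2) * (norm x)\<^sup>2))"
      by simp
  qed
qed simp

lemma integral_exp_norm_gaussian_le:
  assumes "p > 0"
  shows "\<exists>C>0. \<forall>r\<ge>0. (\<integral>x. exp (r * norm x) * exp (- p * (norm x)\<^sup>2) \<partial>(lborel :: 'a::euclidean_space measure)) \<le>
    C * (1 + r) ^ DIM('a) * exp (r\<^sup>2 / (4 * p))"
proof -
  define V where "V = unit_ball_vol (real DIM('a)) * (2 / p) ^ DIM('a)"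
  define I where "I = (\<integral>x. exp (- (p / 2) * (norm x)\<^sup>2) \<partial>(lborel :: 'a measure))"
  have "V \<ge> 0" "I \<ge> 0" using assms by (auto simp: V_def I_def)
  have "(\<integral>x. exp (r * norm x) * exp (- p * (norm x)\<^sup>2) \<partial>(lborel :: 'a measure)) \<le>
    (V + I + 1) * (1 + r) ^ DIM('a) * exp (r\<^sup>2 / (4 * p))" if "r \<ge> 0" for r
  proof -
    have ind: "integrable lborel (\<lambda>x::'a. indicator (cball 0 (2 * r / p)) x * exp (r\<^sup>2 / (4 * p)))"
      by (intro integrable_mult_left integrable_real_indicator) (use emeasure_bounded_finite [OF bounded_cball] assms in auto)
    have gauss: "integrable lborel (\<lambda>x::'a. exp (- (p / 2) * (norm x)\<^sup>2))"
      using assms by (intro integrable_gaussian) simp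
    have "(\<integral>x. exp (r * norm x) * exp (- p * (norm x)\<^sup>2) \<partial>(lborel :: 'a measure)) \<le>
      (\<integral>x. indicator (cball 0 (2 * r / p)) x * exp (r\<^sup>2 / (4 * p)) + exp (- (p / 2) * (norm x)\<^sup>2) \<partial>(lborel :: 'a measure))"
      using exp_norm_gaussian_le [OF assms that]
      by (intro integral_mono integrable_exp_norm_gaussian assms Bochner_Integration.integrable_add ind gauss) auto
    also have "\<dots> = measure lborel (cball 0 (2 * r / p) :: 'a set) * exp (r\<^sup>2 / (4 * p)) + I"
      unfolding I_def by (subst Bochner_Integration.integral_add [OF ind gauss]) simp
    also have "measure lborel (cball 0 (2 * r / p) :: 'a set) = V * r ^ DIM('a)"
      using that assms by (simp add: content_cball V_def power_mult_distrib power_divide)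
    also have "V * r ^ DIM('a) * exp (r\<^sup>2 / (4 * p)) + I \<le>
        V * (1 + r) ^ DIM('a) * exp (r\<^sup>2 / (4 * p)) + (I + 1) * ((1 + r) ^ DIM('a) * exp (r\<^sup>2 / (4 * p)))"
    proof (intro add_mono mult_right_mono mult_left_mono power_mono)
      have "1 * 1 \<le> (1 + r) ^ DIM('a) * exp (r\<^sup>2 / (4 * p))"
        using that assms by (intro mult_mono one_le_power) auto
      then have "I * 1 \<le> (I + 1) * ((1 + r) ^ DIM('a) * exp (r\<^sup>2 / (4 * p)))"
        using \<open>I \<ge> 0\<close> by (intro mult_mono) auto
      then show "I \<le> (I + 1) * ((1 + r) ^ DIM('a) * exp (r\<^sup>2 / (4 * p)))" by simp
    qed (use that \<open>V \<ge> 0\<close> in auto)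
    finally show ?thesis by (simp add: algebra_simps)
  qed
  with \<open>V \<ge> 0\<close> \<open>I \<ge> 0\<close> show ?thesis by (intro exI [of _ "V + I + 1"]) auto
qed

lemma integral_exp_inner_gaussian:
  fixes z :: "'a::euclidean_space"
  assumes "p > 0"
  shows "(\<integral>x. exp (x \<bullet> z) * exp (- p * (norm x)\<^sup>2) \<partial>lborel) =
    exp ((norm z)\<^sup>2 / (4 * p)) * (\<integral>x. exp (- p * (norm x)\<^sup>2) \<partial>(lborel :: 'a measure))"
proof -
  \<comment> \<open>The maximum point of <x, z> - p |x|^2; translation by it completes the
    square.\<close>
  define c where "c = (1 / (2 * p)) *\<^sub>R z"
  have eq: "exp ((c + x) \<bullet> z) * exp (- p * (norm (c + x))\<^sup>2) = exp ((norm z)\<^sup>2 / (4 * p)) * exp (- p * (norm x)\<^sup>2)" for x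
    using assms unfolding power2_norm_eq_inner
    by (simp add: c_def exp_add [symmetric] inner_add_left inner_add_right inner_commute field_simps)
  have "(\<integral>x. exp (x \<bullet> z) * exp (- p * (norm x)\<^sup>2) \<partial>lborel) =
     (\<integral>x. exp (x \<bullet> z) * exp (- p * (norm x)\<^sup>2) \<partial>(distr lborel borel ((+) c)))"
    by (simp add: lborel_distr_plus)
  also have "\<dots> = (\<integral>x. exp ((c + x) \<bullet> z) * exp (- p * (norm (c + x))\<^sup>2) \<partial>lborel)"
    by (rule integral_distr) measurable
  finally show ?thesis unfolding eq by simp
qed

text \<open>The type argument fixes the space of integration, which the value alone would not
  determine.\<close>

definition gauss_mass :: "'a::euclidean_space itself \<Rightarrow> real \<Rightarrow> real"
  where "gauss_mass _ p = (\<integral>x. exp (- p * (norm x)\<^sup>2) \<partial>(lborel :: 'a measure))"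

lemma gauss_mass_pos:
  assumes "p > 0"
  shows "gauss_mass TYPE('a::euclidean_space) p > 0"
proof -
  have int: "integrable lborel (\<lambda>x::'a. exp (- p * (norm x)\<^sup>2))"
    by (rule integrable_gaussian [OF assms])
  have "gauss_mass TYPE('a) p \<ge> 0" by (simp add: gauss_mass_def)
  moreover have "gauss_mass TYPE('a) p \<noteq> 0"
  proof
    assume "gauss_mass TYPE('a) p = 0"
    then have "AE x in (lborel :: 'a measure). exp (- p * (norm x)\<^sup>2) = 0"
      unfolding gauss_mass_def by (subst (asm) integral_nonneg_eq_0_iff_AE [OF int]) auto
    then have "AE x in (lborel :: 'a measure). False" by simp
    then show False
      by (simp add: AE_iff_null null_sets_def)
  qed
  ultimately show ?thesis by simp
qed

text \<open>Completing the square gives the real exponential integral. Its power series along the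
  line through z yields the moments, and resummation of the same series with a complex c takes the
  place of analytic continuation.\<close>

lemma
  fixes z :: "'a::euclidean_space" and c :: complex
  assumes "p > 0"
  shows gaussian_moment_integrable: "integrable lborel (\<lambda>x. (x \<bullet> z) ^ k * exp (- p * (norm x)\<^sup>2))"
    and gaussian_moment: "(\<integral>x. (x \<bullet> z) ^ k * exp (- p * (norm x)\<^sup>2) \<partial>lborel) / fact k =
      gauss_mass TYPE('a) p * exp_square_coeff ((norm z)\<^sup>2 / (4 * p)) k"
    and integral_exp_inner_gaussian_complex:
      "(\<integral>x. exp (c * of_real (x \<bullet> z)) * of_real (exp (- p * (norm x)\<^sup>2)) \<partial>lborel) =
        of_real (gauss_mass TYPE('a) p) * exp (c\<^sup>2 * of_real ((norm z)\<^sup>2 / (4 * p)))"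
proof -
  define \<mu> where "\<mu> k = (\<integral>x. (x \<bullet> z) ^ k * exp (- p * (norm x)\<^sup>2) \<partial>lborel)" for k
  define b where "b = (norm z)\<^sup>2 / (4 * p)"
  define \<kappa> where "\<kappa> = gauss_mass TYPE('a) p"
  define u where "u c k x = (c * of_real (x \<bullet> z)) ^ k / fact k * of_real (exp (- p * (norm x)\<^sup>2))"
    for c :: complex and k x
  have u_le: "norm (u c k x) \<le> (norm c * norm z * norm x) ^ k / fact k * exp (- p * (norm x)\<^sup>2)" for c k x
  proof -
    have "norm c * \<bar>x \<bullet> z\<bar> \<le> norm c * (norm x * norm z)"
      by (intro mult_left_mono Cauchy_Schwarz_ineq2) auto
    then have "norm (c * of_real (x \<bullet> z)) \<le> norm c * norm z * norm x"
      by (simp add: norm_mult mult_ac)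
    then have "norm (c * of_real (x \<bullet> z)) ^ k \<le> (norm c * norm z * norm x) ^ k"
      by (rule power_mono) simp
    then show ?thesis
      unfolding u_def norm_mult [of "_ / _"] norm_divide norm_power norm_fact norm_of_real
      by (intro mult_mono divide_right_mono) auto
  qed
  have int: "integrable lborel (\<lambda>x::'a. exp (norm c * norm z * norm x) * exp (- p * (norm x)\<^sup>2))" for c :: complex
    by (rule integrable_exp_norm_gaussian [OF assms])
  have meas: "u c k \<in> borel_measurable lborel" for c k
    unfolding u_def [abs_def] by measurable
  note dominated = meas _ _ int _ _ u_le
  have int_u: "integrable lborel (u c k)" for c k
    by (rule exp_dominated_integrable_term [OF dominated]) auto
  have sum_u: "(\<lambda>k. integral\<^sup>L lborel (u c k)) sums (\<integral>x. (\<Sum>k. u c k x) \<partial>lborel)" for c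
    by (rule exp_dominated_sums [OF dominated]) auto
  have suminf_u: "(\<Sum>k. u c k x) = exp (c * of_real (x \<bullet> z)) * of_real (exp (- p * (norm x)\<^sup>2))" for c x
  proof -
    have "(\<lambda>k. (c * of_real (x \<bullet> z)) ^ k / fact k) sums exp (c * of_real (x \<bullet> z))"
      using exp_converges [of "c * of_real (x \<bullet> z)"] by (simp add: scaleR_conv_of_real field_simps)
    from sums_mult2 [OF this] show ?thesis unfolding u_def by (rule sums_unique [symmetric])
  qed
  have u1: "u 1 k x = of_real ((x \<bullet> z) ^ k * exp (- p * (norm x)\<^sup>2) / fact k)" for k x
    by (simp add: u_def)
  have "integrable lborel (\<lambda>x. (x \<bullet> z) ^ k * exp (- p * (norm x)\<^sup>2) / fact k)" for k
    using int_u [of 1 k] unfolding u1 [abs_def] complex_of_real_integrable_eq .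
  then have "integrable lborel (\<lambda>x. fact k * ((x \<bullet> z) ^ k * exp (- p * (norm x)\<^sup>2) / fact k))" for k
    by (rule integrable_mult_right)
  then show int_\<mu>: "integrable lborel (\<lambda>x. (x \<bullet> z) ^ k * exp (- p * (norm x)\<^sup>2))" for k
    by simp
  have int_u_eq: "integral\<^sup>L lborel (u c k) = of_real (\<mu> k / fact k) * c ^ k" for c k
  proof -
    have "u c k = (\<lambda>x. c ^ k / fact k * of_real ((x \<bullet> z) ^ k * exp (- p * (norm x)\<^sup>2)))"
      by (simp add: u_def [abs_def] power_mult_distrib mult.assoc)
    then have "integral\<^sup>L lborel (u c k) = c ^ k / fact k * of_real (\<mu> k)"
      unfolding \<mu>_def by (simp only: integral_mult_right_zero integral_complex_of_real)
    then show ?thesis by simp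
  qed
  have real_sums: "(\<lambda>k. \<mu> k / fact k * t ^ k) sums (\<kappa> * exp (b * t\<^sup>2))" for t :: real
  proof -
    have "(\<lambda>k. of_real (\<mu> k / fact k * t ^ k)) sums (\<integral>x. (\<Sum>k. u (of_real t) k x) \<partial>lborel)"
      using sum_u [of "of_real t"] unfolding int_u_eq by simp
    also have "(\<integral>x. (\<Sum>k. u (of_real t) k x) \<partial>lborel) =
        (\<integral>x. of_real (exp (x \<bullet> (t *\<^sub>R z)) * exp (- p * (norm x)\<^sup>2)) \<partial>lborel)"
      unfolding suminf_u by (intro Bochner_Integration.integral_cong refl) (simp only: inner_scaleR_right of_real_mult [symmetric] exp_of_real)
    also have "\<dots> = of_real (\<kappa> * exp (b * t\<^sup>2))"
      unfolding integral_complex_of_real integral_exp_inner_gaussian [OF assms]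
      by (simp add: \<kappa>_def gauss_mass_def b_def power_mult_distrib mult_ac)
    finally show ?thesis unfolding sums_of_real_iff .
  qed
  \<comment> \<open>Two everywhere convergent power series in the real variable t have the same sum,
    so their coefficients agree.\<close>
  have coeff: "\<mu> k / fact k = \<kappa> * exp_square_coeff b k" for k
  proof -
    have "(\<lambda>k. (\<mu> k / fact k - \<kappa> * exp_square_coeff b k) * t ^ k) sums 0" for t :: real
      using sums_diff [OF real_sums [of t] sums_mult [OF exp_square_sums [of b t], of \<kappa>]]
      by (simp add: algebra_simps)
    from power_series_zero_coeff [OF this, of k] show ?thesis by simp
  qed
  then show "(\<integral>x. (x \<bullet> z) ^ k * exp (- p * (norm x)\<^sup>2) \<partial>lborel) / fact k =
      gauss_mass TYPE('a) p * exp_square_coeff ((norm z)\<^sup>2 / (4 * p)) k" for k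
    by (simp add: \<mu>_def \<kappa>_def b_def)
  have "(\<lambda>k. of_real \<kappa> * (exp_square_coeff (of_real b) k * c ^ k)) sums (of_real \<kappa> * exp (of_real b * c\<^sup>2))"
    by (intro sums_mult exp_square_sums)
  also have "(\<lambda>k. of_real \<kappa> * (exp_square_coeff (of_real b) k * c ^ k)) = (\<lambda>k. integral\<^sup>L lborel (u c k))"
    unfolding int_u_eq coeff by (auto simp: exp_square_coeff_def)
  finally have "of_real \<kappa> * exp (of_real b * c\<^sup>2) = (\<integral>x. (\<Sum>k. u c k x) \<partial>lborel)"
    using sum_u by (rule sums_unique2)
  then show "(\<integral>x. exp (c * of_real (x \<bullet> z)) * of_real (exp (- p * (norm x)\<^sup>2)) \<partial>lborel) =
        of_real (gauss_mass TYPE('a) p) * exp (c\<^sup>2 * of_real ((norm z)\<^sup>2 / (4 * p)))"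
    unfolding suminf_u by (simp add: \<kappa>_def b_def mult.commute)
qed

subsection \<open>Uniqueness of moments\<close>

lemma lborel_integral_affine:
  fixes f :: "'a::euclidean_space \<Rightarrow> 'b::{banach, second_countable_topology}"
  assumes [measurable]: "f \<in> borel_measurable borel" and "c \<noteq> 0"
  shows "(\<integral>x. f x \<partial>lborel) = \<bar>c\<bar> ^ DIM('a) *\<^sub>R (\<integral>x. f (t + c *\<^sub>R x) \<partial>lborel)"
proof -
  have "(\<integral>x. f x \<partial>lborel) = (\<integral>x. f x \<partial>density (distr lborel borel (\<lambda>x. t + c *\<^sub>R x)) (\<lambda>_. ennreal (\<bar>c\<bar> ^ DIM('a))))"
    using lborel_affine [OF \<open>c \<noteq> 0\<close>, of t] by (simp add: ennreal_power)
  also have "\<dots> = \<bar>c\<bar> ^ DIM('a) *\<^sub>R (\<integral>x. f (t + c *\<^sub>R x) \<partial>lborel)"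
    by (subst integral_density) (auto simp: integral_distr)
  finally show ?thesis .
qed

lemma integrable_product_norm_le:
  fixes f :: "'a::euclidean_space \<times> 'b::euclidean_space \<Rightarrow> 'c::{banach, second_countable_topology}"
  assumes [measurable]: "f \<in> borel_measurable (lborel \<Otimes>\<^sub>M lborel)"
    and g: "integrable lborel g" and h: "integrable lborel h"
    and le: "\<And>x y. norm (f (x, y)) \<le> g x * (h y :: real)"
  shows "integrable (lborel \<Otimes>\<^sub>M lborel) f"
proof (rule Bochner_Integration.integrable_bound)
  show "integrable (lborel \<Otimes>\<^sub>M lborel) (\<lambda>(x, y). g x * h y)"
  proof (rule lborel_pair.Fubini_integrable)
    show "(\<lambda>(x, y). g x * h y) \<in> borel_measurable (lborel \<Otimes>\<^sub>M lborel)"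
      using borel_measurable_integrable [OF g] borel_measurable_integrable [OF h]
      by (simp add: case_prod_beta)
    show "integrable lborel (\<lambda>x. \<integral>y. norm (case (x, y) of (x, y) \<Rightarrow> g x * h y) \<partial>lborel)"
      using integrable_norm [OF g] by (simp add: abs_mult)
    show "AE x in lborel. integrable lborel (\<lambda>y. case (x, y) of (x, y) \<Rightarrow> g x * h y)"
      using h by simp
  qed
  show "AE z in lborel \<Otimes>\<^sub>M lborel. norm (f z) \<le> norm (case z of (x, y) \<Rightarrow> g x * h y)"
    using le by (intro AE_I2) (auto intro: order.trans [OF _ abs_ge_self])
qed fact

definition std_gauss :: "'a::real_normed_vector \<Rightarrow> real"
  where "std_gauss v = exp (- ((norm v)\<^sup>2))"

lemma borel_measurable_std_gauss [measurable]: "std_gauss \<in> borel_measurable borel"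
  unfolding std_gauss_def [abs_def] by measurable

lemma integrable_std_gauss: "integrable lborel (std_gauss :: 'a::euclidean_space \<Rightarrow> real)"
  using integrable_gaussian [of 1, where 'a = 'a] by (simp add: std_gauss_def [abs_def])

lemma integral_std_gauss: "(\<integral>v. std_gauss v \<partial>(lborel :: 'a::euclidean_space measure)) = gauss_mass TYPE('a) 1"
  by (simp add: gauss_mass_def std_gauss_def)

text \<open>A Gaussian is the Fourier integral of a Gaussian. Inserting this and exchanging the
  integrals leaves the Fourier integral of h inside.\<close>

lemma fourier_zero_imp_gaussian_convolution_zero:
  fixes h :: "'a::euclidean_space \<Rightarrow> real"
  assumes int_h: "integrable lborel h"
    and fourier: "\<And>y. (\<integral>x. exp (- \<i> * of_real (x \<bullet> y)) * of_real (h x) \<partial>lborel) = 0"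
    and s_pos: "s > 0"
  shows "(\<integral>x. h x * std_gauss ((1 / s) *\<^sub>R (x - z)) \<partial>lborel) = 0"
proof -
  note int_abs_h = integrable_abs [OF int_h]
  have [measurable]: "h \<in> borel_measurable borel" using borel_measurable_integrable [OF int_h] by simp
  \<comment> \<open>Chosen so that the Fourier integral of exp (- \<open>\<epsilon>\<close> |y|^2)
    has the profile exp (- |x - z|^2 / s^2).\<close>
  define \<epsilon> where "\<epsilon> = s\<^sup>2 / 4"
  have "\<epsilon> > 0" using s_pos by (simp add: \<epsilon>_def)
  define f where "f x y = exp (\<i> * of_real (y \<bullet> (z - x))) * of_real (exp (- \<epsilon> * (norm y)\<^sup>2) * h x)" for x y
  have "integrable (lborel \<Otimes>\<^sub>M lborel) (case_prod f)"
  proof (rule integrable_product_norm_le [OF _ int_abs_h integrable_gaussian [OF \<open>\<epsilon> > 0\<close>]])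
    show "case_prod f \<in> borel_measurable (lborel \<Otimes>\<^sub>M lborel)"
      unfolding f_def case_prod_beta by measurable
  qed (auto simp: f_def norm_mult)
  from lborel_pair.Fubini_integral [OF this]
  have "(\<integral>y. \<integral>x. f x y \<partial>lborel \<partial>lborel) = (\<integral>x. \<integral>y. f x y \<partial>lborel \<partial>lborel)" .
  moreover have "(\<integral>x. f x y \<partial>lborel) = 0" for y
  proof -
    have "f x y = (exp (\<i> * of_real (y \<bullet> z)) * of_real (exp (- \<epsilon> * (norm y)\<^sup>2))) *
        (exp (- \<i> * of_real (x \<bullet> y)) * of_real (h x))" for x
      by (simp add: f_def inner_diff_right inner_commute exp_diff exp_minus field_simps)
    then show ?thesis by (simp only: integral_mult_right_zero fourier mult_zero_right)
  qed
  moreover have "(\<integral>y. f x y \<partial>lborel) = of_real (gauss_mass TYPE('a) \<epsilon> * (h x * std_gauss ((1 / s) *\<^sub>R (x - z))))" for x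
  proof -
    have "(\<integral>y. f x y \<partial>lborel) = (\<integral>y. exp (\<i> * of_real (y \<bullet> (z - x))) * of_real (exp (- \<epsilon> * (norm y)\<^sup>2)) * of_real (h x) \<partial>lborel)"
      by (simp add: f_def mult.assoc)
    also have "\<dots> = of_real (gauss_mass TYPE('a) \<epsilon>) * exp (\<i>\<^sup>2 * of_real ((norm (z - x))\<^sup>2 / (4 * \<epsilon>))) * of_real (h x)"
      unfolding integral_mult_left_zero integral_exp_inner_gaussian_complex [OF \<open>\<epsilon> > 0\<close>] ..
    also have "exp (\<i>\<^sup>2 * of_real ((norm (z - x))\<^sup>2 / (4 * \<epsilon>))) = of_real (std_gauss ((1 / s) *\<^sub>R (x - z)))"
      using s_pos by (simp add: std_gauss_def \<epsilon>_def norm_minus_commute power_divide power_mult_distrib flip: exp_of_real)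
    finally show ?thesis by (simp add: mult_ac)
  qed
  ultimately have "of_real (gauss_mass TYPE('a) \<epsilon>) * complex_of_real (\<integral>x. h x * std_gauss ((1 / s) *\<^sub>R (x - z)) \<partial>lborel) = 0"
    by (simp flip: integral_complex_of_real)
  with gauss_mass_pos [OF \<open>\<epsilon> > 0\<close>, where 'a = 'a] show ?thesis by simp
qed

text \<open>\<open>J v\<close> is the integral of h over the box translated by v. By Fubini its
  averages against Gaussians of every width s vanish, and as s tends to 0 they tend to a positive
  multiple of \<open>J 0\<close>, because J is continuous at 0: the boundary of a box is a null
  set.\<close>

lemma gaussian_convolution_zero_imp_box_integral_zero:
  fixes h :: "'a::euclidean_space \<Rightarrow> real"
  assumes int_h: "integrable lborel h"
    and conv: "\<And>s z. s > 0 \<Longrightarrow> (\<integral>x. h x * std_gauss ((1 / s) *\<^sub>R (x - z)) \<partial>lborel) = 0"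
  shows "(\<integral>x. indicator (box a b) x * h x \<partial>lborel) = 0"
proof -
  note int_abs_h = integrable_abs [OF int_h]
  have [measurable]: "h \<in> borel_measurable borel" using borel_measurable_integrable [OF int_h] by simp
  define J where "J v = (\<integral>x. indicator (box a b) (x - v) * h x \<partial>lborel)" for v
  have J_le: "\<bar>J v\<bar> \<le> (\<integral>x. \<bar>h x\<bar> \<partial>lborel)" for v
    unfolding J_def
    by (rule order.trans [OF integral_abs_bound integral_mono'])
       (auto simp: int_abs_h abs_mult indicator_def)
  have [measurable]: "J \<in> borel_measurable borel"
    unfolding J_def [abs_def] by measurable
  have J_0: "((\<lambda>n. J (v n)) \<longlongrightarrow> J 0) sequentially" if v: "v \<longlonglongrightarrow> 0" for v :: "nat \<Rightarrow> 'a"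
    unfolding J_def
  proof (rule integral_dominated_convergence [where w = "\<lambda>x. \<bar>h x\<bar>"])
    have "negligible (frontier (box a b))" by (intro negligible_convex_frontier convex_box)
    then have "frontier (box a b) \<in> null_sets lborel"
      by (simp add: negligible_iff_null_sets null_sets_completion_iff)
    then have "AE x in lborel. x \<notin> frontier (box a b)" by (rule AE_not_in)
    then show "AE x in lborel. (\<lambda>n. indicator (box a b) (x - v n) * h x) \<longlonglongrightarrow> indicator (box a b) (x - 0) * h x"
    proof eventually_elim
      fix x assume x: "x \<notin> frontier (box a b)"
      have lim: "(\<lambda>n. x - v n) \<longlonglongrightarrow> x" using tendsto_diff [OF tendsto_const v, of x] by simp
      have "\<forall>\<^sub>F n in sequentially. indicator (box a b) (x - v n) = (indicator (box a b) x :: real)"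
      proof (cases "x \<in> box a b")
        case True
        from topological_tendstoD [OF lim open_box True] show ?thesis
          by eventually_elim (simp add: True)
      next
        case False
        with x have "x \<in> - closure (box a b)" by (simp add: frontier_def interior_open [OF open_box])
        from topological_tendstoD [OF lim _ this] show ?thesis
          by (rule eventually_mono) (use False closure_subset in \<open>auto simp: indicator_def\<close>)
      qed
      then have "(\<lambda>n. indicator (box a b) (x - v n) * h x) \<longlonglongrightarrow> indicator (box a b) x * h x"
        by (intro tendsto_mult_right tendsto_eventually)
      then show "(\<lambda>n. indicator (box a b) (x - v n) * h x) \<longlonglongrightarrow> indicator (box a b) (x - 0) * h x" by simp
    qed
    show "AE x in lborel. norm (indicator (box a b) (x - v n) * h x) \<le> \<bar>h x\<bar>" for n
      by (intro AE_I2) (auto simp: indicator_def)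
  qed (use int_abs_h in auto)
  have zero: "(\<integral>w. std_gauss w * J (s *\<^sub>R w) \<partial>lborel) = 0" if "s > 0" for s
  proof -
    define B where "B z = (indicator (box a b) z :: real)" for z
    have [measurable]: "B \<in> borel_measurable borel" unfolding B_def [abs_def] by measurable
    have "(\<integral>w. std_gauss w * J (s *\<^sub>R w) \<partial>lborel) = (\<integral>w. \<integral>x. std_gauss w * (B (x - s *\<^sub>R w) * h x) \<partial>lborel \<partial>lborel)"
      by (simp add: J_def B_def)
    also have "\<dots> = (\<integral>x. \<integral>w. std_gauss w * (B (x - s *\<^sub>R w) * h x) \<partial>lborel \<partial>lborel)"
      by (rule lborel_pair.Fubini_integral,
          rule integrable_product_norm_le [OF _ int_abs_h integrable_std_gauss])
         (auto simp: case_prod_beta abs_mult B_def indicator_def std_gauss_def)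
    \<comment> \<open>The substitution z = x - s w frees the indicator of the box from the averaging
      variable, so that integration over x produces a convolution of h.\<close>
    also have "\<dots> = (\<integral>x. \<integral>z. (1 / s) ^ DIM('a) * (std_gauss ((1 / s) *\<^sub>R (x - z)) * (B z * h x)) \<partial>lborel \<partial>lborel)"
    proof (rule Bochner_Integration.integral_cong [OF refl])
      fix x :: 'a
      have shift: "(1 / s) *\<^sub>R x + (- 1 / s) *\<^sub>R z = (1 / s) *\<^sub>R (x - z)" for z
        by (simp only: minus_divide_left [symmetric] scaleR_minus_left scaleR_diff_right add_uminus_conv_diff)
      have unshift: "x - s *\<^sub>R ((1 / s) *\<^sub>R (x - z)) = z" for z
        using that by simp
      have meas: "(\<lambda>w. std_gauss w * (B (x - s *\<^sub>R w) * h x)) \<in> borel_measurable borel"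
        by measurable
      have "- 1 / s \<noteq> 0" using that by simp
      note lborel_integral_affine [OF meas this, of "(1 / s) *\<^sub>R x", unfolded shift unshift]
      then have "(\<integral>w. std_gauss w * (B (x - s *\<^sub>R w) * h x) \<partial>lborel) =
          \<bar>- 1 / s\<bar> ^ DIM('a) *\<^sub>R (\<integral>z. std_gauss ((1 / s) *\<^sub>R (x - z)) * (B z * h x) \<partial>lborel)"
        .
      then show "(\<integral>w. std_gauss w * (B (x - s *\<^sub>R w) * h x) \<partial>lborel) =
          (\<integral>z. (1 / s) ^ DIM('a) * (std_gauss ((1 / s) *\<^sub>R (x - z)) * (B z * h x)) \<partial>lborel)"
        using that by (simp only: integral_mult_right_zero) simp
    qed
    also have "\<dots> = (\<integral>z. \<integral>x. (1 / s) ^ DIM('a) * (std_gauss ((1 / s) *\<^sub>R (x - z)) * (B z * h x)) \<partial>lborel \<partial>lborel)"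
    proof (rule lborel_pair.Fubini_integral [symmetric], rule integrable_product_norm_le)
      show "integrable lborel (\<lambda>x. (1 / s) ^ DIM('a) * \<bar>h x\<bar>)"
        by (intro integrable_mult_right int_abs_h)
      show "integrable lborel B" unfolding B_def
        by (intro integrable_real_indicator) (use emeasure_bounded_finite [OF bounded_box] in auto)
      show "norm (case (x, z) of (x, z) \<Rightarrow> (1 / s) ^ DIM('a) * (std_gauss ((1 / s) *\<^sub>R (x - z)) * (B z * h x))) \<le>
          (1 / s) ^ DIM('a) * \<bar>h x\<bar> * B z" for x z
        using that by (auto simp: B_def indicator_def abs_mult std_gauss_def mult_left_le_one_le)
    qed measurable
    also have "\<dots> = (\<integral>z. (1 / s) ^ DIM('a) * B z * (\<integral>x. h x * std_gauss ((1 / s) *\<^sub>R (x - z)) \<partial>lborel) \<partial>lborel)"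
      by (intro Bochner_Integration.integral_cong refl) (simp add: mult_ac flip: integral_mult_right_zero)
    finally show ?thesis by (simp add: conv [OF that])
  qed
  have "(\<lambda>n. \<integral>w. std_gauss w * J ((1 / real (Suc n)) *\<^sub>R w) \<partial>lborel) \<longlonglongrightarrow> (\<integral>w. std_gauss w * J 0 \<partial>(lborel :: 'a measure))"
  proof (rule integral_dominated_convergence [where w = "\<lambda>w::'a. std_gauss w * (\<integral>x. \<bar>h x\<bar> \<partial>lborel)"])
    show "AE w in lborel. (\<lambda>n. std_gauss w * J ((1 / real (Suc n)) *\<^sub>R w)) \<longlonglongrightarrow> std_gauss w * J 0"
    proof (intro AE_I2 tendsto_mult_left J_0)
      fix w :: 'a
      have "(\<lambda>n. (1 / real (Suc n)) *\<^sub>R w) \<longlonglongrightarrow> 0 *\<^sub>R w"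
        using LIMSEQ_inverse_real_of_nat by (intro tendsto_scaleR tendsto_const) (simp add: inverse_eq_divide)
      then show "(\<lambda>n. (1 / real (Suc n)) *\<^sub>R w) \<longlonglongrightarrow> 0" by simp
    qed
    show "AE w in lborel. norm (std_gauss w * J ((1 / real (Suc n)) *\<^sub>R w)) \<le> std_gauss w * (\<integral>x. \<bar>h x\<bar> \<partial>lborel)" for n
      by (intro AE_I2) (auto simp: abs_mult std_gauss_def intro!: mult_left_mono J_le)
  qed (use integrable_std_gauss in auto)
  moreover have "(\<integral>w. std_gauss w * J ((1 / real (Suc n)) *\<^sub>R w) \<partial>lborel) = 0" for n
    by (rule zero) simp
  ultimately have "(\<lambda>n::nat. 0) \<longlonglongrightarrow> (\<integral>w. std_gauss w * J 0 \<partial>(lborel :: 'a measure))"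
    by (simp only:)
  then have "(\<integral>w. std_gauss w * J 0 \<partial>(lborel :: 'a measure)) = 0"
    using tendsto_const by (rule LIMSEQ_unique)
  then have "J 0 = 0"
    using gauss_mass_pos [of 1, where 'a = 'a] by (simp add: integral_std_gauss)
  then show ?thesis by (simp add: J_def)
qed

text \<open>Boxes are closed under intersection and generate the Borel sets, so h integrates to zero
  over every Borel set. The total integral enters for complements, as the whole space is not a
  box.\<close>

lemma box_integrals_zero_imp_AE_zero:
  fixes h :: "'a::euclidean_space \<Rightarrow> real"
  assumes int_h: "integrable lborel h"
    and total: "(\<integral>x. h x \<partial>lborel) = 0"
    and box: "\<And>a b. (\<integral>x. indicator (box a b) x * h x \<partial>lborel) = 0"
  shows "AE x in lborel. h x = 0"
proof (rule density_unique_real [OF int_h integrable_zero])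
  fix A :: "'a set" assume "A \<in> sets lborel"
  then have A: "A \<in> sigma_sets UNIV (range (\<lambda>(a, b). box a b))"
    by (simp add: borel_eq_box)
  have stable: "Int_stable (range (\<lambda>(a, b). box a b :: 'a set))"
    by (auto simp: Int_stable_def box_Int_box)
  have sub: "range (\<lambda>(a, b). box a b :: 'a set) \<subseteq> Pow UNIV" by simp
  from stable sub A have "set_lebesgue_integral lborel A h = 0"
  proof (induction rule: sigma_sets_induct_disjoint)
    case (basic A)
    then show ?case using box by (auto simp: set_lebesgue_integral_def)
  next
    case empty
    then show ?case by (simp add: set_lebesgue_integral_def)
  next
    case (compl A)
    then have [measurable]: "A \<in> sets borel" by (simp add: borel_eq_box)
    have "set_lebesgue_integral lborel (UNIV - A) h =
        (\<integral>x. h x - indicator A x * h x \<partial>lborel)"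
      unfolding set_lebesgue_integral_def
      by (intro Bochner_Integration.integral_cong refl) (auto simp: indicator_def)
    also have "\<dots> = (\<integral>x. h x \<partial>lborel) - (\<integral>x. indicator A x * h x \<partial>lborel)"
      using integrable_mult_indicator [OF _ int_h, of A]
      by (intro Bochner_Integration.integral_diff int_h) auto
    also have "\<dots> = 0"
      using compl total by (simp add: set_lebesgue_integral_def)
    finally show ?case .
  next
    case (union A)
    then have meas: "\<And>i. A i \<in> sets lborel" by (auto simp: borel_eq_box)
    have "set_integrable lborel (\<Union>i. A i) h"
      unfolding set_integrable_def using meas by (intro integrable_mult_indicator int_h) auto
    then show ?case
      using union meas by (subst lebesgue_integral_countable_add) (auto simp: disjoint_family_on_def)
  qed
  then show "set_lebesgue_integral lborel A h = set_lebesgue_integral lborel A (\<lambda>_. 0)"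
    by (simp add: set_lebesgue_integral_def)
qed

text \<open>Gaussian decay makes exp (r |x|) |h x| integrable for every r, so the Fourier integral
  of h expands everywhere into a series of its moments and is zero.\<close>

lemma gaussian_moments_zero_imp_AE_zero:
  fixes h :: "'a::euclidean_space \<Rightarrow> real"
  assumes h [measurable]: "h \<in> borel_measurable borel"
    and "p > 0" and h_le: "\<And>x. \<bar>h x\<bar> \<le> C * exp (- p * (norm x)\<^sup>2)"
    and moments: "\<And>k z. (\<integral>x. (x \<bullet> z) ^ k * h x \<partial>lborel) = 0"
  shows "AE x in lborel. h x = 0"
proof -
  have int_exp_h: "integrable lborel (\<lambda>x. exp (r * norm x) * \<bar>h x\<bar>)" for r
  proof (rule Bochner_Integration.integrable_bound)
    show "integrable lborel (\<lambda>x::'a. C * (exp (r * norm x) * exp (- p * (norm x)\<^sup>2)))"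
      by (intro integrable_mult_right integrable_exp_norm_gaussian \<open>p > 0\<close>)
    show "AE x in lborel. norm (exp (r * norm x) * \<bar>h x\<bar>) \<le> norm (C * (exp (r * norm x) * exp (- p * (norm x)\<^sup>2)))"
    proof (rule AE_I2)
      fix x
      have "exp (r * norm x) * \<bar>h x\<bar> \<le> exp (r * norm x) * (C * exp (- p * (norm x)\<^sup>2))"
        by (intro mult_left_mono h_le) auto
      also have "\<dots> \<le> norm (C * (exp (r * norm x) * exp (- p * (norm x)\<^sup>2)))"
        by (simp add: mult_ac)
      finally show "norm (exp (r * norm x) * \<bar>h x\<bar>) \<le> norm (C * (exp (r * norm x) * exp (- p * (norm x)\<^sup>2)))"
        by simp
    qed
  qed simp
  have int_abs_h: "integrable lborel (\<lambda>x. \<bar>h x\<bar>)" using int_exp_h [of 0] by simp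
  then have int_h: "integrable lborel h" by (simp add: integrable_abs_iff)

  have fourier: "(\<integral>x. exp (- \<i> * of_real (x \<bullet> y)) * of_real (h x) \<partial>lborel) = 0" for y
  proof -
    define u where "u k x = (- \<i> * of_real (x \<bullet> y)) ^ k / fact k * of_real (h x)" for k x
    have "(\<lambda>k. integral\<^sup>L lborel (u k)) sums (\<integral>x. (\<Sum>k. u k x) \<partial>lborel)"
    proof (rule exp_dominated_sums [OF _ _ _ int_exp_h [of "norm y"]])
      fix k x
      have "\<bar>x \<bullet> y\<bar> \<le> norm y * norm x"
        using Cauchy_Schwarz_ineq2 [of x y] by (simp add: mult.commute)
      then have "\<bar>x \<bullet> y\<bar> ^ k \<le> (norm y * norm x) ^ k" by (rule power_mono) simp
      then show "norm (u k x) \<le> (norm y * norm x) ^ k / fact k * \<bar>h x\<bar>"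
        by (simp add: u_def norm_mult norm_divide norm_power mult_right_mono divide_right_mono)
    qed (auto simp: u_def [abs_def])
    moreover have "integral\<^sup>L lborel (u k) = 0" for k
    proof -
      have "u k = (\<lambda>x. (- \<i>) ^ k / fact k * of_real ((x \<bullet> y) ^ k * h x))"
        unfolding u_def [abs_def] power_mult_distrib by (simp add: mult_ac)
      then show ?thesis
        by (simp only: integral_mult_right_zero integral_complex_of_real moments of_real_0 mult_zero_right)
    qed
    moreover have "(\<Sum>k. u k x) = exp (- \<i> * of_real (x \<bullet> y)) * of_real (h x)" for x
    proof -
      have "(\<lambda>k. (- \<i> * of_real (x \<bullet> y)) ^ k / fact k) sums exp (- \<i> * of_real (x \<bullet> y))"
        using exp_converges [of "- \<i> * of_real (x \<bullet> y)"] by (simp add: scaleR_conv_of_real field_simps)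
      from sums_mult2 [OF this] show ?thesis unfolding u_def by (rule sums_unique [symmetric])
    qed
    ultimately show ?thesis by (simp add: sums_iff)
  qed

  have "(\<integral>x. h x \<partial>lborel) = 0" using moments [of 0 0] by simp
  with int_h show ?thesis
    by (intro box_integrals_zero_imp_AE_zero gaussian_convolution_zero_imp_box_integral_zero
        fourier_zero_imp_gaussian_convolution_zero fourier)
qed

subsection \<open>The Clifford-Fourier transform of Gaussian-bounded functions\<close>

text \<open>Letters are replaced but never added or removed. Hence \<open>gam\<close> and its
  exponential respect the order of tensors, and entries at words of other lengths have no
  influence.\<close>

lemma rot_cong:
  assumes "\<And>v. length v = length w \<Longrightarrow> a v = b v"
  shows "rot j l w a = rot j l w b"
  using assms
proof (induction w arbitrary: a b)
  case (Cons i w)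
  have "rot j l w (\<lambda>v. a (i # v)) = rot j l w (\<lambda>v. b (i # v))"
    by (rule Cons.IH) (simp add: Cons.prems)
  then show ?case by (simp add: Cons.prems)
qed simp

lemma cgam_pow_cong:
  assumes "\<And>v. v \<in> words k \<Longrightarrow> a v = b v" and "w \<in> words k"
  shows "(cgam c ^^ n) a w = (cgam c ^^ n) b w"
  using assms(2)
proof (induction n arbitrary: w)
  case (Suc n)
  have "rot j l w ((cgam c ^^ n) a) = rot j l w ((cgam c ^^ n) b)" for j l
    by (rule rot_cong) (use Suc in \<open>auto simp: words_def\<close>)
  then show ?case by (simp add: cgam_def [of c "(cgam c ^^ n) _"] gam_def)
qed (simp add: assms)

lemma tens_exp_cong:
  assumes "\<And>v. v \<in> words k \<Longrightarrow> a v = b v" and "w \<in> words k"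
  shows "tens_exp c a w = tens_exp c b w"
  using cgam_pow_cong [OF assms] by (simp add: tens_exp_def)

lemma cgam_sum: "cgam c (\<lambda>w. \<Sum>i\<in>I. a i w) w = (\<Sum>i\<in>I. cgam c (a i) w)"
proof -
  have "gam (\<lambda>w. \<Sum>i\<in>I. a i w) w = (\<Sum>i\<in>I. gam (a i) w)"
    unfolding gam_def rot_sum cl_mult_sum_right case_prod_beta sum_negf by (subst sum.swap) (rule refl)
  then show ?thesis by (simp add: cgam_def smult_sum)
qed

lemma cgam_pow_sum: "(cgam c ^^ n) (\<lambda>w. \<Sum>i\<in>I. a i w) w = (\<Sum>i\<in>I. (cgam c ^^ n) (a i) w)"
proof (induction n arbitrary: w)
  case (Suc n)
  have "(cgam c ^^ n) (\<lambda>w. \<Sum>i\<in>I. a i w) = (\<lambda>w. \<Sum>i\<in>I. (cgam c ^^ n) (a i) w)"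
    using Suc by auto
  then show ?case by (simp add: cgam_sum)
qed simp

lemma tens_exp_sum: "tens_exp c (\<lambda>w. \<Sum>i\<in>I. a i w) w = (\<Sum>i\<in>I. tens_exp c (a i) w)"
proof (rule sums_unique2 [OF tens_exp_sums])
  show "(\<lambda>n. (1 / fact n) *\<^sub>R (cgam c ^^ n) (\<lambda>w. \<Sum>i\<in>I. a i w) w) sums (\<Sum>i\<in>I. tens_exp c (a i) w)"
    unfolding cgam_pow_sum scaleR_sum_right by (intro sums_sum tens_exp_sums)
qed

lemma tens_exp_mult_right: "tens_exp c (\<lambda>w. a w \<odot> z) w = tens_exp c a w \<odot> z"
proof (rule sums_unique2 [OF tens_exp_sums])
  show "(\<lambda>n. (1 / fact n) *\<^sub>R (cgam c ^^ n) (\<lambda>w. a w \<odot> z) w) sums (tens_exp c a w \<odot> z)"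
    unfolding cgam_pow_mult_right cl_mult.scaleR_left [symmetric]
    by (intro bounded_linear.sums [OF cl_mult.bounded_linear_left] tens_exp_sums)
qed

definition unit_tensor :: "'n list \<Rightarrow> 'n list \<Rightarrow> 'n::{finite,linorder} cclifford"
  where "unit_tensor v w = (if w = v then blade {} else 0)"

definition exp_gamma_coeff :: "complex \<Rightarrow> nat \<Rightarrow> 'n list \<Rightarrow> 'n point \<Rightarrow> 'n::{finite,linorder} cclifford"
  where "exp_gamma_coeff c k v y = tens_eval k (tens_exp c (unit_tensor v)) y"

text \<open>Separates the tensor from the dependence on y: the factors
  \<open>exp_gamma_coeff\<close> are fixed Clifford-valued polynomials in y. With a tensor depending
  on x, the integral over x thus passes through exp (c \<open>\<Gamma>\<close>) as a finite
  sum.\<close>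

lemma exp_gamma_tens_eval_expand:
  "exp_gamma c (tens_eval k a) y = (\<Sum>v\<in>words k. exp_gamma_coeff c k v y \<odot> a v)"
proof -
  have "tens_exp c a w = (\<Sum>v\<in>words k. tens_exp c (unit_tensor v) w \<odot> a v)" if "w \<in> words k" for w
  proof -
    have "a u = (\<Sum>v\<in>words k. unit_tensor v u \<odot> a v)" if "u \<in> words k" for u
    proof -
      have "(\<Sum>v\<in>words k. unit_tensor v u \<odot> a v) = (\<Sum>v\<in>words k. if u = v then a v else 0)"
        by (intro sum.cong refl) (simp add: unit_tensor_def cl_mult_one_left)
      then show ?thesis using that by simp
    qed
    then have "tens_exp c a w = tens_exp c (\<lambda>w. \<Sum>v\<in>words k. unit_tensor v w \<odot> a v) w"
      using that by (intro tens_exp_cong [where k = k]) auto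
    then show ?thesis by (simp only: tens_exp_sum tens_exp_mult_right)
  qed
  then have "exp_gamma c (tens_eval k a) y =
      tens_eval k (\<lambda>w. \<Sum>v\<in>words k. tens_exp c (unit_tensor v) w \<odot> a v) y"
    by (simp add: exp_gamma_tens_eval) (simp add: tens_eval_def)
  also have "\<dots> = (\<Sum>v\<in>words k. tens_eval k (\<lambda>w. tens_exp c (unit_tensor v) w \<odot> a v) y)"
    by (rule tens_eval_sum)
  also have "\<dots> = (\<Sum>v\<in>words k. exp_gamma_coeff c k v y \<odot> a v)"
    unfolding exp_gamma_coeff_def
    by (intro sum.cong refl tens_eval_linear bounded_linear.linear [OF cl_mult.bounded_linear_left])
  finally show ?thesis .
qed

text \<open>The k-th tensor power of x with the Taylor factor of the exponential; it represents
  \<open>plane_wave_term k x\<close> by \<open>sum_tens_mult\<close>.\<close>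

definition wave_tensor :: "nat \<Rightarrow> 'n point \<Rightarrow> 'n list \<Rightarrow> 'n::{finite,linorder} cclifford"
  where "wave_tensor k x w = ((- \<i>) ^ k / fact k * of_real (tens x w)) *s blade {}"

lemma plane_wave_term_eq: "plane_wave_term k x = tens_eval k (wave_tensor k x)"
proof
  fix y
  have "tens_eval k (wave_tensor k x) y =
      (\<Sum>w\<in>words k. ((- \<i>) ^ k / fact k * of_real (tens x w * tens y w)) *s blade {})"
    unfolding tens_eval_def wave_tensor_def scaleR_conv_smult vector_smult_assoc by (simp add: mult_ac)
  also have "\<dots> = ((- \<i>) ^ k / fact k * of_real ((x \<bullet> y) ^ k)) *s blade {}"
    unfolding sum_tens_mult [symmetric] of_real_sum sum_distrib_left by (simp add: vec_eq_iff sum_distrib_right)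
  finally show "plane_wave_term k x y = tens_eval k (wave_tensor k x) y"
    unfolding plane_wave_term_def power_mult_distrib by simp
qed

lemma norm_blade [simp]: "norm (blade A :: 'n::{finite,linorder} cclifford) = 1"
  by (simp add: blade_def)

text \<open>The isometry leaves the l^2 norm |x|^k / k! of the wave tensor unchanged, and evaluation
  at y multiplies it by at most |y|^k. The bound is the one for the classical exponential.\<close>

lemma norm_exp_gamma_plane_wave_le:
  assumes "Re c = 0"
  shows "norm (exp_gamma c (plane_wave_term k x) y) \<le> (norm y * norm x) ^ k / fact k"
proof -
  have "(wave_tensor k x w \<bullet> wave_tensor k x w) = (1 / fact k)\<^sup>2 * (tens x w * tens x w)" for w
    by (simp add: wave_tensor_def norm_smult norm_mult norm_divide norm_power power2_eq_square
        flip: power2_norm_eq_inner)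
  then have "(\<Sum>w\<in>words k. wave_tensor k x w \<bullet> wave_tensor k x w) = (1 / fact k)\<^sup>2 * (norm x ^ k)\<^sup>2"
    by (simp only: sum_distrib_left [symmetric] sum_tens_mult power2_norm_eq_inner [symmetric])
       (simp flip: power_mult add: mult.commute)
  then have "sqrt (\<Sum>w\<in>words k. wave_tensor k x w \<bullet> wave_tensor k x w) = norm x ^ k / fact k"
    by (simp add: real_sqrt_mult)
  moreover have "norm (exp_gamma c (plane_wave_term k x) y) \<le>
      norm y ^ k * sqrt (\<Sum>w\<in>words k. wave_tensor k x w \<bullet> wave_tensor k x w)"
    unfolding plane_wave_term_eq exp_gamma_tens_eval
    using norm_tens_eval_le [of k "tens_exp c (wave_tensor k x)" y] by (simp add: tens_exp_isometry [OF assms])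
  ultimately show ?thesis by (simp add: power_mult_distrib)
qed

lemma borel_measurable_tens [measurable]: "(\<lambda>x. tens x w) \<in> borel_measurable borel"
proof (induction w)
  case (Cons i w)
  have "(\<lambda>x::'a point. x $ i) \<in> borel_measurable borel"
    by (intro borel_measurable_continuous_onI continuous_on_component continuous_on_id)
  with Cons show ?case by simp
qed simp

section \<open>Moments and the homogeneous expansion of the transform\<close>

definition moment_tensor :: "('n::{finite,linorder} point \<Rightarrow> 'n cclifford) \<Rightarrow> 'n list \<Rightarrow> 'n cclifford"
  where "moment_tensor \<phi> w = (\<integral>x. tens x w *\<^sub>R \<phi> x \<partial>lebesgue)"

text \<open>The part of degree k in y of the integral of the kernel against \<open>\<phi>\<close>,
  without the normalising power of 2 pi: exp (c \<open>\<Gamma>\<close>) applied to the classical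
  Taylor term. See \<open>has_integral_term\<close>.\<close>

definition cft_coeff ::
    "complex \<Rightarrow> ('n::{finite,linorder} point \<Rightarrow> 'n cclifford) \<Rightarrow> nat \<Rightarrow> 'n point \<Rightarrow> 'n cclifford"
  where "cft_coeff c \<phi> k y = exp_gamma c (tens_eval k (\<lambda>w. ((- \<i>) ^ k / fact k) *s moment_tensor \<phi> w)) y"

lemma cft_coeff_scaleR: "cft_coeff c \<phi> k (t *\<^sub>R y) = t ^ k *\<^sub>R cft_coeff c \<phi> k y"
  by (simp add: cft_coeff_def exp_gamma_tens_eval tens_eval_scaleR)

text \<open>The angular operator annihilates constants, since \<open>rot\<close> on the empty word
  is zero; only the first term of the exponential remains.\<close>

lemma cft_coeff_0: "cft_coeff c \<phi> 0 y = (\<integral>x. \<phi> x \<partial>lebesgue)"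
proof -
  have "(cgam c ^^ Suc n) a [] = 0" for n and a :: "'a list \<Rightarrow> 'a cclifford"
    by (simp add: cgam_def [of c "(cgam c ^^ n) a"] gam_def case_prod_beta)
  then have "(1 / fact n) *\<^sub>R (cgam c ^^ n) a [] = (if n = 0 then a [] else 0)" for n and a :: "'a list \<Rightarrow> 'a cclifford"
    by (cases n) (simp_all del: funpow.simps(2))
  then have "tens_exp c a [] = a []" for a :: "'a list \<Rightarrow> 'a cclifford"
    using sums_single [of 0 "\<lambda>_. a []"] tens_exp_sums [of c a "[]"] by (simp add: sums_iff del: One_nat_def)
  then show ?thesis by (simp add: cft_coeff_def exp_gamma_tens_eval moment_tensor_def)
qed

locale gaussian_bounded =
  fixes \<phi> :: "'n::{finite,linorder} point \<Rightarrow> 'n cclifford" and p C :: real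
  assumes meas [measurable]: "\<phi> \<in> borel_measurable lebesgue"
    and p_pos: "p > 0"
    and bound: "\<And>x. norm (\<phi> x) \<le> C * exp (- p * (norm x)\<^sup>2)"
begin

lemma C_nonneg: "C \<ge> 0"
  using order.trans [OF norm_ge_zero bound [of 0]] by simp

lemma integrable_weight: "integrable lebesgue (\<lambda>x::'n point. exp (r * norm x) * (D * exp (- p * (norm x)\<^sup>2)))"
proof -
  have "integrable lborel (\<lambda>x::'n point. D * (exp (r * norm x) * exp (- p * (norm x)\<^sup>2)))"
    by (intro integrable_mult_right integrable_exp_norm_gaussian p_pos)
  then show ?thesis
    by (subst integrable_completion) (auto simp: mult_ac)
qed

lemma integrable_power_weight:
  assumes u [measurable]: "u \<in> borel_measurable lebesgue" and le: "\<And>x. norm (u x :: 'b::{banach, second_countable_topology}) \<le> D * norm x ^ k * norm (\<phi> x)" and "D \<ge> 0"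
  shows "integrable lebesgue u"
proof (rule Bochner_Integration.integrable_bound [OF integrable_weight [of 1 "D * fact k * C"]])
  show "AE x in lebesgue. norm (u x) \<le> norm (exp (1 * norm x) * (D * fact k * C * exp (- p * (norm x)\<^sup>2)))"
  proof (rule AE_I2)
    fix x :: "'n point"
    have "norm x ^ k / fact k \<le> exp (norm x)"
      using sum_le_suminf [OF summable_exp_generic [of "norm x"], of "{k}"]
      by (simp add: exp_def field_simps)
    then have "norm x ^ k \<le> fact k * exp (norm x)" by (simp add: field_simps)
    then have "D * norm x ^ k * norm (\<phi> x) \<le> D * (fact k * exp (norm x)) * (C * exp (- p * (norm x)\<^sup>2))"
      using C_nonneg \<open>D \<ge> 0\<close> by (intro mult_mono bound) auto
    with le [of x] show "norm (u x) \<le> norm (exp (1 * norm x) * (D * fact k * C * exp (- p * (norm x)\<^sup>2)))"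
      using C_nonneg \<open>D \<ge> 0\<close> by (simp add: abs_mult mult_ac)
  qed
qed fact

lemma integrable_tens: "integrable lebesgue (\<lambda>x. tens x w *\<^sub>R \<phi> x)"
proof (rule integrable_power_weight [where D = 1 and k = "length w"])
  have "(\<lambda>x. tens x w) \<in> borel_measurable lebesgue" by (rule measurable_completion) measurable
  then show "(\<lambda>x. tens x w *\<^sub>R \<phi> x) \<in> borel_measurable lebesgue" by measurable
  show "norm (tens x w *\<^sub>R \<phi> x) \<le> 1 * norm x ^ length w * norm (\<phi> x)" for x
    using abs_tens_le [of w "length w" x] by (simp add: words_def mult_right_mono)
qed simp

lemma has_integral_term:
  "has_bochner_integral lebesgue (\<lambda>x. exp_gamma c (plane_wave_term k x) y \<odot> \<phi> x) (cft_coeff c \<phi> k y)"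
proof -
  define s where "s = (- \<i>) ^ k / fact k"
  have "exp_gamma c (plane_wave_term k x) y \<odot> \<phi> x =
      (\<Sum>v\<in>words k. s *s (exp_gamma_coeff c k v y \<odot> (tens x v *\<^sub>R \<phi> x)))" for x
    unfolding plane_wave_term_eq exp_gamma_tens_eval_expand cl_mult_sum_left
    by (intro sum.cong refl)
       (simp add: wave_tensor_def s_def cl_mult_smult_left cl_mult_smult_right cl_mult_one_right
         scaleR_conv_smult vector_smult_assoc)
  moreover have "has_bochner_integral lebesgue
      (\<lambda>x. \<Sum>v\<in>words k. s *s (exp_gamma_coeff c k v y \<odot> (tens x v *\<^sub>R \<phi> x)))
      (\<Sum>v\<in>words k. s *s (exp_gamma_coeff c k v y \<odot> moment_tensor \<phi> v))"
    unfolding moment_tensor_def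
    by (intro has_bochner_integral_sum has_bochner_integral_bounded_linear [OF bounded_linear_smult]
        has_bochner_integral_bounded_linear [OF cl_mult.bounded_linear_right]
        has_bochner_integral_integrable integrable_tens)
  ultimately show ?thesis
    by (simp add: cft_coeff_def exp_gamma_tens_eval_expand s_def cl_mult_smult_right)
qed

text \<open>Termwise integration by the \<open>exp_dominated\<close> lemmas with r = |y| |x| and a
  multiple of the Gaussian as h. D combines the bound of \<open>\<phi>\<close> with the norm of the
  Clifford product and does not depend on y.\<close>

lemma kernel_integral_series:
  assumes c: "Re c = 0"
  shows "\<exists>D\<ge>0. \<forall>y. integrable lebesgue (\<lambda>x. cft_kernel c x y \<odot> \<phi> x) \<and>
    (\<lambda>k. cft_coeff c \<phi> k y) sums (\<integral>x. cft_kernel c x y \<odot> \<phi> x \<partial>lebesgue) \<and>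
    summable (\<lambda>k. norm (cft_coeff c \<phi> k y)) \<and>
    (\<Sum>k. norm (cft_coeff c \<phi> k y)) \<le>
      (\<integral>x. exp (norm y * norm x) * (D * exp (- p * (norm (x :: 'n point))\<^sup>2)) \<partial>lebesgue)"
proof -
  obtain L where L: "L > 0" "\<And>u v :: 'n cclifford. norm (u \<odot> v) \<le> norm u * norm v * L"
    using cl_mult.pos_bounded by blast
  define D where "D = L * C"
  have "D \<ge> 0" using L(1) C_nonneg by (simp add: D_def)
  define u where "u y k x = exp_gamma c (plane_wave_term k x) y \<odot> \<phi> x" for y k x
  have u_bound: "norm (u y k x) \<le> (norm y * norm x) ^ k / fact k * (D * exp (- p * (norm x)\<^sup>2))" for y k x
  proof -
    have "norm (u y k x) \<le> norm (exp_gamma c (plane_wave_term k x) y) * norm (\<phi> x) * L"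
      unfolding u_def by (rule L)
    also have "\<dots> \<le> (norm y * norm x) ^ k / fact k * (C * exp (- p * (norm x)\<^sup>2)) * L"
      using L(1) C_nonneg by (intro mult_mono norm_exp_gamma_plane_wave_le [OF c] bound) auto
    finally show ?thesis by (simp add: D_def mult_ac)
  qed
  have u_meas: "u y k \<in> borel_measurable lebesgue" for y k
    using has_integral_term [of c k y] unfolding u_def [abs_def]
    by (auto simp: has_bochner_integral_iff)
  have r_meas: "(\<lambda>x::'n point. norm y * norm x) \<in> borel_measurable lebesgue" for y :: "'n point"
    by (rule measurable_completion) measurable
  have h_meas: "(\<lambda>x::'n point. D * exp (- p * (norm x)\<^sup>2)) \<in> borel_measurable lebesgue"
    by (rule measurable_completion) measurable
  have u_integral: "integral\<^sup>L lebesgue (u y k) = cft_coeff c \<phi> k y" for y k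
    using has_integral_term [of c k y] unfolding u_def [abs_def]
    by (simp add: has_bochner_integral_iff)
  have u_sum: "(\<Sum>k. u y k x) = cft_kernel c x y \<odot> \<phi> x" for y x
  proof -
    have "summable (\<lambda>k. (norm y * norm x) ^ k / fact k)"
      using summable_exp_generic [of "norm y * norm x"] by (simp add: field_simps)
    then have "summable (\<lambda>k. exp_gamma c (plane_wave_term k x) y)"
      by (rule summable_comparison_test' [where N = 0]) (rule norm_exp_gamma_plane_wave_le [OF c])
    then have "(\<lambda>k. exp_gamma c (plane_wave_term k x) y) sums cft_kernel c x y"
      unfolding cft_kernel_def by (rule summable_sums)
    from bounded_linear.sums [OF cl_mult.bounded_linear_left this] show ?thesis
      unfolding u_def by (rule sums_unique [symmetric])
  qed
  note dominated = u_meas r_meas h_meas integrable_weight [where D = D] _ _ u_bound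
  have "integrable lebesgue (\<lambda>x. cft_kernel c x y \<odot> \<phi> x)" for y
    using exp_dominated_integrable [OF dominated, of y] \<open>D \<ge> 0\<close> by (simp add: u_sum)
  moreover have "(\<lambda>k. cft_coeff c \<phi> k y) sums (\<integral>x. cft_kernel c x y \<odot> \<phi> x \<partial>lebesgue)" for y
    using exp_dominated_sums [OF dominated, of y] \<open>D \<ge> 0\<close> by (simp add: u_sum u_integral)
  moreover have "summable (\<lambda>k. norm (cft_coeff c \<phi> k y))" for y
    using exp_dominated_summable [OF dominated, of y] \<open>D \<ge> 0\<close> by (simp add: u_integral)
  moreover have "(\<Sum>k. norm (cft_coeff c \<phi> k y)) \<le>
      (\<integral>x. exp (norm y * norm x) * (D * exp (- p * (norm (x :: 'n point))\<^sup>2)) \<partial>lebesgue)" for y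
    using exp_dominated_suminf_le [OF dominated, of y] \<open>D \<ge> 0\<close> by (simp add: u_integral)
  ultimately show ?thesis using \<open>D \<ge> 0\<close> by blast
qed

lemma integrable_kernel: "Re c = 0 \<Longrightarrow> integrable lebesgue (\<lambda>x. cft_kernel c x y \<odot> \<phi> x)"
  and kernel_integral_sums:
    "Re c = 0 \<Longrightarrow> (\<lambda>k. cft_coeff c \<phi> k y) sums (\<integral>x. cft_kernel c x y \<odot> \<phi> x \<partial>lebesgue)"
  using kernel_integral_series by blast+

text \<open>On the line through e the homogeneous terms become monomials, so each component of the
  transform is a power series in t, to which \<open>Hardy_entire\<close> applies with exponent
  1/(4p). The conclusion is stated for the series, because its coefficients are needed in
  \<open>Hardy_moments_zero\<close>.\<close>

lemma Hardy_sums: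
  assumes c: "Re c = 0" and q: "1 / (4 * p) \<le> q" and e: "norm e = 1"
    and decay: "\<And>y. norm (\<integral>x. cft_kernel c x y \<odot> \<phi> x \<partial>lebesgue) \<le> C' * exp (- q * (norm y)\<^sup>2)"
  shows "(\<lambda>k. cft_coeff c \<phi> k e $ B * z ^ k) sums
    ((\<integral>x. \<phi> x \<partial>lebesgue) $ B * exp (- of_real (1 / (4 * p)) * z\<^sup>2))"
proof -
  obtain D where D: "D \<ge> 0"
    "\<And>y. (\<lambda>k. cft_coeff c \<phi> k y) sums (\<integral>x. cft_kernel c x y \<odot> \<phi> x \<partial>lebesgue)"
    "\<And>y. summable (\<lambda>k. norm (cft_coeff c \<phi> k y))"
    "\<And>y. (\<Sum>k. norm (cft_coeff c \<phi> k y)) \<le>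
      (\<integral>x. exp (norm y * norm x) * (D * exp (- p * (norm (x :: 'n point))\<^sup>2)) \<partial>lebesgue)"
    using kernel_integral_series [OF c] by blast
  obtain M where M: "M > 0" "\<And>r. r \<ge> 0 \<Longrightarrow>
      (\<integral>x. exp (r * norm x) * exp (- p * (norm x)\<^sup>2) \<partial>(lborel :: 'n point measure)) \<le>
      M * (1 + r) ^ DIM('n point) * exp (r\<^sup>2 / (4 * p))"
    using integral_exp_norm_gaussian_le [OF p_pos, where 'a = "'n point"] by blast
  define \<alpha> where "\<alpha> = 1 / (4 * p)"
  have "\<alpha> > 0" using p_pos by (simp add: \<alpha>_def)
  have "C' \<ge> 0" using order.trans [OF norm_ge_zero decay [of 0]] by simp
  define a where "a k = cft_coeff c \<phi> k e $ B" for k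
  define g where "g z = (\<Sum>k. a k * z ^ k)" for z
  define N where "N = DIM('n point)"
  \<comment> \<open>By homogeneity the terms at a complex z are dominated by those of the transform
    at the real point |z| e, so the bound on the sum of norms controls g on the whole plane.\<close>
  have term_le: "norm (a k * z ^ k) \<le> norm (cft_coeff c \<phi> k (norm z *\<^sub>R e))" for k z
    using Finite_Cartesian_Product.norm_nth_le [of "cft_coeff c \<phi> k e" B]
    by (simp add: a_def norm_mult norm_power cft_coeff_scaleR mult.commute mult_left_mono)
  have summ: "summable (\<lambda>k. a k * z ^ k)" for z
    by (rule summable_comparison_test' [OF D(3) [of "norm z *\<^sub>R e"], where N = 0]) (rule term_le)
  have "g z = g 0 * exp (- of_real \<alpha> * z\<^sup>2)" for z
  proof (rule Hardy_entire [OF \<open>\<alpha> > 0\<close>])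
    have "(g has_field_derivative (\<Sum>n. diffs a n * z ^ n)) (at z)" for z
      unfolding g_def [abs_def] by (rule termdiffs_strong_converges_everywhere [OF summ])
    then show "g holomorphic_on UNIV" by (auto simp: holomorphic_on_open)
    \<comment> \<open>\<open>Hardy_entire\<close> takes a single constant for growth and decay; D M
      comes from the former and C' from the latter.\<close>
    show "norm (g z) \<le> max (D * M) C' * (1 + norm z) ^ N * exp (\<alpha> * (norm z)\<^sup>2)" for z
    proof -
      have summ_norm: "summable (\<lambda>k. norm (a k * z ^ k))"
        by (rule summable_comparison_test' [OF D(3) [of "norm z *\<^sub>R e"], where N = 0]) (use term_le in simp)
      have "norm (g z) \<le> (\<Sum>k. norm (a k * z ^ k))"
        unfolding g_def by (rule summable_norm [OF summ_norm])
      also have "\<dots> \<le> (\<Sum>k. norm (cft_coeff c \<phi> k (norm z *\<^sub>R e)))"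
        by (intro suminf_le term_le summ_norm D(3))
      also have "\<dots> \<le> (\<integral>x. exp (norm z * norm x) * (D * exp (- p * (norm (x :: 'n point))\<^sup>2)) \<partial>lebesgue)"
        using D(4) [of "norm z *\<^sub>R e"] e by simp
      also have "\<dots> = D * (\<integral>x. exp (norm z * norm x) * exp (- p * (norm x)\<^sup>2) \<partial>(lborel :: 'n point measure))"
        by (subst integral_completion) (auto simp: mult.left_commute [of _ D])
      also have "\<dots> \<le> D * (M * (1 + norm z) ^ N * exp ((norm z)\<^sup>2 / (4 * p)))"
        unfolding N_def by (intro mult_left_mono M D(1)) auto
      also have "\<dots> = D * M * ((1 + norm z) ^ N * exp (\<alpha> * (norm z)\<^sup>2))"
        by (simp add: \<alpha>_def)
      also have "\<dots> \<le> max (D * M) C' * ((1 + norm z) ^ N * exp (\<alpha> * (norm z)\<^sup>2))"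
        by (intro mult_right_mono) auto
      finally show ?thesis by (simp add: mult.assoc)
    qed
    show "norm (g (of_real t)) \<le> max (D * M) C' * exp (- \<alpha> * t\<^sup>2)" for t
    proof -
      have "(\<lambda>k. cft_coeff c \<phi> k (t *\<^sub>R e) $ B) sums ((\<integral>x. cft_kernel c x (t *\<^sub>R e) \<odot> \<phi> x \<partial>lebesgue) $ B)"
        by (rule bounded_linear.sums [OF bounded_linear_vec_nth D(2)])
      also have "(\<lambda>k. cft_coeff c \<phi> k (t *\<^sub>R e) $ B) = (\<lambda>k. a k * of_real t ^ k)"
        by (simp only: cft_coeff_scaleR vector_scaleR_component) (simp add: a_def scaleR_conv_of_real mult.commute)
      finally have "g (of_real t) = (\<integral>x. cft_kernel c x (t *\<^sub>R e) \<odot> \<phi> x \<partial>lebesgue) $ B"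
        unfolding g_def by (rule sums_unique [symmetric])
      then have "norm (g (of_real t)) \<le> C' * exp (- q * t\<^sup>2)"
        using Finite_Cartesian_Product.norm_nth_le [of "\<integral>x. cft_kernel c x (t *\<^sub>R e) \<odot> \<phi> x \<partial>lebesgue" B]
          decay [of "t *\<^sub>R e"] e by simp
      also have "\<dots> \<le> max (D * M) C' * exp (- \<alpha> * t\<^sup>2)"
        using mult_right_mono [OF q, of "t\<^sup>2"] \<open>C' \<ge> 0\<close> by (intro mult_mono) (auto simp: \<alpha>_def)
      finally show ?thesis .
    qed
  qed
  moreover have "g 0 = (\<integral>x. \<phi> x \<partial>lebesgue) $ B"
    by (simp add: g_def a_def cft_coeff_0)
  moreover have "(\<lambda>k. a k * z ^ k) sums g z" for z
    unfolding g_def by (rule summable_sums [OF summ])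
  ultimately show ?thesis by (simp add: a_def \<alpha>_def)
qed

lemma Hardy_kernel_integral:
  assumes c: "Re c = 0" and q: "1 / (4 * p) \<le> q"
    and decay: "\<And>y. norm (\<integral>x. cft_kernel c x y \<odot> \<phi> x \<partial>lebesgue) \<le> C' * exp (- q * (norm y)\<^sup>2)"
    and e: "norm e = 1"
  shows "(\<integral>x. cft_kernel c x (t *\<^sub>R e) \<odot> \<phi> x \<partial>lebesgue) =
    exp (- (1 / (4 * p)) * t\<^sup>2) *\<^sub>R (\<integral>x. \<phi> x \<partial>lebesgue)"
proof -
  have "(\<integral>x. cft_kernel c x (t *\<^sub>R e) \<odot> \<phi> x \<partial>lebesgue) $ B =
      (exp (- (1 / (4 * p)) * t\<^sup>2) *\<^sub>R (\<integral>x. \<phi> x \<partial>lebesgue)) $ B" for B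
  proof (rule sums_unique2)
    show "(\<lambda>k. cft_coeff c \<phi> k (t *\<^sub>R e) $ B) sums ((\<integral>x. cft_kernel c x (t *\<^sub>R e) \<odot> \<phi> x \<partial>lebesgue) $ B)"
      by (intro bounded_linear.sums [OF bounded_linear_vec_nth] kernel_integral_sums c)
    have "(\<lambda>k. cft_coeff c \<phi> k (t *\<^sub>R e) $ B) = (\<lambda>k. cft_coeff c \<phi> k e $ B * of_real t ^ k)"
      by (simp only: cft_coeff_scaleR vector_scaleR_component) (simp add: scaleR_conv_of_real mult.commute)
    moreover have "(\<integral>x. \<phi> x \<partial>lebesgue) $ B * exp (- of_real (1 / (4 * p)) * (of_real t)\<^sup>2) =
        (exp (- (1 / (4 * p)) * t\<^sup>2) *\<^sub>R (\<integral>x. \<phi> x \<partial>lebesgue)) $ B"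
      by (simp only: vector_scaleR_component) (simp add: scaleR_conv_of_real mult.commute exp_of_real [symmetric])
    ultimately show "(\<lambda>k. cft_coeff c \<phi> k (t *\<^sub>R e) $ B) sums
        ((exp (- (1 / (4 * p)) * t\<^sup>2) *\<^sub>R (\<integral>x. \<phi> x \<partial>lebesgue)) $ B)"
      using Hardy_sums [OF c q e decay, of B "of_real t"] by simp
  qed
  then show ?thesis by (simp add: vec_eq_iff)
qed

text \<open>On any line the transform equals exp (- t^2 / 4p) times the integral of
  \<open>\<phi>\<close>. Decay at a rate above 1/(4p) is compatible with this for large t only if
  the integral is zero.\<close>

lemma Hardy_integral_zero:
  assumes c: "Re c = 0" and q: "1 / (4 * p) < q"
    and decay: "\<And>y. norm (\<integral>x. cft_kernel c x y \<odot> \<phi> x \<partial>lebesgue) \<le> C' * exp (- q * (norm y)\<^sup>2)"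
  shows "(\<integral>x. \<phi> x \<partial>lebesgue) = 0"
proof -
  define e :: "'n point" where "e = axis undefined 1"
  have e: "norm e = 1" by (simp add: e_def)
  define I where "I = norm (\<integral>x. \<phi> x \<partial>lebesgue)"
  have I_le: "I \<le> C' * exp (- (q - 1 / (4 * p)) * t\<^sup>2)" for t
  proof -
    have "exp (- (1 / (4 * p)) * t\<^sup>2) * I \<le> C' * exp (- q * t\<^sup>2)"
      using decay [of "t *\<^sub>R e"] Hardy_kernel_integral [OF c less_imp_le [OF q] decay e, of t] e
      by (simp add: I_def)
    then have "exp (1 / (4 * p) * t\<^sup>2) * (exp (- (1 / (4 * p)) * t\<^sup>2) * I) \<le> exp (1 / (4 * p) * t\<^sup>2) * (C' * exp (- q * t\<^sup>2))"
      by (rule mult_left_mono) simp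
    then show ?thesis
      by (simp only: mult.assoc [symmetric] exp_add [symmetric]) (simp add: mult.assoc mult.left_commute [of _ C'] exp_add [symmetric] algebra_simps)
  qed
  have "((\<lambda>t. C' * exp (- (q - 1 / (4 * p)) * t\<^sup>2)) \<longlongrightarrow> C' * 0) at_top"
  proof (intro tendsto_mult tendsto_const filterlim_compose [OF exp_at_bot])
    show "filterlim (\<lambda>t. - (q - 1 / (4 * p)) * t\<^sup>2) at_bot at_top"
      using q by (intro filterlim_tendsto_neg_mult_at_bot [OF tendsto_const] filterlim_pow_at_top filterlim_ident) auto
  qed
  then have "I \<le> C' * 0"
    by (rule tendsto_lowerbound) (rule always_eventually, intro allI I_le, simp)
  then show ?thesis by (simp add: I_def)
qed

lemma tens_eval_moment_tensor:
  "tens_eval k (moment_tensor \<phi>) y = (\<integral>x. (x \<bullet> y) ^ k *\<^sub>R \<phi> x \<partial>lebesgue)"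
proof -
  have "tens_eval k (moment_tensor \<phi>) y = (\<integral>x. (\<Sum>w\<in>words k. tens y w *\<^sub>R tens x w *\<^sub>R \<phi> x) \<partial>lebesgue)"
    unfolding tens_eval_def moment_tensor_def
    by (subst Bochner_Integration.integral_sum)
       (auto intro!: integrable_scaleR_right integrable_tens simp del: scaleR_scaleR)
  also have "\<dots> = (\<integral>x. (x \<bullet> y) ^ k *\<^sub>R \<phi> x \<partial>lebesgue)"
    by (simp add: scaleR_sum_left [symmetric] sum_tens_mult inner_commute)
  finally show ?thesis .
qed

text \<open>The power series on each line sums to zero, so every homogeneous part of the transform
  vanishes on the unit sphere and then everywhere. Injectivity of exp (c \<open>\<Gamma>\<close>) on
  polynomials turns this into the vanishing of the classical Taylor terms, which are multiples of
  the moments.\<close>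

lemma Hardy_moments_zero:
  assumes c: "Re c = 0" and q: "1 / (4 * p) \<le> q"
    and decay: "\<And>y. norm (\<integral>x. cft_kernel c x y \<odot> \<phi> x \<partial>lebesgue) \<le> C' * exp (- q * (norm y)\<^sup>2)"
    and zero: "(\<integral>x. \<phi> x \<partial>lebesgue) = 0"
  shows "(\<integral>x. (x \<bullet> y) ^ k *\<^sub>R \<phi> x \<partial>lebesgue) = 0"
proof -
  have unit: "cft_coeff c \<phi> k e = 0" if "norm e = 1" for e
  proof -
    have "cft_coeff c \<phi> k e $ B = 0" for B
      by (rule power_series_zero_coeff) (use Hardy_sums [OF c q that decay, of B] zero in simp)
    then show ?thesis by (simp add: vec_eq_iff)
  qed
  have coeff: "cft_coeff c \<phi> k y = 0" for y
  proof (cases "y = 0")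
    case True
    \<comment> \<open>Writing the origin as 0 times a unit vector covers k = 0 as well, where the
      power of 0 is 1.\<close>
    have "cft_coeff c \<phi> k (0 *\<^sub>R axis undefined 1) = 0"
      unfolding cft_coeff_scaleR by (simp add: unit)
    with True show ?thesis by simp
  next
    case False
    define u where "u = (1 / norm y) *\<^sub>R y"
    have "norm u = 1" and y: "norm y *\<^sub>R u = y" using False by (simp_all add: u_def)
    from cft_coeff_scaleR [of c \<phi> k "norm y" u] show ?thesis
      unfolding y unit [OF \<open>norm u = 1\<close>] by simp
  qed
  have "tens_eval k (\<lambda>w. ((- \<i>) ^ k / fact k) *s moment_tensor \<phi> w) y = 0"
    by (rule tens_eval_exp_eq_0_imp [where c = c]) (use coeff in \<open>simp add: cft_coeff_def exp_gamma_tens_eval\<close>)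
  then have "((- \<i>) ^ k / fact k) *s tens_eval k (moment_tensor \<phi>) y = 0"
    by (subst (asm) tens_eval_linear [OF linear_smult])
  then have "tens_eval k (moment_tensor \<phi>) y = 0"
    by (simp add: vec_eq_iff)
  then show ?thesis by (simp only: tens_eval_moment_tensor)
qed

end

subsection \<open>Hardy's theorem\<close>

lemma cl_complexify_simps:
  "cl_complexify (a - b) = cl_complexify a - cl_complexify b"
  "cl_complexify (r *\<^sub>R a) = r *\<^sub>R cl_complexify a"
  by (simp_all add: cl_complexify_def vec_eq_iff complex_eq_iff)

lemma norm_cl_complexify [simp]: "norm (cl_complexify a) = norm a"
  by (simp add: norm_vec_def cl_complexify_def)

lemma bounded_linear_cl_complexify: "bounded_linear (cl_complexify :: 'n::{finite,linorder} clifford \<Rightarrow> _)"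
proof -
  have "linear (cl_complexify :: 'n clifford \<Rightarrow> _)"
    by (rule linearI) (simp_all add: cl_complexify_def vec_eq_iff complex_eq_iff)
  then show ?thesis by (simp add: linear_conv_bounded_linear)
qed

lemma gaussian_bounded_cl_complexify:
  assumes "f \<in> borel_measurable lebesgue" "p > 0" "\<And>x. norm (f x) \<le> C * exp (- p * (norm x)\<^sup>2)"
  shows "gaussian_bounded (\<lambda>x. cl_complexify (f x)) p C"
proof
  have "cl_complexify \<in> borel_measurable borel"
    by (rule borel_measurable_continuous_onI [OF linear_continuous_on [OF bounded_linear_cl_complexify]])
  then show "(\<lambda>x. cl_complexify (f x)) \<in> borel_measurable lebesgue"
    using assms(1) by (rule measurable_compose_rev)
qed (use assms in auto)

text \<open>Applied to each real component, after replacing the Lebesgue measurable component by a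
  Borel function.\<close>

lemma moments_zero_imp_AE_zero:
  fixes f :: "'n::{finite,linorder} point \<Rightarrow> 'n clifford"
  assumes f: "f \<in> borel_measurable lebesgue" "p > 0" "\<And>x. norm (f x) \<le> C * exp (- p * (norm x)\<^sup>2)"
    and moments: "\<And>k y. (\<integral>x. (x \<bullet> y) ^ k *\<^sub>R cl_complexify (f x) \<partial>lebesgue) = 0"
  shows "AE x in lebesgue. f x = 0"
proof -
  interpret gaussian_bounded "\<lambda>x. cl_complexify (f x)" p C
    by (rule gaussian_bounded_cl_complexify [OF f])
  have "AE x in lebesgue. f x $ B = 0" for B
  proof -
    have nth_le: "\<bar>f x $ B\<bar> \<le> C * exp (- p * (norm x)\<^sup>2)" for x
      using component_le_norm_cart [of "f x" B] f(3) [of x] by linarith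
    have "(\<lambda>x. f x $ B) \<in> borel_measurable lebesgue"
      using f(1) by (rule measurable_compose)
        (intro borel_measurable_continuous_onI continuous_on_component continuous_on_id)
    then obtain g where g [measurable]: "g \<in> borel_measurable lborel" and g_eq: "AE x in lborel. f x $ B = g x"
      using completion_ex_borel_measurable_real by blast
    \<comment> \<open>The Borel function g agrees with the component only almost everywhere; the
      truncation restores the Gaussian bound at every point and changes g only on a null
      set.\<close>
    define h where "h x = (if \<bar>g x\<bar> \<le> C * exp (- p * (norm x)\<^sup>2) then g x else 0)" for x
    have [measurable]: "h \<in> borel_measurable borel" unfolding h_def [abs_def] using g by measurable
    have h_eq: "AE x in lborel. f x $ B = h x"
      using g_eq
    proof eventually_elim
      fix x assume "f x $ B = g x"
      with nth_le [of x] show "f x $ B = h x" by (simp add: h_def)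
    qed
    have "AE x in lborel. h x = 0"
    proof (rule gaussian_moments_zero_imp_AE_zero [OF _ \<open>p > 0\<close>])
      show "\<bar>h x\<bar> \<le> C * exp (- p * (norm x)\<^sup>2)" for x
        using C_nonneg by (auto simp: h_def)
      show "(\<integral>x. (x \<bullet> z) ^ k * h x \<partial>lborel) = 0" for k z
      proof -
        have int: "integrable lebesgue (\<lambda>x. (x \<bullet> z) ^ k *\<^sub>R cl_complexify (f x))"
        proof (rule integrable_power_weight [where D = "norm z ^ k" and k = k])
          have "(\<lambda>x. (x \<bullet> z) ^ k) \<in> borel_measurable lebesgue"
            by (rule measurable_completion) measurable
          then show "(\<lambda>x. (x \<bullet> z) ^ k *\<^sub>R cl_complexify (f x)) \<in> borel_measurable lebesgue" by measurable
          show "norm ((x \<bullet> z) ^ k *\<^sub>R cl_complexify (f x)) \<le> norm z ^ k * norm x ^ k * norm (cl_complexify (f x))" for x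
            using power_mono [OF Cauchy_Schwarz_ineq2 [of x z] abs_ge_zero, of k]
            by (simp add: power_abs power_mult_distrib mult.commute [of "norm z ^ k"] mult_right_mono)
        qed simp
        have "complex_of_real (\<integral>x. (x \<bullet> z) ^ k * h x \<partial>lborel) = (\<integral>x. complex_of_real ((x \<bullet> z) ^ k * h x) \<partial>lebesgue)"
        proof -
          have "(\<integral>x. (x \<bullet> z) ^ k * h x \<partial>lebesgue) = (\<integral>x. (x \<bullet> z) ^ k * h x \<partial>lborel)"
            by (rule integral_completion) measurable
          then show ?thesis by (simp only: integral_complex_of_real)
        qed
        also have "\<dots> = (\<integral>x. ((x \<bullet> z) ^ k *\<^sub>R cl_complexify (f x)) $ B \<partial>lebesgue)"
        proof (rule integral_cong_AE)
          show "(\<lambda>x. complex_of_real ((x \<bullet> z) ^ k * h x)) \<in> borel_measurable lebesgue"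
            by (rule measurable_completion) measurable
          show "(\<lambda>x. ((x \<bullet> z) ^ k *\<^sub>R cl_complexify (f x)) $ B) \<in> borel_measurable lebesgue"
            using integrable_bounded_linear [OF bounded_linear_vec_nth int] by (rule borel_measurable_integrable)
          show "AE x in lebesgue. complex_of_real ((x \<bullet> z) ^ k * h x) = ((x \<bullet> z) ^ k *\<^sub>R cl_complexify (f x)) $ B"
            using AE_completion [OF h_eq] by eventually_elim (simp only: vector_scaleR_component, simp add: cl_complexify_def scaleR_conv_of_real)
        qed
        also have "\<dots> = (\<integral>x. (x \<bullet> z) ^ k *\<^sub>R cl_complexify (f x) \<partial>lebesgue) $ B"
          by (rule integral_bounded_linear [OF bounded_linear_vec_nth int])
        finally show ?thesis by (simp add: moments)
      qed
    qed simp
    then have "AE x in lborel. f x $ B = 0" using h_eq by eventually_elim simp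
    then show ?thesis by (rule AE_completion)
  qed
  then have "AE x in lebesgue. \<forall>B\<in>UNIV. f x $ B = 0"
    by (intro AE_finite_allI) auto
  then show ?thesis by eventually_elim (simp add: vec_eq_iff)
qed

section \<open>The transform of a Gaussian\<close>

lemma exp_square_coeff_of_real: "exp_square_coeff (of_real b) k = of_real (exp_square_coeff b k)"
  by (simp add: exp_square_coeff_def)

text \<open>The k-th moment in direction y is a multiple of |y|^k for even k and zero for odd k, so
  each homogeneous part is radial and fixed by exp (c \<open>\<Gamma>\<close>). What remains is the
  classical Gaussian series.\<close>

lemma kernel_integral_gaussian:
  fixes a :: "'n::{finite,linorder} cclifford" and y :: "'n point"
  assumes "p > 0" and c: "Re c = 0"
  shows "(\<integral>x. cft_kernel c x y \<odot> (exp (- p * (norm x)\<^sup>2) *\<^sub>R a) \<partial>lebesgue) =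
    (gauss_mass TYPE('n point) p * exp (- (norm y)\<^sup>2 / (4 * p))) *\<^sub>R a"
proof -
  define \<phi> where "\<phi> x = exp (- p * (norm x)\<^sup>2) *\<^sub>R a" for x :: "'n point"
  interpret gaussian_bounded \<phi> p "norm a"
  proof
    have "(\<lambda>x::'n point. exp (- p * (norm x)\<^sup>2)) \<in> borel_measurable lebesgue"
      by (rule measurable_completion) measurable
    then show "\<phi> \<in> borel_measurable lebesgue" unfolding \<phi>_def [abs_def] by measurable
  qed (auto simp: \<phi>_def \<open>p > 0\<close>)
  define \<kappa> where "\<kappa> = gauss_mass TYPE('n point) p"
  define b where "b y = (norm y)\<^sup>2 / (4 * p)" for y :: "'n point"
  have moments: "tens_eval k (\<lambda>w. ((- \<i>) ^ k / fact k) *s moment_tensor \<phi> w) y =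
      ((- \<i>) ^ k * of_real (\<kappa> * exp_square_coeff (b y) k)) *s a" for k y
  proof -
    have "tens_eval k (moment_tensor \<phi>) y = (\<integral>x. ((x \<bullet> y) ^ k * exp (- p * (norm x)\<^sup>2)) *\<^sub>R a \<partial>lebesgue)"
      by (simp add: tens_eval_moment_tensor \<phi>_def)
    also have "\<dots> = (\<integral>x. (x \<bullet> y) ^ k * exp (- p * (norm x)\<^sup>2) \<partial>lebesgue) *\<^sub>R a"
    proof (rule integral_scaleR_left)
      show "integrable lebesgue (\<lambda>x. (x \<bullet> y) ^ k * exp (- p * (norm x)\<^sup>2))"
        using gaussian_moment_integrable [OF \<open>p > 0\<close>, of y k] by (subst integrable_completion) auto
    qed
    also have "(\<integral>x. (x \<bullet> y) ^ k * exp (- p * (norm x)\<^sup>2) \<partial>lebesgue) =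
        (\<integral>x. (x \<bullet> y) ^ k * exp (- p * (norm x)\<^sup>2) \<partial>lborel)"
      by (rule integral_completion) measurable
    also have "\<dots> = fact k * (\<kappa> * exp_square_coeff (b y) k)"
      using gaussian_moment [OF \<open>p > 0\<close>, of y k] by (simp add: \<kappa>_def b_def field_simps)
    finally show ?thesis
      by (simp add: tens_eval_linear [OF linear_smult] scaleR_conv_smult vector_smult_assoc)
  qed
  have coeff: "cft_coeff c \<phi> k y = ((- \<i>) ^ k * of_real (\<kappa> * exp_square_coeff (b y) k)) *s a" for k y
  proof -
    define T where "T = tens_eval k (\<lambda>w. ((- \<i>) ^ k / fact k) *s moment_tensor \<phi> w)"
    have T: "T y = ((- \<i>) ^ k * of_real (\<kappa> * exp_square_coeff (b y) k)) *s a" for y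
      unfolding T_def by (rule moments)
    have "gamma_op T = (\<lambda>_. 0)"
    proof (cases "even k")
      case True
      define v where "v = ((- \<i>) ^ k * of_real (\<kappa> * ((1 / (4 * p)) ^ (k div 2) / fact (k div 2)))) *s a"
      have "exp_square_coeff (b y) k = (y \<bullet> y) ^ (k div 2) * ((1 / (4 * p)) ^ (k div 2) / fact (k div 2))" for y
        using True by (simp add: exp_square_coeff_def b_def power2_norm_eq_inner power_divide)
      then have "T = (\<lambda>y. (y \<bullet> y) ^ (k div 2) *\<^sub>R v)"
        unfolding fun_eq_iff T v_def scaleR_conv_smult vector_smult_assoc by (simp only: of_real_mult mult_ac) simp
      then show ?thesis by (simp only: gamma_op_radial)
    next
      case False
      then have "T = (\<lambda>_. 0)" unfolding fun_eq_iff T by (simp add: exp_square_coeff_def)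
      then show ?thesis by (simp only: gamma_op_zero)
    qed
    from exp_gamma_of_kernel [OF this, of c] show ?thesis
      unfolding cft_coeff_def T_def [symmetric] by (simp only: T)
  qed
  have "(\<lambda>k. of_real \<kappa> * (exp_square_coeff (of_real (b y)) k * (- \<i>) ^ k)) sums (of_real \<kappa> * exp (of_real (b y) * (- \<i>)\<^sup>2))"
    by (intro sums_mult exp_square_sums)
  also have "of_real \<kappa> * exp (of_real (b y) * (- \<i>)\<^sup>2) = complex_of_real (\<kappa> * exp (- b y))"
    by (simp add: exp_of_real [symmetric])
  finally have "(\<lambda>k. ((- \<i>) ^ k * of_real (\<kappa> * exp_square_coeff (b y) k))) sums complex_of_real (\<kappa> * exp (- b y))"
    by (simp add: exp_square_coeff_of_real mult_ac)
  moreover have "bounded_linear (\<lambda>z. z *s a)"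
    unfolding linear_conv_bounded_linear [symmetric]
    by (rule linearI) (simp_all add: vec_eq_iff algebra_simps)
  ultimately have "(\<lambda>k. cft_coeff c \<phi> k y) sums (complex_of_real (\<kappa> * exp (- b y)) *s a)"
    unfolding coeff by (rule bounded_linear.sums [rotated])
  with kernel_integral_sums [OF c]
  have "(\<integral>x. cft_kernel c x y \<odot> \<phi> x \<partial>lebesgue) = complex_of_real (\<kappa> * exp (- b y)) *s a"
    by (rule sums_unique2)
  then show ?thesis by (simp add: \<phi>_def \<kappa>_def b_def scaleR_conv_smult)
qed

section \<open>The supercritical, critical and subcritical cases\<close>

lemma hardy_bounds_kernel_transformD:
  fixes f :: "'n::{finite,linorder} point \<Rightarrow> 'n clifford"
  assumes "hardy_bounds (kernel_transform K) p q f"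
  obtains C where "C > 0" "f \<in> borel_measurable lebesgue"
    "\<And>x. norm (f x) \<le> C * exp (- p * (norm x)\<^sup>2)"
    "\<And>y. norm (\<integral>x. K x y \<odot> cl_complexify (f x) \<partial>lebesgue) \<le> C * exp (- q * (norm y)\<^sup>2)"
proof -
  obtain C where C: "C > 0" and meas: "f \<in> borel_measurable lebesgue"
    and f: "\<And>x. norm (f x) \<le> C * exp (- p * (norm x)\<^sup>2)"
    and F: "\<And>y. norm (kernel_transform K f y) \<le> C * exp (- q * (norm y)\<^sup>2)"
    using assms by (auto simp: hardy_bounds_def)
  define N where "N = (2 * pi) powr (- real CARD('n) / 2)"
  have "N > 0" by (simp add: N_def)
  define C' where "C' = max C (C / N)"
  show ?thesis
  proof
    show "C' > 0" using C by (simp add: C'_def)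
    show "f \<in> borel_measurable lebesgue" by fact
    show "norm (f x) \<le> C' * exp (- p * (norm x)\<^sup>2)" for x
      using f by (rule order.trans) (simp add: C'_def)
    show "norm (\<integral>x. K x y \<odot> cl_complexify (f x) \<partial>lebesgue) \<le> C' * exp (- q * (norm y)\<^sup>2)" for y
    proof -
      have "norm (\<integral>x. K x y \<odot> cl_complexify (f x) \<partial>lebesgue) \<le> C / N * exp (- q * (norm y)\<^sup>2)"
      proof -
        have "norm (kernel_transform K f y) = N * norm (\<integral>x. K x y \<odot> cl_complexify (f x) \<partial>lebesgue)"
          by (simp add: kernel_transform_def N_def)
        with F [of y] \<open>N > 0\<close> show ?thesis by (simp add: pos_le_divide_eq mult.commute)
      qed
      also have "\<dots> \<le> C' * exp (- q * (norm y)\<^sup>2)" by (intro mult_right_mono) (auto simp: C'_def)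
      finally show ?thesis .
    qed
  qed
qed

lemma Hardy_AE_zero:
  assumes c: "Re c = 0" and "p > 0" and q: "1 / (4 * p) \<le> q"
    and f: "f \<in> borel_measurable lebesgue" "\<And>x. norm (f x) \<le> C * exp (- p * (norm x)\<^sup>2)"
    and decay: "\<And>y. norm (\<integral>x. cft_kernel c x y \<odot> cl_complexify (f x) \<partial>lebesgue) \<le> C' * exp (- q * (norm y)\<^sup>2)"
    and zero: "(\<integral>x. cl_complexify (f x) \<partial>lebesgue) = 0"
  shows "AE x in lebesgue. f x = 0"
proof -
  interpret gaussian_bounded "\<lambda>x. cl_complexify (f x)" p C
    by (rule gaussian_bounded_cl_complexify [OF f(1) \<open>p > 0\<close> f(2)])
  show ?thesis
    by (rule moments_zero_imp_AE_zero [OF f(1) \<open>p > 0\<close> f(2) Hardy_moments_zero [OF c q decay zero]])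
qed

lemma Hardy_supercritical:
  assumes c: "Re c = 0" and p: "p > 0" and q: "1 / (4 * p) < q"
    and f: "hardy_bounds (kernel_transform (cft_kernel c)) p q f"
  shows "AE x in lebesgue. f x = 0"
proof -
  obtain C where "C > 0" and C: "f \<in> borel_measurable lebesgue"
    "\<And>x. norm (f x) \<le> C * exp (- p * (norm x)\<^sup>2)"
    "\<And>y. norm (\<integral>x. cft_kernel c x y \<odot> cl_complexify (f x) \<partial>lebesgue) \<le> C * exp (- q * (norm y)\<^sup>2)"
    using hardy_bounds_kernel_transformD [OF f] by blast
  interpret gaussian_bounded "\<lambda>x. cl_complexify (f x)" p C
    by (rule gaussian_bounded_cl_complexify [OF C(1) p C(2)])
  show ?thesis
    by (rule Hardy_AE_zero [OF c p less_imp_le [OF q] C Hardy_integral_zero [OF c q C(3)]])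
qed

lemma Hardy_critical:
  fixes f :: "'n::{finite,linorder} point \<Rightarrow> 'n clifford"
  assumes c: "Re c = 0" and p: "p > 0" and q: "q = 1 / (4 * p)"
    and f: "hardy_bounds (kernel_transform (cft_kernel c)) p q f"
  shows "\<exists>A. AE x in lebesgue. f x = exp (- p * (norm x)\<^sup>2) *\<^sub>R A"
proof -
  obtain C where "C > 0" and C: "f \<in> borel_measurable lebesgue"
    "\<And>x. norm (f x) \<le> C * exp (- p * (norm x)\<^sup>2)"
    "\<And>y. norm (\<integral>x. cft_kernel c x y \<odot> cl_complexify (f x) \<partial>lebesgue) \<le> C * exp (- q * (norm y)\<^sup>2)"
    using hardy_bounds_kernel_transformD [OF f] by blast
  define \<kappa> where "\<kappa> = gauss_mass TYPE('n point) p"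
  have "\<kappa> > 0" unfolding \<kappa>_def by (rule gauss_mass_pos [OF p])
  \<comment> \<open>Division by \<open>\<kappa>\<close>, the integral of the Gaussian, makes g and f
    have the same integral. The difference satisfies the same bounds with larger constants and falls
    under \<open>Hardy_AE_zero\<close>.\<close>
  define A where "A = (1 / \<kappa>) *\<^sub>R (\<integral>x. f x \<partial>lebesgue)"
  define g where "g x = exp (- p * (norm x)\<^sup>2) *\<^sub>R A" for x :: "'n point"
  have g_meas: "g \<in> borel_measurable lebesgue"
  proof -
    have "(\<lambda>x::'n point. exp (- p * (norm x)\<^sup>2)) \<in> borel_measurable lebesgue"
      by (rule measurable_completion) measurable
    then show ?thesis unfolding g_def [abs_def] by measurable
  qed
  have g_le: "norm (g x) \<le> norm A * exp (- p * (norm x)\<^sup>2)" for x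
    by (simp add: g_def)
  interpret \<phi>: gaussian_bounded "\<lambda>x. cl_complexify (f x)" p C
    by (rule gaussian_bounded_cl_complexify [OF C(1) p C(2)])
  interpret \<gamma>: gaussian_bounded "\<lambda>x. cl_complexify (g x)" p "norm A"
    by (rule gaussian_bounded_cl_complexify [OF g_meas p g_le])
  have int_f: "integrable lebesgue f"
    using \<phi>.integrable_power_weight [OF C(1), of 1 0] by simp
  have int_gauss: "integrable lebesgue (\<lambda>x::'n point. exp (- p * (norm x)\<^sup>2))"
    using integrable_gaussian [OF p, where 'a = "'n point"] by (subst integrable_completion) auto
  have int_g: "integrable lebesgue g"
    unfolding g_def [abs_def] using int_gauss by (rule integrable_scaleR_left)
  have "(\<integral>x. g x \<partial>lebesgue) = (\<integral>x. exp (- p * (norm x)\<^sup>2) \<partial>(lebesgue :: 'n point measure)) *\<^sub>R A"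
    unfolding g_def by (rule integral_scaleR_left [OF int_gauss])
  also have "(\<integral>x. exp (- p * (norm x)\<^sup>2) \<partial>(lebesgue :: 'n point measure)) = \<kappa>"
    unfolding \<kappa>_def gauss_mass_def by (rule integral_completion) measurable
  finally have total: "(\<integral>x. g x \<partial>lebesgue) = (\<integral>x. f x \<partial>lebesgue)"
    using \<open>\<kappa> > 0\<close> by (simp add: A_def)
  have "AE x in lebesgue. f x - g x = 0"
  proof (rule Hardy_AE_zero [OF c p, of q])
    show "1 / (4 * p) \<le> q" by (simp add: q)
    show "(\<lambda>x. f x - g x) \<in> borel_measurable lebesgue" using C(1) g_meas by measurable
    show "norm (f x - g x) \<le> (C + norm A) * exp (- p * (norm x)\<^sup>2)" for x
      using norm_triangle_ineq4 [of "f x" "g x"] C(2) [of x] g_le [of x] by (simp add: algebra_simps)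
    show "(\<integral>x. cl_complexify (f x - g x) \<partial>lebesgue) = 0"
      using integral_bounded_linear [OF bounded_linear_cl_complexify Bochner_Integration.integrable_diff [OF int_f int_g]]
      by (simp add: total Bochner_Integration.integral_diff [OF int_f int_g] cl_complexify_def vec_eq_iff)
    show "norm (\<integral>x. cft_kernel c x y \<odot> cl_complexify (f x - g x) \<partial>lebesgue) \<le>
        (C + \<kappa> * norm A) * exp (- q * (norm y)\<^sup>2)" for y
    proof -
      have "(\<integral>x. cft_kernel c x y \<odot> cl_complexify (f x - g x) \<partial>lebesgue) =
          (\<integral>x. cft_kernel c x y \<odot> cl_complexify (f x) \<partial>lebesgue) -
          (\<integral>x. cft_kernel c x y \<odot> cl_complexify (g x) \<partial>lebesgue)"
        unfolding cl_complexify_simps cl_mult.diff_right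
        by (intro Bochner_Integration.integral_diff \<phi>.integrable_kernel \<gamma>.integrable_kernel c)
      \<comment> \<open>Here q = 1/(4p) enters: the transform of g decays at exactly the rate
        required of the difference.\<close>
      also have "(\<integral>x. cft_kernel c x y \<odot> cl_complexify (g x) \<partial>lebesgue) =
          (\<kappa> * exp (- q * (norm y)\<^sup>2)) *\<^sub>R cl_complexify A"
        unfolding g_def cl_complexify_simps kernel_integral_gaussian [OF p c] by (simp add: \<kappa>_def q)
      finally have "norm (\<integral>x. cft_kernel c x y \<odot> cl_complexify (f x - g x) \<partial>lebesgue) \<le>
          C * exp (- q * (norm y)\<^sup>2) + norm ((\<kappa> * exp (- q * (norm y)\<^sup>2)) *\<^sub>R cl_complexify A)"
        by (simp only:) (rule order.trans [OF norm_triangle_ineq4 add_right_mono [OF C(3)]])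
      then show ?thesis using \<open>\<kappa> > 0\<close> by (simp add: algebra_simps abs_mult)
    qed
  qed
  then show ?thesis by (intro exI [of _ A]) (simp add: g_def)
qed

text \<open>The natural multiples of one Gaussian suffice, since their transforms decay at the rate
  1/(4p), which exceeds q.\<close>

lemma Hardy_subcritical:
  assumes c: "Re c = 0" and p: "p > 0" and q: "q < 1 / (4 * p)"
  shows "infinite ({f :: 'n::{finite,linorder} point \<Rightarrow> 'n clifford.
    hardy_bounds (kernel_transform (cft_kernel c)) p q f} // ae_equal)"
proof -
  define g :: "nat \<Rightarrow> 'n point \<Rightarrow> 'n clifford"
    where "g n x = exp (- p * (norm x)\<^sup>2) *\<^sub>R (real n *\<^sub>R blade {})" for n x
  define N where "N = (2 * pi) powr (- real CARD('n) / 2)"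
  define \<kappa> where "\<kappa> = gauss_mass TYPE('n point) p"
  have "\<kappa> > 0" unfolding \<kappa>_def by (rule gauss_mass_pos [OF p])
  have "N > 0" by (simp add: N_def)
  have nb: "norm (blade {} :: 'n clifford) = 1" by (simp add: blade_def)
  have mem: "hardy_bounds (kernel_transform (cft_kernel c)) p q (g n)" for n
    unfolding hardy_bounds_def
  \<comment> \<open>The first summand bounds \<open>g n\<close>, the second its transform, and 1
    keeps the constant positive for n = 0.\<close>
  proof (intro conjI exI [of _ "real n + N * \<kappa> * real n + 1"] allI)
    have "(\<lambda>x::'n point. exp (- p * (norm x)\<^sup>2)) \<in> borel_measurable lebesgue"
      by (rule measurable_completion) measurable
    then show "g n \<in> borel_measurable lebesgue" unfolding g_def [abs_def] by measurable
    show "0 < real n + N * \<kappa> * real n + 1" using \<open>N > 0\<close> \<open>\<kappa> > 0\<close> by (simp add: add_nonneg_pos)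
    show "norm (g n x) \<le> (real n + N * \<kappa> * real n + 1) * exp (- p * (norm x)\<^sup>2)" for x
      using \<open>N > 0\<close> \<open>\<kappa> > 0\<close> by (simp add: g_def nb mult.commute mult_right_mono)
    show "norm (kernel_transform (cft_kernel c) (g n) y) \<le> (real n + N * \<kappa> * real n + 1) * exp (- q * (norm y)\<^sup>2)" for y
    proof -
      have "kernel_transform (cft_kernel c) (g n) y =
          N *\<^sub>R (\<kappa> * exp (- (norm y)\<^sup>2 / (4 * p))) *\<^sub>R cl_complexify (real n *\<^sub>R blade {})"
        unfolding kernel_transform_def g_def cl_complexify_simps(2) [of "exp _"] kernel_integral_gaussian [OF p c]
        by (simp add: N_def \<kappa>_def)
      then have "norm (kernel_transform (cft_kernel c) (g n) y) = N * \<kappa> * real n * exp (- (norm y)\<^sup>2 / (4 * p))"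
        using \<open>N > 0\<close> \<open>\<kappa> > 0\<close> by (simp add: nb abs_mult)
      also have "\<dots> \<le> (real n + N * \<kappa> * real n + 1) * exp (- q * (norm y)\<^sup>2)"
        using \<open>N > 0\<close> \<open>\<kappa> > 0\<close> mult_right_mono [OF less_imp_le [OF q], of "(norm y)\<^sup>2"]
        by (intro mult_mono) auto
      finally show ?thesis .
    qed
  qed
  have inj: "inj (\<lambda>n. ae_equal `` {g n})"
  proof (rule injI)
    fix m n assume "ae_equal `` {g m} = ae_equal `` {g n}"
    then have "g n \<in> ae_equal `` {g m}" by (simp add: ae_equal_def)
    then have "AE x in lebesgue. g m x = g n x" by (simp add: ae_equal_def)
    \<comment> \<open>The Gaussian has no zeros, so equality at a single point forces m = n; such a
      point exists because the space is not a null set.\<close>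
    then have "AE x in (lebesgue :: 'n point measure). m = n"
      by eventually_elim (use nb in \<open>auto simp: g_def\<close>)
    then show "m = n"
      by (cases "m = n") (simp_all add: AE_iff_null null_sets_def)
  qed
  have "range (\<lambda>n. ae_equal `` {g n}) \<subseteq> {f. hardy_bounds (kernel_transform (cft_kernel c)) p q f} // ae_equal"
    using mem by (auto intro: quotientI)
  with range_inj_infinite [OF inj] show ?thesis by (rule infinite_super [rotated])
qed

theorem theorem5p1:
  fixes p q :: real
    and F :: "('n::{finite,linorder} point \<Rightarrow> 'n clifford) \<Rightarrow> 'n point \<Rightarrow> 'n cclifford"
  assumes "even CARD('n)"
    and "p > 0" and "q > 0"
    and "F = cft_plus \<or> F = cft_minus"
  shows "(p * q > 1 / 4 \<longrightarrow>
            (\<forall>f. hardy_bounds F p q f \<longrightarrow> (AE x in lebesgue. f x = 0))) \<and>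
         (p * q = 1 / 4 \<longrightarrow>
            (\<forall>f. hardy_bounds F p q f \<longrightarrow>
              (\<exists>A. AE x in lebesgue. f x = exp (- p * (norm x)\<^sup>2) *\<^sub>R A))) \<and>
         (p * q < 1 / 4 \<longrightarrow> infinite ({f. hardy_bounds F p q f} // ae_equal))"
proof -
  \<comment> \<open>Both signs give a purely imaginary c, which is the form in which the lemmas
    treat the two transforms together.\<close>
  have "\<exists>c. Re c = 0 \<and> F = kernel_transform (cft_kernel c)"
    using assms(4)
  proof
    assume "F = cft_plus"
    then show ?thesis
      by (intro exI [of _ "- \<i> * complex_of_real (pi / 2)"]) (simp add: cft_plus_def cft_kernel_plus_def)
  next
    assume "F = cft_minus"
    then show ?thesis
      by (intro exI [of _ "\<i> * complex_of_real (pi / 2)"]) (simp add: cft_minus_def cft_kernel_minus_def)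
  qed
  then obtain c where c: "Re c = 0" and F: "F = kernel_transform (cft_kernel c)" by blast
  show ?thesis unfolding F
  proof (intro conjI impI allI)
    fix f :: "'n point \<Rightarrow> 'n clifford"
    assume "p * q > 1 / 4" and f: "hardy_bounds (kernel_transform (cft_kernel c)) p q f"
    then have "1 / (4 * p) < q" using \<open>p > 0\<close> by (simp add: field_simps)
    then show "AE x in lebesgue. f x = 0" by (rule Hardy_supercritical [OF c \<open>p > 0\<close> _ f])
  next
    fix f :: "'n point \<Rightarrow> 'n clifford"
    assume "p * q = 1 / 4" and f: "hardy_bounds (kernel_transform (cft_kernel c)) p q f"
    then have "q = 1 / (4 * p)" using \<open>p > 0\<close> by (simp add: field_simps)
    then show "\<exists>A. AE x in lebesgue. f x = exp (- p * (norm x)\<^sup>2) *\<^sub>R A"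
      by (rule Hardy_critical [OF c \<open>p > 0\<close> _ f])
  next
    assume "p * q < 1 / 4"
    then have "q < 1 / (4 * p)" using \<open>p > 0\<close> by (simp add: field_simps)
    then show "infinite ({f :: 'n point \<Rightarrow> 'n clifford. hardy_bounds (kernel_transform (cft_kernel c)) p q f} // ae_equal)"
      by (rule Hardy_subcritical [OF c \<open>p > 0\<close>])
  qed
qed

end
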